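(* The generating function of square lattice walks starting at $(-1,0)$ and confined to the cone $\mathcal C=\{(i,j)\in\mathbb Z^2:i\ge0\text{ or }j\ge0\}$ is algebraic. Let $P(x,y)$ (resp. $\bar xL(\bar x,y)$, $\bar yB(x,\bar y)$) denote the generating function of such walks ending in the first quadrant $i\ge 0,j\ge0$ (resp. at a negative abscissa, at a negative ordinate). These three series are algebraic of degree $72$ over $\mathbb Q(x,y,t)$. More precisely, $P$ can be expressed in terms of $L$ and $B$ by $$P(x,y)=\bar x\big(L(x,y)-L(0,y)\big)+\bar y\big(B(x,y)-B(x,0)\big),$$ the series $L$ and $B$ satisfy $$\begin{aligned}\big(1-t(x+\bar x+y+\bar y)\big)\big(2L(x,y)-L(0,y)\big)=\;&1-2t\bar yL(x,0)+t(x-\bar x)L(0,y)\\&+t\bar yB(0,y)+t\bar yL_{0,0}-t\bar yB_{0,0}\end{aligned}$$ and $$\begin{aligned}\big(1-t(x+\bar x+y+\bar y)\big)\big(2B(x,y)-B(x,0)\big)=\;&t(y-\bar y)B(x,0)-2t\bar xB(0,y)\\&+t\bar xL(x,0)-t\bar xL_{0,0}+t\bar xB_{0,0},\end{aligned}$$ where $L_{0,0}=L(0,0)$ and $B_{0,0}=B(0,0)$, and each specialization $L(x,0)$, $L(0,x)$, $B(x,0)$ and $B(0,x)$ has degree $24$ over $\mathbb Q(t,x)$. Moreover, these algebraic series have rational parametrizations. Let $T$ be the unique series in $t$ with constant term $1$ satisfying $T=1+256\,t^2\frac{T^3}{(T+3)^3}$, let $Z=\sqrt T$, and let $U$ be the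 only power series in $t$ with constant term $1$ (and coefficients in $\mathbb Q[x]$) satisfying $$16T^2(U^2-T)=x(U+UT-2T)(U^2-9T+8TU+T^2-TU^2).$$ Then the series $L(xt,0)$, $L(0,xt)$, $B(xt,0)$, $B(0,xt)$ admit rational expressions in terms of $Z$ and $U$, given (note that $x$ is rational in $Z$ and $U$) by $$L(xt,0)=\frac{256Z^4(UZ^2-2Z^2+U)}{(UZ+Z^2+U-3Z)(U+Z)(Z-1)(Z^2+3)^3},$$ $$xL(0,xt)=\frac{256Z^6(U-Z)(UZ-Z^2-U-3Z)(U^2Z^2-Z^4-4UZ^2+U^2+3Z^2)}{D(Z,U)(Z-1)(Z^2+3)^3},$$ $$xB(xt,0)=-\frac{512Z^6(UZ^2-2Z^2+U)(U-Z)N_1(Z,U)}{(Z^2-1)(Z^2+3)^3D(Z,U)},$$ $$B(0,xt)=\frac{16Z^2(UZ^2-2Z^2+U)N_2(Z,U)}{(U+Z)(1-Z^2)(Z^2+3)^3(UZ-Z^2-U-3Z)},$$ with $$D(z,u)=z^8-2(u-2)(u-6)z^6+(u-3)(u^3+3u^2-15u+3)z^4-6u^2z^2-u^4,$$ $$N_1(z,u)=z^4+2(u-3)z^3+(u+1)(u-3)z^2-u^2,$$ $$N_2(z,u)=(z+1)(z-1)^2u^2-4z(3z+1)(z-1)u-z^2(z^3+3z^2-25z-11).$$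
   Context: Notation: $\bar x=1/x$, $\bar y=1/y$. Square lattice walks take steps in $\{(1,0),(-1,0),(0,1),(0,-1)\}$; a walk is confined to a set if all its vertices lie in it. The generating function of a family of walks is $\sum t^nx^iy^j$ over the walks in the family, where $n$ is the length and $(i,j)$ the endpoint (dependence on $t$ is omitted from the notation). The series $P(x,y)$, $L(x,y)$, $B(x,y)$ are power series in $t$ with coefficients in $\mathbb Q[x,y]$. "Algebraic of degree $d$" over a field means algebraic with minimal polynomial of degree $d$ over that field. *)

theory Defs
  imports
    "HOL-Computational_Algebra.Computational_Algebra"
    "HOL-Library.Product_Plus"
begin

section \<open>Walks\<close>

definition steps :: "(int \<times> int) set" where
  "steps = {(1,0), (-1,0), (0,1), (0,-1)}"

definition cone :: "(int \<times> int) set" where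
  "cone = {(i,j). i \<ge> 0 \<or> j \<ge> 0}"

text \<open>A walk is the list of its vertices; a walk of length \<open>n\<close> has \<open>n + 1\<close> vertices.\<close>

definition cone_walks :: "(int \<times> int) list set" where
  "cone_walks = {w. w \<noteq> [] \<and> hd w = (-1,0) \<and> successively (\<lambda>u v. v - u \<in> steps) w \<and> set w \<subseteq> cone}"

definition quadrant_walks :: "(int \<times> int) list set" where
  "quadrant_walks = {w \<in> cone_walks. fst (last w) \<ge> 0 \<and> snd (last w) \<ge> 0}"

definition left_walks :: "(int \<times> int) list set" where
  "left_walks = {w \<in> cone_walks. fst (last w) < 0}"

definition below_walks :: "(int \<times> int) list set" where
  "below_walks = {w \<in> cone_walks. snd (last w) < 0}"

definition of_length :: "nat \<Rightarrow> (int \<times> int) list set \<Rightarrow> (int \<times> int) list set" where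
  "of_length n W = {w \<in> W. length w = Suc n}"


section \<open>Generating functions\<close>

text \<open>
  \<open>rat poly poly\<close> is \<open>\<rat>[x,y]\<close> with \<open>x\<close> the inner and \<open>y\<close> the outer variable, and \<open>qxy\<close> is
  \<open>\<rat>(x,y)\<close>. All series are eventually compared in \<open>qxy fps\<close>, i.e. \<open>\<rat>(x,y)[[t]]\<close>, or in the
  field \<open>qxy fls\<close>, i.e. \<open>\<rat>(x,y)((t))\<close>.
\<close>

type_synonym qxy = "rat poly poly fract"

definition emb_poly :: "rat poly poly \<Rightarrow> qxy" where
  "emb_poly p = Fract p 1"

definition vx :: "qxy fps" where "vx = fps_const (emb_poly [:[:0, 1:]:])"
definition vy :: "qxy fps" where "vy = fps_const (emb_poly [:0, 1:])"
abbreviation vt :: "qxy fps" where "vt \<equiv> fps_X"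

definition gf :: "(int \<times> int) list set \<Rightarrow> qxy fps" where
  "gf W = Abs_fps (\<lambda>n. \<Sum>w\<in>of_length n W.
     (emb_poly [:[:0, 1:]:]) powi (fst (last w)) * (emb_poly [:0, 1:]) powi (snd (last w)))"

definition P_series :: "rat poly poly fps" where
  "P_series = Abs_fps (\<lambda>n. \<Sum>w\<in>of_length n quadrant_walks.
     monom (monom 1 (nat (fst (last w)))) (nat (snd (last w))))"

text \<open>
  \<open>L_series\<close> and \<open>B_series\<close> are the series \<open>L(x,y)\<close> and \<open>B(x,y)\<close> for which
  \<open>x\<inverse> L(x\<inverse>,y)\<close> and \<open>y\<inverse> B(x,y\<inverse>)\<close> count the walks ending at a negative abscissa and ordinate
  (lemmas \<open>left_walks_gf\<close> and \<open>below_walks_gf\<close>).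
\<close>

definition L_series :: "rat poly poly fps" where
  "L_series = Abs_fps (\<lambda>n. \<Sum>w\<in>of_length n left_walks.
     monom (monom 1 (nat (- 1 - fst (last w)))) (nat (snd (last w))))"

definition B_series :: "rat poly poly fps" where
  "B_series = Abs_fps (\<lambda>n. \<Sum>w\<in>of_length n below_walks.
     monom (monom 1 (nat (fst (last w)))) (nat (- 1 - snd (last w))))"

definition emb_rat :: "rat \<Rightarrow> qxy fps" where
  "emb_rat c = fps_const (emb_poly [:[:c:]:])"

definition poly2 :: "rat poly poly \<Rightarrow> qxy fps \<Rightarrow> qxy fps \<Rightarrow> qxy fps" where
  "poly2 p a b = poly (map_poly (\<lambda>q. poly (map_poly emb_rat q) a) p) b"

text \<open>
  \<open>S(a,b) = \<Sum>\<^sub>m t\<^sup>m S\<^sub>m(a,b)\<close>, where \<open>S\<^sub>m\<close> is the coefficient of \<open>t\<^sup>m\<close> in \<open>S\<close>. The arguments may be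
  arbitrary power series in \<open>t\<close>, so this also covers substitutions such as \<open>x \<mapsto> xt\<close>.
\<close>

definition subst_xy :: "rat poly poly fps \<Rightarrow> qxy fps \<Rightarrow> qxy fps \<Rightarrow> qxy fps" where
  "subst_xy S a b = Abs_fps (\<lambda>n. \<Sum>m\<le>n. fps_nth (poly2 (fps_nth S m) a b) (n - m))"

abbreviation P :: "qxy fps \<Rightarrow> qxy fps \<Rightarrow> qxy fps" where "P \<equiv> subst_xy P_series"
abbreviation L :: "qxy fps \<Rightarrow> qxy fps \<Rightarrow> qxy fps" where "L \<equiv> subst_xy L_series"
abbreviation B :: "qxy fps \<Rightarrow> qxy fps \<Rightarrow> qxy fps" where "B \<equiv> subst_xy B_series"

lemma emb_poly_add: "emb_poly (p + q) = emb_poly p + emb_poly q"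
  by (simp add: emb_poly_def)

lemma emb_poly_mult: "emb_poly (p * q) = emb_poly p * emb_poly q"
  by (simp add: emb_poly_def)

lemma emb_poly_0 [simp]: "emb_poly 0 = 0"
  by (simp add: emb_poly_def Zero_fract_def)

lemma emb_poly_1 [simp]: "emb_poly 1 = 1"
  by (simp add: emb_poly_def One_fract_def)

lemma emb_rat_0 [simp]: "emb_rat 0 = 0"
  by (simp add: emb_rat_def)

lemma emb_rat_1 [simp]: "emb_rat 1 = 1"
  by (simp add: emb_rat_def flip: one_pCons)

lemma emb_rat_add: "emb_rat (c + d) = emb_rat c + emb_rat d"
  by (simp add: emb_rat_def flip: emb_poly_add)

lemma poly2_0 [simp]: "poly2 0 a b = 0"
  by (simp add: poly2_def)

lemma poly2_add: "poly2 (p + q) a b = poly2 p a b + poly2 q a b"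
proof -
  have 1: "map_poly emb_rat (r + s) = map_poly emb_rat r + map_poly emb_rat s" for r s
    by (intro poly_eqI) (simp add: coeff_map_poly emb_rat_add)
  have "map_poly (\<lambda>q. poly (map_poly emb_rat q) a) (p + q) =
      map_poly (\<lambda>q. poly (map_poly emb_rat q) a) p + map_poly (\<lambda>q. poly (map_poly emb_rat q) a) q"
    by (intro poly_eqI) (simp add: coeff_map_poly 1)
  then show ?thesis
    by (simp add: poly2_def)
qed

lemma poly2_sum: "poly2 (sum f A) a b = (\<Sum>w\<in>A. poly2 (f w) a b)"
  by (induction A rule: infinite_finite_induct) (simp_all add: poly2_add)

lemma poly2_monom: "poly2 (monom (monom 1 i) j) a b = a ^ i * b ^ j"
  by (simp add: poly2_def map_poly_monom poly_monom)

lemma subst_xy_const: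
  assumes "\<And>m. fps_nth S m = (\<Sum>w\<in>A m. monom (monom 1 (e w)) (f w))"
  shows "subst_xy S (fps_const a) (fps_const b) = Abs_fps (\<lambda>n. \<Sum>w\<in>A n. a ^ e w * b ^ f w)"
proof (rule fps_ext)
  fix n
  have *: "poly2 (fps_nth S m) (fps_const a) (fps_const b) = fps_const (\<Sum>w\<in>A m. a ^ e w * b ^ f w)" for m
    by (simp add: assms poly2_sum poly2_monom fps_const_power fps_eq_iff fps_sum_nth)
  have "(\<Sum>m\<le>n. fps_nth (poly2 (fps_nth S m) (fps_const a) (fps_const b)) (n - m)) =
      (\<Sum>m\<in>{n}. \<Sum>w\<in>A m. a ^ e w * b ^ f w)"
    unfolding * by (intro sum.mono_neutral_cong_right) auto
  then show "fps_nth (subst_xy S (fps_const a) (fps_const b)) n =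
      fps_nth (Abs_fps (\<lambda>n. \<Sum>w\<in>A n. a ^ e w * b ^ f w)) n"
    by (simp add: subst_xy_def)
qed

lemma last_in_cone:
  assumes "w \<in> cone_walks"
  shows "fst (last w) \<ge> 0 \<or> snd (last w) \<ge> 0"
proof -
  have "last w \<in> cone"
    using assms by (auto simp: cone_walks_def)
  then show ?thesis
    by (auto simp: cone_def)
qed

lemma emb_var_nonzero: "emb_poly [:[:0, 1:]:] \<noteq> 0" "emb_poly [:0, 1:] \<noteq> 0"
  by (simp_all add: emb_poly_def Zero_fract_def eq_fract)

lemma quadrant_walks_gf: "P vx vy = gf quadrant_walks"
proof -
  have "P vx vy = Abs_fps (\<lambda>n. \<Sum>w\<in>of_length n quadrant_walks.
      emb_poly [:[:0, 1:]:] ^ nat (fst (last w)) * emb_poly [:0, 1:] ^ nat (snd (last w)))"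
    unfolding vx_def vy_def by (rule subst_xy_const) (simp add: P_series_def)
  also have "\<dots> = gf quadrant_walks"
    unfolding gf_def
    by (intro arg_cong[of _ _ Abs_fps] ext sum.cong)
       (auto simp: of_length_def quadrant_walks_def power_int_def)
  finally show ?thesis .
qed

lemma left_walks_gf: "inverse vx * L (inverse vx) vy = gf left_walks"
proof -
  let ?x = "emb_poly [:[:0, 1:]:]" and ?y = "emb_poly [:0, 1:]"
  have "L (inverse vx) vy = Abs_fps (\<lambda>n. \<Sum>w\<in>of_length n left_walks.
      inverse ?x ^ nat (- 1 - fst (last w)) * ?y ^ nat (snd (last w)))"
    unfolding vx_def vy_def fps_const_inverse by (rule subst_xy_const) (simp add: L_series_def)
  then have "fps_nth (inverse vx * L (inverse vx) vy) n = (\<Sum>w\<in>of_length n left_walks.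
      inverse ?x * (inverse ?x ^ nat (- 1 - fst (last w)) * ?y ^ nat (snd (last w))))" for n
    by (simp add: vx_def sum_distrib_left fps_const_inverse)
  also have "\<dots> n = fps_nth (gf left_walks) n" for n
    unfolding gf_def fps_nth_Abs_fps
  proof (intro sum.cong refl)
    fix w assume "w \<in> of_length n left_walks"
    then have w: "fst (last w) < 0" "snd (last w) \<ge> 0"
      using last_in_cone[of w] by (auto simp: of_length_def left_walks_def)
    then have "nat (- fst (last w)) = Suc (nat (- 1 - fst (last w)))"
      by linarith
    with w show "inverse ?x * (inverse ?x ^ nat (- 1 - fst (last w)) * ?y ^ nat (snd (last w))) =
        ?x powi fst (last w) * ?y powi snd (last w)"
      by (simp add: power_int_def mult.assoc)
  qed
  finally show ?thesis
    by (simp add: fps_eq_iff)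
qed

lemma below_walks_gf: "inverse vy * B vx (inverse vy) = gf below_walks"
proof -
  let ?x = "emb_poly [:[:0, 1:]:]" and ?y = "emb_poly [:0, 1:]"
  have "B vx (inverse vy) = Abs_fps (\<lambda>n. \<Sum>w\<in>of_length n below_walks.
      ?x ^ nat (fst (last w)) * inverse ?y ^ nat (- 1 - snd (last w)))"
    unfolding vx_def vy_def fps_const_inverse by (rule subst_xy_const) (simp add: B_series_def)
  then have "fps_nth (inverse vy * B vx (inverse vy)) n = (\<Sum>w\<in>of_length n below_walks.
      inverse ?y * (?x ^ nat (fst (last w)) * inverse ?y ^ nat (- 1 - snd (last w))))" for n
    by (simp add: vy_def sum_distrib_left fps_const_inverse)
  also have "\<dots> n = fps_nth (gf below_walks) n" for n
    unfolding gf_def fps_nth_Abs_fps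
  proof (intro sum.cong refl)
    fix w assume "w \<in> of_length n below_walks"
    then have w: "snd (last w) < 0" "fst (last w) \<ge> 0"
      using last_in_cone[of w] by (auto simp: of_length_def below_walks_def)
    then have "nat (- snd (last w)) = Suc (nat (- 1 - snd (last w)))"
      by linarith
    with w show "inverse ?y * (?x ^ nat (fst (last w)) * inverse ?y ^ nat (- 1 - snd (last w))) =
        ?x powi fst (last w) * ?y powi snd (last w)"
      by (simp add: power_int_def algebra_simps)
  qed
  finally show ?thesis
    by (simp add: fps_eq_iff)
qed


section \<open>Algebraic elements over subfields\<close>

text \<open>
  The subfield generated by a set. It contains the prime field, so in characteristic 0
  \<open>gen_field {a, b}\<close> is \<open>\<rat>(a,b)\<close>.
\<close>

inductive_set gen_field :: "'a::field set \<Rightarrow> 'a set" for S where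
  gen_field_base: "a \<in> S \<Longrightarrow> a \<in> gen_field S"
| gen_field_one: "1 \<in> gen_field S"
| gen_field_diff: "a \<in> gen_field S \<Longrightarrow> b \<in> gen_field S \<Longrightarrow> a - b \<in> gen_field S"
| gen_field_mult: "a \<in> gen_field S \<Longrightarrow> b \<in> gen_field S \<Longrightarrow> a * b \<in> gen_field S"
| gen_field_inverse: "a \<in> gen_field S \<Longrightarrow> inverse a \<in> gen_field S"

definition annihilates :: "'a::field set \<Rightarrow> 'a poly \<Rightarrow> 'a \<Rightarrow> bool" where
  "annihilates k p a \<longleftrightarrow> p \<noteq> 0 \<and> (\<forall>i. coeff p i \<in> k) \<and> poly p a = 0"

definition algebraic_over :: "'a::field set \<Rightarrow> 'a \<Rightarrow> bool" where
  "algebraic_over k a \<longleftrightarrow> (\<exists>p. annihilates k p a)"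

definition minimal_poly :: "'a::field set \<Rightarrow> 'a \<Rightarrow> 'a poly \<Rightarrow> bool" where
  "minimal_poly k a p \<longleftrightarrow>
     annihilates k p a \<and> lead_coeff p = 1 \<and> (\<forall>q. annihilates k q a \<longrightarrow> degree p \<le> degree q)"

definition algebraic_of_degree :: "'a::field set \<Rightarrow> 'a \<Rightarrow> nat \<Rightarrow> bool" where
  "algebraic_of_degree k a d \<longleftrightarrow> (\<exists>p. minimal_poly k a p \<and> degree p = d)"

definition Q_xyt :: "qxy fls set" where
  "Q_xyt = gen_field {fps_to_fls vx, fps_to_fls vy, fps_to_fls vt}"

definition Q_xt :: "qxy fls set" where
  "Q_xt = gen_field {fps_to_fls vx, fps_to_fls vt}"


section \<open>The parametrization\<close>

definition is_T :: "rat fps \<Rightarrow> bool" where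
  "is_T T \<longleftrightarrow> fps_nth T 0 = 1 \<and> T = 1 + 256 * fps_X ^ 2 * (T ^ 3 / (T + 3) ^ 3)"

definition is_Z :: "rat fps \<Rightarrow> rat fps \<Rightarrow> bool" where
  "is_Z T Z \<longleftrightarrow> fps_nth Z 0 = 1 \<and> Z ^ 2 = T"

text \<open>Here \<open>U\<close> ranges over \<open>\<rat>[x][[t]]\<close>.\<close>

definition is_U :: "rat fps \<Rightarrow> rat poly fps \<Rightarrow> bool" where
  "is_U T U \<longleftrightarrow> fps_nth U 0 = 1 \<and>
     (let T = Abs_fps (\<lambda>n. [:fps_nth T n:]); x = fps_const [:0, 1:]
      in 16 * T ^ 2 * (U ^ 2 - T) =
         x * (U + U * T - 2 * T) * (U ^ 2 - 9 * T + 8 * T * U + T ^ 2 - T * U ^ 2))"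

definition lift_Q :: "rat fps \<Rightarrow> qxy fls" where
  "lift_Q f = fps_to_fls (Abs_fps (\<lambda>n. emb_poly [:[:fps_nth f n:]:]))"

definition lift_Qx :: "rat poly fps \<Rightarrow> qxy fls" where
  "lift_Qx f = fps_to_fls (Abs_fps (\<lambda>n. emb_poly [:fps_nth f n:]))"

definition poly_D :: "'a::comm_ring_1 \<Rightarrow> 'a \<Rightarrow> 'a" where
  "poly_D z u = z ^ 8 - 2 * (u - 2) * (u - 6) * z ^ 6
     + (u - 3) * (u ^ 3 + 3 * u ^ 2 - 15 * u + 3) * z ^ 4 - 6 * u ^ 2 * z ^ 2 - u ^ 4"

definition poly_N1 :: "'a::comm_ring_1 \<Rightarrow> 'a \<Rightarrow> 'a" where
  "poly_N1 z u = z ^ 4 + 2 * (u - 3) * z ^ 3 + (u + 1) * (u - 3) * z ^ 2 - u ^ 2"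

definition poly_N2 :: "'a::comm_ring_1 \<Rightarrow> 'a \<Rightarrow> 'a" where
  "poly_N2 z u = (z + 1) * (z - 1) ^ 2 * u ^ 2 - 4 * z * (3 * z + 1) * (z - 1) * u
     - z ^ 2 * (z ^ 3 + 3 * z ^ 2 - 25 * z - 11)"

end

theory Submission
  imports Defs
begin

text \<open>
  Let \<open>c(n,i,j)\<close> be the number of walks of length \<open>n\<close> in the cone from \<open>(-1,0)\<close> to \<open>(i,j)\<close>. The walks obey
  a reflection principle, \<open>c(n,i,j) = c(n,-i-2,j) + c(n,i,-j-2)\<close> for \<open>i, j \<ge> -1\<close> (\<open>cnt_reflection\<close>), which
  expresses \<open>P\<close> by \<open>L\<close> and \<open>B\<close>. It also eliminates \<open>P\<close> from the recurrences of the walks that end in the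
  other two quadrants; what remains are the functional equations of \<open>L\<close> and \<open>B\<close>.

  The left sides of these equations contain the kernel \<open>1 - t(x + 1/x + y + 1/y)\<close>. Let \<open>Y\<close> be the power
  series in \<open>t\<close> that cancels it when it is substituted for \<open>y\<close>. It also cancels the kernel at \<open>1/x\<close>. Adding
  the equations at \<open>x\<close> and at \<open>1/x\<close>, and likewise with the roles of \<open>x\<close> and \<open>y\<close> exchanged, leaves a system
  for the two univariate series \<open>A(x) = L(x,0)\<close> and \<open>C(x) = B(0,x)\<close> (\<open>series_system\<close>):
  \<open>A(x) + A(1/x) = Y/t + C(Y) + k\<close> and \<open>C(x) + C(1/x) = A(Y) - k\<close>, where \<open>k = A(0) - C(0)\<close>. This system
  has only one solution (\<open>kernel_system_unique\<close>): in a homogeneous solution the lowest coefficient \<open>p\<close>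
  satisfies \<open>p(x) + p(1/x) = p(0)\<close>, and such a polynomial is zero. So it suffices to check that the
  expressions of the theorem for \<open>A\<close> and \<open>C\<close> are series that solve the system. The equations at the
  kernel pair then give \<open>L(0,x)\<close> and \<open>B(x,0)\<close> as well.

  For this check the kernel curve is parametrized. With \<open>z = Z\<close> and \<open>m = U/Z\<close> the equations that define
  \<open>T\<close> and \<open>U\<close> say that \<open>(z\<^sup>2 - 1)(z\<^sup>2 + 3)\<^sup>3 = 256 t\<^sup>2 z\<^sup>6\<close> and that \<open>m\<close> is a root of a cubic polynomial
  over \<open>\<rat>(z, x/t)\<close>. On pairs of points \<open>(m, n)\<close> the kernel splits into three factors (\<open>kernel_factors\<close>), one
  of which, \<open>bi z m n\<close>, is quadratic in \<open>m\<close> and in \<open>n\<close> and vanishes on the kernel pairs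
  (\<open>kernel_pair_bi\<close>). The points \<open>m\<close> over \<open>x\<close> and over \<open>1/x\<close> are the two roots of \<open>bi z m n\<close> for the
  point \<open>n\<close> over \<open>Y\<close>, and modulo \<open>bi z m n\<close> the expressions for \<open>A\<close> and \<open>C\<close> are linear in \<open>m\<close>; hence the
  system becomes a consequence of the formula for the sum of the roots of a quadratic polynomial.

  The degrees are bounded from above by the degrees of \<open>z\<close>, which is 8, and of \<open>m\<close>, which is 3. A series
  in one of the variables lies in an extension of degree at most \<open>8 \<cdot> 3\<close>, the series in both variables lie
  in one of degree at most \<open>8 \<cdot> 3 \<cdot> 3\<close>. For the lower bounds the conjugates are counted modulo a prime.
  Modulo 1009 there is a base point at which the equations for \<open>z\<close> and for the points \<open>m\<close>, \<open>n\<close> over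
  the two variables have only simple rational roots, and at the 24 points \<open>(z, m)\<close> (or the 72 points
  \<open>(z, m, n)\<close>) over it the series take distinct values. Polynomial relations of the generic point persist at
  all special points (\<open>generic_relations\<close>), so an annihilating polynomial, after removal of its content,
  would have all these values as zeros. To prevent that it vanishes modulo 1009 at the base point, the base
  point is deformed to one in \<open>F[[t]]\<close>, \<open>F\<close> being the field with 1009 elements, where Hensel's lemma still
  provides all the points (\<open>card_conjugates_le_degree\<close>).
\<close>

section \<open>Hensel's lemma for power series\<close>

definition agree :: "nat \<Rightarrow> 'a::zero fps \<Rightarrow> 'a fps \<Rightarrow> bool" where
  "agree n f g \<longleftrightarrow> (\<forall>k<n. fps_nth f k = fps_nth g k)"

lemma fps_mult_nth_below:
  fixes f g :: "'a::comm_ring_1 fps"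
  assumes "\<And>k. k < n \<Longrightarrow> fps_nth f k = 0"
  shows "k < n \<Longrightarrow> fps_nth (f * g) k = 0" "fps_nth (f * g) n = fps_nth f n * fps_nth g 0"
proof -
  show "fps_nth (f * g) k = 0" if "k < n"
    using assms that by (simp add: fps_mult_nth)
  have "fps_nth (f * g) n = (\<Sum>i\<in>{0..n}. fps_nth f i * fps_nth g (n - i))"
    by (simp add: fps_mult_nth)
  also have "\<dots> = (\<Sum>i\<in>{n}. fps_nth f i * fps_nth g (n - i))"
    by (rule sum.mono_neutral_right) (use assms in auto)
  finally show "fps_nth (f * g) n = fps_nth f n * fps_nth g 0" by simp
qed

text \<open>
  Newton's iteration and the uniqueness of its limit both use this cofactor: if \<open>a\<close> and \<open>b\<close> have the same
  constant term, then it is a unit as soon as the derivative at \<open>b\<close> is one.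
\<close>

lemma poly_difference_factor:
  fixes p :: "'a::idom fps poly"
  obtains q where "poly p a - poly p b = (a - b) * q"
    "fps_nth a 0 = fps_nth b 0 \<Longrightarrow> fps_nth q 0 = fps_nth (poly (pderiv p) b) 0"
proof -
  define s where "s = synthetic_div p b"
  have p: "p = [:-b, 1:] * s + [:poly p b:]"
    unfolding s_def by (rule synthetic_div_correct'[symmetric])
  have 1: "poly p a - poly p b = (a - b) * poly s a"
    by (subst p) (simp add: algebra_simps)
  have "pderiv p = pderiv ([:-b, 1:] * s + [:poly p b:])"
    using p by simp
  also have "\<dots> = [:-b, 1:] * pderiv s + s"
    by (simp only: pderiv_add pderiv_mult) (simp add: pderiv_pCons)
  finally have 2: "poly (pderiv p) b = poly s b"
    by simp
  have 3: "fps_nth (poly s a) 0 = fps_nth (poly s b) 0" if ab: "fps_nth a 0 = fps_nth b 0"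
  proof -
    have "s = [:-b, 1:] * synthetic_div s b + [:poly s b:]"
      by (rule synthetic_div_correct'[symmetric])
    then have "poly s a = poly ([:-b, 1:] * synthetic_div s b + [:poly s b:]) a"
      by simp
    also have "\<dots> = (a - b) * poly (synthetic_div s b) a + poly s b"
      by (simp add: algebra_simps)
    finally show ?thesis
      using ab by (simp add: fps_mult_nth)
  qed
  show thesis
    by (rule that[of "poly s a"]) (use 1 2 3 in auto)
qed

lemma poly_agree:
  fixes p :: "'a::idom fps poly"
  assumes "agree n a b"
  shows "agree n (poly p a) (poly p b)"
proof -
  obtain q where q: "poly p a - poly p b = (a - b) * q"
    by (rule poly_difference_factor)
  have "fps_nth ((a - b) * q) k = 0" if "k < n" for k
    by (rule fps_mult_nth_below(1)[OF _ that]) (use assms in \<open>auto simp: agree_def\<close>)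
  then show ?thesis
    unfolding agree_def by (metis q fps_sub_nth right_minus_eq)
qed

text \<open>
  Newton's iteration with the fixed slope \<open>d\<close>: each step kills one more coefficient of \<open>p\<close> at the
  approximate root and leaves the lower coefficients of that root alone. The inverse \<open>d\<close> of the derivative is
  an argument because the coefficients also come from rings without inverses such as \<open>\<rat>[x,y]\<close>.
\<close>

theorem hensel:
  fixes p :: "'a::idom fps poly"
  assumes root: "fps_nth (poly p (fps_const a0)) 0 = 0"
    and unit: "fps_nth (poly (pderiv p) (fps_const a0)) 0 * d = 1"
  shows "\<exists>!a. fps_nth a 0 = a0 \<and> poly p a = 0"
proof -
  have pd: "fps_nth (poly (pderiv p) b) 0 * d = 1" if "fps_nth b 0 = a0" for b
    using poly_agree[of 1 b "fps_const a0" "pderiv p"] that unit by (simp add: agree_def)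
  define step where "step a = a - fps_const d * poly p a" for a
  define s where "s n = (step ^^ n) (fps_const a0)" for n
  have s0: "s 0 = fps_const a0" and sS: "s (Suc n) = s n - fps_const d * poly p (s n)" for n
    by (simp_all add: s_def step_def)
  have inv: "fps_nth (s n) 0 = a0 \<and> (\<forall>k<Suc n. fps_nth (poly p (s n)) k = 0)" for n
  proof (induction n)
    case 0 then show ?case using root by (simp add: s0)
  next
    case (Suc n)
    let ?a = "s n"
    obtain q where q: "poly p (s (Suc n)) - poly p ?a = (s (Suc n) - ?a) * q"
      and q0: "fps_nth (s (Suc n)) 0 = fps_nth ?a 0 \<Longrightarrow> fps_nth q 0 = fps_nth (poly (pderiv p) ?a) 0"
      using poly_difference_factor[of p "s (Suc n)" ?a] by blast
    have const: "fps_nth (s (Suc n)) 0 = a0"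
      using Suc by (simp add: sS)
    have eq: "poly p (s (Suc n)) = poly p ?a * (1 - fps_const d * q)"
      using q by (simp add: sS algebra_simps)
    have c: "fps_nth (1 - fps_const d * q) 0 = 0"
      using q0 const Suc pd[of ?a] by (simp add: mult.commute)
    have "fps_nth (poly p (s (Suc n))) k = 0" if "k < Suc (Suc n)" for k
    proof (cases "k < Suc n")
      case True
      then show ?thesis
        unfolding eq by (intro fps_mult_nth_below(1)[of "Suc n"]) (use Suc in auto)
    next
      case False
      with that have k: "k = Suc n" by simp
      show ?thesis
        unfolding eq k by (subst fps_mult_nth_below(2)) (use Suc c in auto)
    qed
    with const show ?case by simp
  qed
  define a where "a = Abs_fps (\<lambda>n. fps_nth (s n) n)"
  have step_agree: "fps_nth (s (Suc n)) k = fps_nth (s n) k" if "k \<le> n" for n k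
    using inv[of n] that by (simp add: sS)
  have stable: "fps_nth (s m) k = fps_nth (s n) k" if "k \<le> n" "n \<le> m" for n m k
    using that(2,1)
  proof (induction m rule: dec_induct)
    case (step m)
    then show ?case using step_agree[of k m] by simp
  qed simp
  have "agree (Suc n) a (s n)" for n
    unfolding agree_def
  proof (intro allI impI)
    fix k assume "k < Suc n"
    then have "fps_nth (s n) k = fps_nth (s k) k"
      by (intro stable) auto
    then show "fps_nth a k = fps_nth (s n) k"
      by (simp add: a_def)
  qed
  then have "agree (Suc n) (poly p a) (poly p (s n))" for n
    by (rule poly_agree)
  then have "poly p a = 0"
    using inv by (auto simp: fps_eq_iff agree_def)
  moreover have "fps_nth a 0 = a0"
    by (simp add: a_def s0)
  moreover have "b = a" if b: "fps_nth b 0 = a0" "poly p b = 0" for b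
  proof -
    obtain q where q: "poly p b - poly p a = (b - a) * q"
      and q0: "fps_nth b 0 = fps_nth a 0 \<Longrightarrow> fps_nth q 0 = fps_nth (poly (pderiv p) a) 0"
      using poly_difference_factor[of p b a] by blast
    have z: "(b - a) * q = 0"
      using q b \<open>poly p a = 0\<close> by simp
    have u: "fps_nth q 0 * d = 1"
      using q0 b \<open>fps_nth a 0 = a0\<close> pd[of a] by simp
    have "fps_nth (b - a) n = 0" for n
    proof (induction n rule: less_induct)
      case (less n)
      have "fps_nth (b - a) n * fps_nth q 0 = 0"
        using fps_mult_nth_below(2)[of n "b - a" q] less z by simp
      then have "fps_nth (b - a) n * (fps_nth q 0 * d) = 0"
        by (simp only: mult.assoc[symmetric] mult_zero_left)
      then show ?case using u by simp
    qed
    then show ?thesis by (simp add: fps_eq_iff)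
  qed
  ultimately show ?thesis by blast
qed


section \<open>Counting walks by their endpoint\<close>

definition cnt :: "nat \<Rightarrow> int \<Rightarrow> int \<Rightarrow> rat" where
  "cnt n i j = of_nat (card {w \<in> of_length n cone_walks. last w = (i, j)})"

lemma cone_walk_snoc:
  assumes "w \<noteq> []"
  shows "w @ [p] \<in> cone_walks \<longleftrightarrow> w \<in> cone_walks \<and> p - last w \<in> steps \<and> p \<in> cone"
  using assms by (auto simp: cone_walks_def successively_append_iff)

lemma walks_Suc:
  "{w \<in> of_length (Suc n) cone_walks. last w = p} =
     (if p \<in> cone then (\<Union>s\<in>steps. (\<lambda>w. w @ [p]) ` {w \<in> of_length n cone_walks. last w = p - s}) else {})"
  (is "?A = ?B")
proof (intro set_eqI iffI)
  fix w assume w: "w \<in> ?A"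
  then have len: "length w = Suc (Suc n)" and wc: "w \<in> cone_walks" and l: "last w = p"
    by (auto simp: of_length_def)
  define v where "v = butlast w"
  have v: "w = v @ [p]" "v \<noteq> []" "length v = Suc n"
  proof -
    show len': "length v = Suc n" using len by (simp add: v_def)
    show "v \<noteq> []" using len' by auto
    have "w \<noteq> []" using len by auto
    then show "w = v @ [p]" using l by (auto simp: v_def)
  qed
  then have "v \<in> cone_walks" "p - last v \<in> steps" "p \<in> cone"
    using wc cone_walk_snoc[of v p] by auto
  then show "w \<in> ?B"
    using v by (auto simp: of_length_def intro!: bexI[of _ "p - last v"])
next
  fix w assume "w \<in> ?B"
  then obtain s v where "p \<in> cone" "s \<in> steps" "w = v @ [p]" "v \<in> of_length n cone_walks" "last v = p - s"
    by (auto split: if_splits)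
  moreover from this have "v \<noteq> []"
    by (auto simp: of_length_def)
  ultimately show "w \<in> ?A"
    using cone_walk_snoc[of v p] by (auto simp: of_length_def)
qed

lemma walks_0: "{w \<in> of_length 0 cone_walks. last w = p} = (if p = (-1,0) then {[(-1,0)]} else {})"
  by (auto simp: of_length_def cone_walks_def cone_def length_Suc_conv)

lemma finite_walks_to: "finite {w \<in> of_length n cone_walks. last w = p}"
proof (induction n arbitrary: p)
  case (Suc n)
  then show ?case
    unfolding walks_Suc by (auto simp: steps_def)
qed (simp add: walks_0)

lemma walk_endpoint_bound:
  "w \<in> of_length n cone_walks \<Longrightarrow> last w \<in> {-int n - 1..int n} \<times> {-int n - 1..int n}"
proof (induction n arbitrary: w)
  case 0
  then show ?case using walks_0[of "last w"] by (auto split: if_splits)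
next
  case (Suc n)
  then have "w \<in> {w \<in> of_length (Suc n) cone_walks. last w = last w}" by simp
  then obtain s v where sv: "s \<in> steps" "v \<in> of_length n cone_walks" "last v = last w - s"
    unfolding walks_Suc[of n "last w"] using Suc.prems walks_Suc[of n "last w"] by (auto split: if_splits)
  then have "last w - s \<in> {-int n - 1..int n} \<times> {-int n - 1..int n}"
    using Suc.IH[OF sv(2)] by simp
  then show ?case
    using sv(1) by (cases "last w") (auto simp: steps_def)
qed

lemma finite_of_length: "finite (of_length n cone_walks)"
proof -
  have "of_length n cone_walks \<subseteq>
      (\<Union>p\<in>{-int n - 1..int n} \<times> {-int n - 1..int n}. {w \<in> of_length n cone_walks. last w = p})"
    using walk_endpoint_bound by blast
  then show ?thesis
    by (rule finite_subset) (auto intro: finite_walks_to)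
qed

lemma cnt_0: "cnt 0 i j = (if i = -1 \<and> j = 0 then 1 else 0)"
  by (simp add: cnt_def walks_0)

lemma cnt_outside: "i < 0 \<Longrightarrow> j < 0 \<Longrightarrow> cnt n i j = 0"
proof -
  assume ij: "i < 0" "j < 0"
  then have "{w \<in> of_length n cone_walks. last w = (i, j)} = {}"
    using last_in_cone by (force simp: of_length_def)
  then show ?thesis
    unfolding cnt_def by (simp only: card.empty of_nat_0)
qed

lemma cnt_Suc:
  assumes "i \<ge> 0 \<or> j \<ge> 0"
  shows "cnt (Suc n) i j = cnt n (i - 1) j + cnt n (i + 1) j + cnt n i (j - 1) + cnt n i (j + 1)"
proof -
  let ?W = "\<lambda>p. {w \<in> of_length n cone_walks. last w = p}" and ?p = "(i, j)"
  have inj: "card ((\<lambda>w. w @ [?p]) ` ?W q) = card (?W q)" for q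
    by (rule card_image) (simp add: inj_on_def)
  have "card {w \<in> of_length (Suc n) cone_walks. last w = ?p} =
      card (\<Union>s\<in>steps. (\<lambda>w. w @ [?p]) ` ?W (?p - s))"
    using assms by (subst walks_Suc) (simp add: cone_def)
  also have "\<dots> = (\<Sum>s\<in>steps. card ((\<lambda>w. w @ [?p]) ` ?W (?p - s)))"
    by (rule card_UN_disjoint) (auto simp: steps_def intro: finite_walks_to)
  also have "\<dots> = (\<Sum>s\<in>steps. card (?W (?p - s)))"
    by (simp only: inj)
  also have "\<dots> = card (?W (i - 1, j)) + card (?W (i + 1, j)) + card (?W (i, j - 1)) + card (?W (i, j + 1))"
    by (simp add: steps_def)
  finally show ?thesis
    by (simp add: cnt_def)
qed

text \<open>
  A reflection principle. Both sides obey the recurrence of the walks at the points of the quadrant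
  and they agree on the two lines \<open>i = -1\<close> and \<open>j = -1\<close> that border it, because one of the reflected
  points then lies in the forbidden quadrant and the other one is the point itself.
\<close>

lemma cnt_reflection:
  assumes "i \<ge> -1" "j \<ge> -1"
  shows "cnt n i j = cnt n (- 2 - i) j + cnt n i (- 2 - j)"
  using assms
proof (induction n arbitrary: i j)
  case 0
  then show ?case by (auto simp: cnt_0)
next
  case (Suc n)
  show ?case
  proof (cases "i = -1 \<or> j = -1")
    case True
    then show ?thesis
      using Suc.prems cnt_outside[of i "-2-j" "Suc n"] cnt_outside[of "-2-i" j "Suc n"]
        cnt_outside[of i j "Suc n"]
      by (cases "i = -1"; cases "j = -1") auto
  next
    case False
    with Suc.prems have ij: "i \<ge> 0" "j \<ge> 0" by auto
    have e: "- 2 - (i - 1) = - 2 - i + 1" "- 2 - (i + 1) = - 2 - i - 1"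
      "- 2 - (j - 1) = - 2 - j + 1" "- 2 - (j + 1) = - 2 - j - 1"
      by auto
    show ?thesis
      using ij Suc.IH[of "i - 1" j] Suc.IH[of "i + 1" j] Suc.IH[of i "j - 1"] Suc.IH[of i "j + 1"]
        cnt_Suc[of i j n] cnt_Suc[of "- 2 - i" j n] cnt_Suc[of i "- 2 - j" n]
      unfolding e by linarith
  qed
qed

text \<open>
  Coefficients with the exponents of \<open>x\<close> and \<open>y\<close> in this order, although \<open>y\<close> is the outer variable. An
  identity between the series is proved by comparing them.
\<close>

definition co :: "rat poly poly fps \<Rightarrow> nat \<Rightarrow> nat \<Rightarrow> nat \<Rightarrow> rat" where
  "co S n a b = coeff (coeff (fps_nth S n) b) a"

lemma sum_monom_coeff:
  assumes "\<And>w. w \<in> of_length n W \<Longrightarrow> (e w = a \<and> f w = b) = (last w = p)" "W \<subseteq> cone_walks"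
    and "\<And>w. w \<in> cone_walks \<Longrightarrow> last w = p \<Longrightarrow> w \<in> W"
  shows "coeff (coeff (\<Sum>w\<in>of_length n W. monom (monom 1 (e w)) (f w)) b) a = cnt n (fst p) (snd p)"
proof -
  have fin: "finite (of_length n W)"
    by (rule finite_subset[OF _ finite_of_length[of n]]) (use assms(2) in \<open>auto simp: of_length_def\<close>)
  have "coeff (coeff (\<Sum>w\<in>of_length n W. monom (monom (1::rat) (e w)) (f w)) b) a =
      (\<Sum>w\<in>of_length n W. if last w = p then 1 else 0)"
    unfolding coeff_sum by (intro sum.cong refl) (use assms(1) in \<open>auto simp: coeff_monom\<close>)
  also have "\<dots> = of_nat (card {w \<in> of_length n W. last w = p})"
    using fin by (simp add: sum.If_cases Int_def conj_commute)
  also have "{w \<in> of_length n W. last w = p} = {w \<in> of_length n cone_walks. last w = p}"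
    using assms(2,3) by (auto simp: of_length_def)
  finally show ?thesis
    by (simp add: cnt_def)
qed

lemma co_P: "co P_series n a b = cnt n (int a) (int b)"
  unfolding co_def P_series_def fps_nth_Abs_fps
  by (subst sum_monom_coeff[where p = "(int a, int b)"])
     (auto simp: of_length_def quadrant_walks_def prod_eq_iff)

lemma co_L: "co L_series n a b = cnt n (- 1 - int a) (int b)"
  unfolding co_def L_series_def fps_nth_Abs_fps
proof (subst sum_monom_coeff[where p = "(- 1 - int a, int b)"])
  fix w assume "w \<in> of_length n left_walks"
  then have "fst (last w) < 0" "snd (last w) \<ge> 0"
    using last_in_cone[of w] by (auto simp: of_length_def left_walks_def)
  then show "(nat (- 1 - fst (last w)) = a \<and> nat (snd (last w)) = b) = (last w = (- 1 - int a, int b))"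
    by (cases "last w") auto
qed (auto simp: left_walks_def)

lemma co_B: "co B_series n a b = cnt n (int a) (- 1 - int b)"
  unfolding co_def B_series_def fps_nth_Abs_fps
proof (subst sum_monom_coeff[where p = "(int a, - 1 - int b)"])
  fix w assume "w \<in> of_length n below_walks"
  then have "snd (last w) < 0" "fst (last w) \<ge> 0"
    using last_in_cone[of w] by (auto simp: of_length_def below_walks_def)
  then show "(nat (fst (last w)) = a \<and> nat (- 1 - snd (last w)) = b) = (last w = (int a, - 1 - int b))"
    by (cases "last w") auto
qed (auto simp: below_walks_def)


section \<open>The functional equations\<close>

definition xx :: "rat poly poly fps" where "xx = fps_const [:[:0, 1:]:]"
definition yy :: "rat poly poly fps" where "yy = fps_const [:0, 1:]"
definition at_x0 :: "rat poly poly fps \<Rightarrow> rat poly poly fps" where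
  "at_x0 S = Abs_fps (\<lambda>n. map_poly (\<lambda>q. [:coeff q 0:]) (fps_nth S n))"
definition at_y0 :: "rat poly poly fps \<Rightarrow> rat poly poly fps" where
  "at_y0 S = Abs_fps (\<lambda>n. [:coeff (fps_nth S n) 0:])"

lemma co_eqI: "(\<And>n a b. co S n a b = co S' n a b) \<Longrightarrow> S = S'"
  unfolding co_def by (intro fps_ext poly_eqI) auto

lemma co_add: "co (S + S') n a b = co S n a b + co S' n a b"
  and co_diff: "co (S - S') n a b = co S n a b - co S' n a b"
  and co_t: "co (fps_X * S) n a b = (case n of 0 \<Rightarrow> 0 | Suc m \<Rightarrow> co S m a b)"
  and co_x: "co (xx * S) n a b = (case a of 0 \<Rightarrow> 0 | Suc m \<Rightarrow> co S n m b)"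
  and co_y: "co (yy * S) n a b = (case b of 0 \<Rightarrow> 0 | Suc m \<Rightarrow> co S n a m)"
  and co_x0: "co (at_x0 S) n a b = (if a = 0 then co S n 0 b else 0)"
  and co_y0: "co (at_y0 S) n a b = (if b = 0 then co S n a 0 else 0)"
  and co_1: "co 1 n a b = (if n = 0 \<and> a = 0 \<and> b = 0 then 1 else 0)"
  by (auto simp: co_def xx_def yy_def at_x0_def at_y0_def coeff_map_poly coeff_pCons
      split: nat.splits)

lemma co_2: "co (2 * S) n a b = 2 * co S n a b"
  by (simp only: mult_2 co_add)

lemma co_yy: "co yy n a b = (if n = 0 \<and> a = 0 \<and> b = 1 then 1 else 0)"
  by (auto simp: co_def yy_def coeff_pCons split: nat.splits)

lemmas co_simps = co_add co_diff co_t co_x co_y co_x0 co_y0 co_1 co_2 co_yy co_P co_L co_B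

text \<open>
  This is the reflection principle at the points of the first quadrant: the coefficients of \<open>L - L(0,y)\<close> count
  the walks that end at an abscissa below \<open>-1\<close>, that is, at the reflected points.
\<close>

lemma P_from_L_B:
  "xx * (yy * P_series) = yy * (L_series - at_x0 L_series) + xx * (B_series - at_y0 B_series)"
proof (rule co_eqI)
  fix n a b
  show "co (xx * (yy * P_series)) n a b =
      co (yy * (L_series - at_x0 L_series) + xx * (B_series - at_y0 B_series)) n a b"
  proof (cases a; cases b)
    fix a' b' assume ab: "a = Suc a'" "b = Suc b'"
    show ?thesis
      using cnt_reflection[of "int a'" "int b'" n] ab by (simp add: co_simps)
  qed (simp_all add: co_simps)
qed

text \<open>
  The coefficient of \<open>x\<^sup>a y\<^sup>b\<close> in \<open>2L - L(0,y)\<close> is twice the number of walks to \<open>(-1-a,b)\<close>, except for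
  \<open>a = 0\<close>. Multiplication by the kernel compares it with the recurrence. At \<open>a = 0\<close> the recurrence involves
  walks to \<open>(0,b)\<close>; by reflection their number is that of the walks to \<open>(-2,b)\<close>, whence the factor 2, plus
  that of the walks to \<open>(0,-2-b)\<close>, whence the terms with \<open>B\<close>.
\<close>

lemma L_equation:
  "(xx * yy - fps_X * (xx * (xx * yy) + yy + xx * (yy * yy) + xx)) * (2 * L_series - at_x0 L_series) =
     xx * yy - 2 * (fps_X * (xx * at_y0 L_series)) + fps_X * (xx * (xx * (yy * at_x0 L_series)))
     - fps_X * (yy * at_x0 L_series)
     + fps_X * (xx * at_x0 B_series) + fps_X * (xx * at_x0 (at_y0 L_series))
     - fps_X * (xx * at_x0 (at_y0 B_series))" (is "?l = ?r")
proof (rule co_eqI)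
  fix n a b
  define M where "M = 2 * L_series - at_x0 L_series"
  have l: "?l = xx * (yy * M) - fps_X * (xx * (xx * (yy * M)) + yy * M + xx * (yy * (yy * M)) + xx * M)"
    unfolding M_def by (simp add: algebra_simps)
  have r: "?r = xx * (yy * 1) - 2 * (fps_X * (xx * at_y0 L_series)) + fps_X * (xx * (xx * (yy * at_x0 L_series)))
     - fps_X * (yy * at_x0 L_series)
     + fps_X * (xx * at_x0 B_series) + fps_X * (xx * at_x0 (at_y0 L_series))
     - fps_X * (xx * at_x0 (at_y0 B_series))"
    by simp
  have M: "co M n a b = (if a = 0 then cnt n (-1) (int b) else 2 * cnt n (- 1 - int a) (int b))" for n a b
    by (auto simp: M_def co_simps)
  show "co ?l n a b = co ?r n a b"
  proof (cases n)
    case 0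
    then show ?thesis
      unfolding l r by (auto simp: co_simps M cnt_0 split: nat.splits)
  next
    case (Suc m)
    show ?thesis
    proof (cases a)
      case a: 0
      show ?thesis
        unfolding l r Suc a by (cases b) (auto simp: co_simps M)
    next
      case a: (Suc a')
      show ?thesis
      proof (cases b)
        case b: 0
        show ?thesis
          unfolding l r Suc a b by (cases a') (auto simp: co_simps M)
      next
        case b: (Suc b')
        have R: "cnt (Suc m) (- 1 - int a') (int b') = cnt m (- 2 - int a') (int b') +
            cnt m (- int a') (int b') + cnt m (- 1 - int a') (int b' - 1) + cnt m (- 1 - int a') (1 + int b')"
        proof -
          have "- 1 - int a' - 1 = - 2 - int a'" "- 1 - int a' + 1 = - int a'"
            by auto
          then show ?thesis
            using cnt_Suc[of "- 1 - int a'" "int b'" m] by (simp only: add.commute) simp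
        qed
        have Y: "(case b' of 0 \<Rightarrow> 0 | Suc k \<Rightarrow> co M m a' k) =
            (if a' = 0 then 1 else 2) * cnt m (- 1 - int a') (int b' - 1)"
          using cnt_outside[of "- 1 - int a'" "-1" m]
          by (cases b') (auto simp: M)
        show ?thesis
        proof (cases a')
          case a': 0
          have "cnt m 0 (int b') = cnt m (-2) (int b') + cnt m 0 (- 2 - int b')"
            using cnt_reflection[of 0 "int b'" m] by (simp add: algebra_simps)
          then show ?thesis
            using R Y unfolding l r Suc a b a'
            by (auto simp: co_simps M)
        next
          case a': (Suc a'')
          show ?thesis
            using R Y unfolding l r Suc a b a'
            by (cases a'') (auto simp: co_simps M)
        qed
      qed
    qed
  qed
qed

text \<open>
  The mirror image of the previous equation, without an initial term because the walks start at a negative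
  abscissa.
\<close>

lemma B_equation:
  "(xx * yy - fps_X * (xx * (xx * yy) + yy + xx * (yy * yy) + xx)) * (2 * B_series - at_y0 B_series) =
     fps_X * (xx * (yy * (yy * at_y0 B_series))) - fps_X * (xx * at_y0 B_series)
     - 2 * (fps_X * (yy * at_x0 B_series)) + fps_X * (yy * at_y0 L_series)
     - fps_X * (yy * at_x0 (at_y0 L_series)) + fps_X * (yy * at_x0 (at_y0 B_series))" (is "?l = ?r")
proof (rule co_eqI)
  fix n a b
  define M where "M = 2 * B_series - at_y0 B_series"
  have l: "?l = xx * (yy * M) - fps_X * (xx * (xx * (yy * M)) + yy * M + xx * (yy * (yy * M)) + xx * M)"
    unfolding M_def by (simp add: algebra_simps)
  have M: "co M n a b = (if b = 0 then cnt n (int a) (-1) else 2 * cnt n (int a) (- 1 - int b))" for n a b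
    by (auto simp: M_def co_simps)
  show "co ?l n a b = co ?r n a b"
  proof (cases n)
    case 0
    then show ?thesis
      unfolding l by (auto simp: co_simps M cnt_0 split: nat.splits)
  next
    case (Suc m)
    show ?thesis
    proof (cases a)
      case a: 0
      show ?thesis
        unfolding l Suc a by (cases b) (auto simp: co_simps M)
    next
      case a: (Suc a')
      show ?thesis
      proof (cases b)
        case b: 0
        show ?thesis
          unfolding l Suc a b by (cases a') (auto simp: co_simps M)
      next
        case b: (Suc b')
        have R: "cnt (Suc m) (int a') (- 1 - int b') = cnt m (int a') (- 2 - int b') +
            cnt m (int a') (- int b') + cnt m (int a' - 1) (- 1 - int b') + cnt m (1 + int a') (- 1 - int b')"
        proof -
          have "- 1 - int b' - 1 = - 2 - int b'" "- 1 - int b' + 1 = - int b'"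
            by auto
          then show ?thesis
            using cnt_Suc[of "int a'" "- 1 - int b'" m] by (simp only: add.commute) simp
        qed
        have Y: "(case a' of 0 \<Rightarrow> 0 | Suc k \<Rightarrow> co (yy * M) m k (Suc b')) =
            (if b' = 0 then 1 else 2) * cnt m (int a' - 1) (- 1 - int b')"
          using cnt_outside[of "-1" "- 1 - int b'" m]
          by (cases a') (auto simp: M co_y)
        show ?thesis
        proof (cases b')
          case b': 0
          have "cnt m (int a') 0 = cnt m (int a') (-2) + cnt m (- 2 - int a') 0"
            using cnt_reflection[of "int a'" 0 m] by (simp add: algebra_simps)
          then show ?thesis
            using R Y unfolding l Suc a b b'
            by (auto simp: co_simps M)
        next
          case b': (Suc b'')
          show ?thesis
            using R Y unfolding l Suc a b b'
            by (cases b'') (auto simp: co_simps M)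
        qed
      qed
    qed
  qed
qed

section \<open>Ring homomorphisms and substitution\<close>

text \<open>
  Evaluations, embeddings and substitutions all connect different types of rings; as instances of one
  predicate they share the rewrite rules that move identities along them.
\<close>

definition ring_map :: "('a::comm_ring_1 \<Rightarrow> 'b::comm_ring_1) \<Rightarrow> bool" where
  "ring_map h \<longleftrightarrow> h 1 = 1 \<and> (\<forall>a b. h (a + b) = h a + h b) \<and> (\<forall>a b. h (a * b) = h a * h b)"

lemma ring_map_simps:
  assumes "ring_map h"
  shows "h 0 = 0" "h 1 = 1" "h (a + b) = h a + h b" "h (a * b) = h a * h b"
    "h (- a) = - h a" "h (a - b) = h a - h b" "h (a ^ n) = h a ^ n" "h (numeral k) = numeral k"
proof -
  show 1: "h 1 = 1" and add: "h (a + b) = h a + h b" and mult: "h (a * b) = h a * h b" for a b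
    using assms by (auto simp: ring_map_def)
  show 0: "h 0 = 0"
    using add[of 0 0] by simp
  show m: "h (- a) = - h a" for a
    using add[of a "- a"] by (simp add: 0 eq_neg_iff_add_eq_0 add.commute)
  show "h (a - b) = h a - h b"
    using add[of a "- b"] m[of b] by simp
  show "h (a ^ n) = h a ^ n"
    by (induction n) (simp_all add: 1 mult)
  have "h (of_nat n) = of_nat n" for n
    by (induction n) (simp_all add: 0 1 add)
  from this[of "numeral k"] show "h (numeral k) = numeral k"
    by simp
qed

lemma ring_map_sum:
  assumes "ring_map h"
  shows "h (sum f A) = (\<Sum>x\<in>A. h (f x))"
  by (induction A rule: infinite_finite_induct) (simp_all add: ring_map_simps[OF assms])

lemma ring_map_poly_eval:
  assumes "ring_map h"
  shows "ring_map (\<lambda>p. poly (map_poly h p) a)"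
proof -
  note h = ring_map_simps[OF assms]
  let ?e = "\<lambda>p. poly (map_poly h p) a"
  have add: "?e (p + q) = ?e p + ?e q" for p q
  proof -
    have "map_poly h (p + q) = map_poly h p + map_poly h q"
      by (intro poly_eqI) (simp add: coeff_map_poly h)
    then show ?thesis by simp
  qed
  have smult: "?e (smult c p) = h c * ?e p" for c p
  proof -
    have "map_poly h (smult c p) = smult (h c) (map_poly h p)"
      by (intro poly_eqI) (simp add: coeff_map_poly h)
    then show ?thesis by simp
  qed
  have pC: "?e (pCons c p) = h c + a * ?e p" for c p
    by (simp add: map_poly_pCons h)
  have "?e (p * q) = ?e p * ?e q" for p q
    by (induction p) (simp_all add: add smult pC h algebra_simps)
  then show ?thesis
    unfolding ring_map_def by (auto simp: add h one_pCons pC simp del: pCons_one)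
qed

lemma ring_map_coeffwise:
  assumes "ring_map h"
  shows "ring_map (\<lambda>f. Abs_fps (\<lambda>n. h (fps_nth f n)))"
  unfolding ring_map_def
  by (auto simp: fps_eq_iff ring_map_simps[OF assms] fps_mult_nth ring_map_sum[OF assms] fps_one_nth)

lemma ring_map_compose: "ring_map f \<Longrightarrow> ring_map g \<Longrightarrow> ring_map (\<lambda>x. f (g x))"
  by (simp add: ring_map_def)

lemma ring_map_emb_poly: "ring_map emb_poly"
  by (simp add: ring_map_def emb_poly_add emb_poly_mult)

lemma ring_map_fps_const: "ring_map fps_const"
  by (simp add: ring_map_def)

lemma ring_map_const_poly: "ring_map (\<lambda>c. [:c:])"
  by (simp add: ring_map_def one_pCons)

lemma ring_map_emb_rat: "ring_map emb_rat"
  unfolding emb_rat_def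
  by (intro ring_map_compose[OF ring_map_fps_const] ring_map_compose[OF ring_map_emb_poly]
      ring_map_compose[OF ring_map_const_poly] ring_map_const_poly)

lemma ring_map_poly2: "ring_map (\<lambda>p. poly2 p a b)"
  unfolding poly2_def by (intro ring_map_poly_eval ring_map_emb_rat)

lemma fps_decompose: "S = fps_const (fps_nth S 0) + fps_X * fps_shift 1 S"
  for S :: "'a::comm_ring_1 fps"
  by (rule fps_ext) (simp add: fps_X_mult_nth)

lemma subst_xy_add: "subst_xy (S + S') a b = subst_xy S a b + subst_xy S' a b"
  by (rule fps_ext) (simp add: subst_xy_def poly2_add sum.distrib)

lemma subst_xy_fps_const: "subst_xy (fps_const p) a b = poly2 p a b"
proof (rule fps_ext)
  fix n
  have "(\<Sum>m\<le>n. fps_nth (poly2 (fps_nth (fps_const p) m) a b) (n - m)) =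
      (\<Sum>m\<in>{0}. fps_nth (poly2 (fps_nth (fps_const p) m) a b) (n - m))"
    by (rule sum.mono_neutral_right) auto
  then show "fps_nth (subst_xy (fps_const p) a b) n = fps_nth (poly2 p a b) n"
    by (simp add: subst_xy_def)
qed

lemma subst_xy_X_mult: "subst_xy (fps_X * S) a b = fps_X * subst_xy S a b"
proof (rule fps_ext)
  fix n
  show "fps_nth (subst_xy (fps_X * S) a b) n = fps_nth (fps_X * subst_xy S a b) n"
  proof (cases n)
    case (Suc k)
    have "(\<Sum>m\<le>Suc k. fps_nth (poly2 (fps_nth (fps_X * S) m) a b) (Suc k - m)) =
        (\<Sum>m\<le>k. fps_nth (poly2 (fps_nth S m) a b) (k - m))"
      by (subst sum.atMost_Suc_shift) simp
    then show ?thesis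
      by (simp add: subst_xy_def Suc)
  qed (simp add: subst_xy_def)
qed

lemma subst_xy_decompose:
  "subst_xy S a b = poly2 (fps_nth S 0) a b + fps_X * subst_xy (fps_shift 1 S) a b"
  using arg_cong[OF fps_decompose[of S], of "\<lambda>S. subst_xy S a b"]
  by (simp only: subst_xy_add subst_xy_fps_const subst_xy_X_mult)

lemma subst_xy_const_mult: "subst_xy (fps_const p * S) a b = poly2 p a b * subst_xy S a b"
proof -
  note p2 = ring_map_simps[OF ring_map_poly2]
  have "fps_nth (subst_xy (fps_const p * S) a b) n = fps_nth (poly2 p a b * subst_xy S a b) n" for n
  proof (induction n arbitrary: S)
    case 0
    then show ?case by (simp add: subst_xy_def p2)
  next
    case (Suc n)
    have sh: "fps_shift 1 (fps_const p * S) = fps_const p * fps_shift 1 S"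
      by (rule fps_ext) simp
    have "poly2 p a b * subst_xy S a b =
        poly2 p a b * poly2 (fps_nth S 0) a b + fps_X * (poly2 p a b * subst_xy (fps_shift 1 S) a b)"
      by (subst subst_xy_decompose) (simp add: algebra_simps)
    moreover have "subst_xy (fps_const p * S) a b =
        poly2 p a b * poly2 (fps_nth S 0) a b + fps_X * subst_xy (fps_const p * fps_shift 1 S) a b"
      by (subst subst_xy_decompose) (simp only: sh, simp add: p2)
    ultimately show ?case
      using Suc.IH[of "fps_shift 1 S"] by simp
  qed
  then show ?thesis by (simp add: fps_eq_iff)
qed

text \<open>
  Coefficient by coefficient, splitting off the constant term of the first factor: this reduces products of
  series to products with a polynomial and thus handles arguments that are series in \<open>t\<close> themselves.
\<close>

lemma subst_xy_mult: "subst_xy (S * S') a b = subst_xy S a b * subst_xy S' a b"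
proof -
  note p2 = ring_map_simps[OF ring_map_poly2]
  have "fps_nth (subst_xy (S * S') a b) n = fps_nth (subst_xy S a b * subst_xy S' a b) n" for n
  proof (induction n arbitrary: S)
    case 0
    then show ?case by (simp add: subst_xy_def p2)
  next
    case (Suc n)
    have "S * S' = fps_const (fps_nth S 0) * S' + fps_X * (fps_shift 1 S * S')"
      by (subst fps_decompose) (simp only: algebra_simps)
    then have "subst_xy (S * S') a b =
        poly2 (fps_nth S 0) a b * subst_xy S' a b + fps_X * subst_xy (fps_shift 1 S * S') a b"
      by (simp only: subst_xy_add subst_xy_X_mult subst_xy_const_mult)
    moreover have "subst_xy S a b * subst_xy S' a b =
        poly2 (fps_nth S 0) a b * subst_xy S' a b + fps_X * (subst_xy (fps_shift 1 S) a b * subst_xy S' a b)"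
      by (subst subst_xy_decompose) (simp add: algebra_simps)
    ultimately show ?case
      using Suc.IH[of "fps_shift 1 S"] by simp
  qed
  then show ?thesis by (simp add: fps_eq_iff)
qed

lemma ring_map_subst_xy: "ring_map (\<lambda>S. subst_xy S a b)"
  unfolding ring_map_def
proof (intro conjI allI)
  show "subst_xy 1 a b = 1"
    using subst_xy_fps_const[of 1 a b] ring_map_simps(2)[OF ring_map_poly2] by simp
qed (simp_all add: subst_xy_add subst_xy_mult)

lemma poly2_xy: "poly2 [:[:0, 1:]:] a b = a" "poly2 [:0, 1:] a b = b"
proof -
  have "monom (monom 1 1) 0 = [:[:0, 1::rat:]:]" "monom (monom 1 0) 1 = [:0, 1 :: rat poly:]"
    by (simp_all add: monom_altdef)
  then show "poly2 [:[:0, 1:]:] a b = a" "poly2 [:0, 1:] a b = b"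
    using poly2_monom[of 1 0 a b] poly2_monom[of 0 1 a b] by simp_all
qed

lemma subst_xy_vars: "subst_xy xx a b = a" "subst_xy yy a b = b" "subst_xy fps_X a b = fps_X"
proof -
  show "subst_xy xx a b = a" "subst_xy yy a b = b"
    by (simp_all add: xx_def yy_def subst_xy_fps_const poly2_xy)
  have "subst_xy (fps_X * 1) a b = fps_X * 1"
    unfolding subst_xy_X_mult by (simp add: ring_map_simps(2)[OF ring_map_subst_xy])
  then show "subst_xy fps_X a b = fps_X" by simp
qed

lemma subst_xy_at_x0: "subst_xy (at_x0 S) a b = subst_xy S 0 b"
proof -
  have "poly2 (map_poly (\<lambda>q. [:coeff q 0:]) p) a b = poly2 p 0 b" for p
    unfolding poly2_def
    by (subst map_poly_map_poly) (simp_all add: o_def map_poly_pCons ring_map_simps[OF ring_map_emb_rat]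
          poly_0_coeff_0 coeff_map_poly)
  then show ?thesis
    by (simp add: subst_xy_def at_x0_def)
qed

lemma subst_xy_at_y0: "subst_xy (at_y0 S) a b = subst_xy S a 0"
proof -
  have "poly2 [:coeff p 0:] a b = poly2 p a 0" for p
    by (simp add: poly2_def map_poly_pCons poly_0_coeff_0 coeff_map_poly)
  then show ?thesis
    by (simp add: subst_xy_def at_y0_def)
qed

lemmas subst_xy_simps =
  ring_map_simps[OF ring_map_subst_xy] subst_xy_vars subst_xy_at_x0 subst_xy_at_y0

text \<open>
  The functional equations at arbitrary arguments. The kernel method needs them at arguments that depend
  on \<open>t\<close>.
\<close>

lemma P_at: "a * (b * P a b) = b * (L a b - L 0 b) + a * (B a b - B a 0)"
  using arg_cong[OF P_from_L_B, of "\<lambda>S. subst_xy S a b"] by (simp only: subst_xy_simps)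

lemma L_at:
  "(a * b - vt * (a * (a * b) + b + a * (b * b) + a)) * (2 * L a b - L 0 b) =
     a * b - 2 * (vt * (a * L a 0)) + vt * (a * (a * (b * L 0 b))) - vt * (b * L 0 b)
     + vt * (a * B 0 b) + vt * (a * L 0 0) - vt * (a * B 0 0)"
  using arg_cong[OF L_equation, of "\<lambda>S. subst_xy S a b"] by (simp only: subst_xy_simps)

lemma B_at:
  "(a * b - vt * (a * (a * b) + b + a * (b * b) + a)) * (2 * B a b - B a 0) =
     vt * (a * (b * (b * B a 0))) - vt * (a * B a 0) - 2 * (vt * (b * B 0 b)) + vt * (b * L a 0)
     - vt * (b * L 0 0) + vt * (b * B 0 0)"
  using arg_cong[OF B_equation, of "\<lambda>S. subst_xy S a b"] by (simp only: subst_xy_simps)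

lemma vx_nonzero: "vx \<noteq> 0" "vy \<noteq> 0" and vx_inverse: "vx * inverse vx = 1" "vy * inverse vy = 1"
proof -
  show "vx \<noteq> 0" "vy \<noteq> 0"
    using emb_var_nonzero by (simp_all add: vx_def vy_def)
  show "vx * inverse vx = 1" "vy * inverse vy = 1"
    using emb_var_nonzero by (simp_all add: vx_def vy_def fps_const_inverse)
qed

lemma P_equation: "P vx vy = inverse vx * (L vx vy - L 0 vy) + inverse vy * (B vx vy - B vx 0)"
proof -
  have "vx * vy * P vx vy = vx * vy * (inverse vx * (L vx vy - L 0 vy) + inverse vy * (B vx vy - B vx 0))"
    using P_at[of vx vy] vx_inverse by algebra
  then show ?thesis
    using vx_nonzero by simp
qed

lemma L_vx_vy_equation:
  "(1 - vt * (vx + inverse vx + vy + inverse vy)) * (2 * L vx vy - L 0 vy) =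
        1 - 2 * vt * inverse vy * L vx 0 + vt * (vx - inverse vx) * L 0 vy
        + vt * inverse vy * B 0 vy + vt * inverse vy * L 0 0 - vt * inverse vy * B 0 0" (is "?l = ?r")
proof -
  have "vx * vy * ?l = vx * vy * ?r"
    using L_at[of vx vy] vx_inverse by algebra
  then show ?thesis
    using vx_nonzero by simp
qed

lemma B_vx_vy_equation:
  "(1 - vt * (vx + inverse vx + vy + inverse vy)) * (2 * B vx vy - B vx 0) =
        vt * (vy - inverse vy) * B vx 0 - 2 * vt * inverse vx * B 0 vy
        + vt * inverse vx * L vx 0 - vt * inverse vx * L 0 0 + vt * inverse vx * B 0 0" (is "?l = ?r")
proof -
  have "vx * vy * ?l = vx * vy * ?r"
    using B_at[of vx vy] vx_inverse by algebra
  then show ?thesis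
    using vx_nonzero by simp
qed

section \<open>The kernel curve\<close>

text \<open>
  Numerals are invertible in the field of rational functions; the simplifier and \<open>algebra\<close> rely on it.
\<close>

instance fract :: ("{idom, ring_char_0}") field_char_0
proof
  have "of_nat n = Fract (of_nat n) (1::'a)" for n
    by (induction n) (simp_all add: Zero_fract_def One_fract_def)
  then show "inj (of_nat :: nat \<Rightarrow> 'a fract)"
    by (auto simp: inj_def eq_fract)
qed

text \<open>
  The curve and its parameters. Over a \<open>z\<close> with \<open>(z\<^sup>2 - 1)(z\<^sup>2 + 3)\<^sup>3 = 256 t\<^sup>2 z\<^sup>6\<close> the point with
  parameter \<open>m\<close> has the abscissa \<open>x/t = 16 z\<^sup>3 (1 - m\<^sup>2) / ck z m\<close>, and \<open>m = 1\<close> lies over \<open>x = 0\<close>. The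
  polynomials \<open>qa\<close>, \<open>qb\<close>, \<open>qc\<close> are the coefficients of \<open>bi z m n\<close> as a quadratic polynomial in \<open>m\<close>.
\<close>

definition h1 :: "'a::comm_ring_1 \<Rightarrow> 'a \<Rightarrow> 'a" where "h1 z m = (z\<^sup>2 + 1) * m - 2 * z"
definition h2 :: "'a::comm_ring_1 \<Rightarrow> 'a \<Rightarrow> 'a" where "h2 z m = (z + 1) * m + z - 3"
definition h3 :: "'a::comm_ring_1 \<Rightarrow> 'a \<Rightarrow> 'a" where "h3 z m = (z - 1) * m - z - 3"
definition qa :: "'a::comm_ring_1 \<Rightarrow> 'a \<Rightarrow> 'a" where
  "qa z m = (z\<^sup>2 + 1) * (z - 1) * (m + 1) * h3 z m"
definition qb :: "'a::comm_ring_1 \<Rightarrow> 'a \<Rightarrow> 'a" where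
  "qb z m = 4 * (z^3 - 3 - 3 * z - 3 * z\<^sup>2 + 2 * z * (1 + z)\<^sup>2 * m + (1 - z) * (1 + z\<^sup>2) * m\<^sup>2)"
definition qc :: "'a::comm_ring_1 \<Rightarrow> 'a \<Rightarrow> 'a" where
  "qc z m = 9 + 30 * z - 6 * z\<^sup>2 - 2 * z^3 + z^4 - 4 * (3 + 3 * z + 3 * z\<^sup>2 - z^3) * m
     + (1 + z\<^sup>2) * (1 - z) * (z + 3) * m\<^sup>2"
definition bi :: "'a::comm_ring_1 \<Rightarrow> 'a \<Rightarrow> 'a \<Rightarrow> 'a" where
  "bi z m n = qa z n * m\<^sup>2 + qb z n * m + qc z n"
definition ck :: "'a::comm_ring_1 \<Rightarrow> 'a \<Rightarrow> 'a" where "ck z m = h1 z m * h2 z m * h3 z m"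
definition bj :: "'a::comm_ring_1 \<Rightarrow> 'a \<Rightarrow> 'a \<Rightarrow> 'a" where
  "bj z m n = z^4*m\<^sup>2*n + z^4*m*n\<^sup>2 + z^4*m + z^4*n - 2*z^3*m\<^sup>2 - 8*z^3*m*n - 2*z^3*n\<^sup>2 - 4*z^3 + 12*z\<^sup>2*m + 12*z\<^sup>2*n + 2*z*m\<^sup>2 - 8*z*m*n + 2*z*n\<^sup>2 - 12*z - m\<^sup>2*n - m*n\<^sup>2 + 3*m + 3*n"

lemmas curve_defs = h1_def h2_def h3_def qa_def qb_def qc_def bi_def ck_def bj_def

text \<open>
  The left side is the kernel \<open>1 - t\<^sup>2 x - 1/x - t\<^sup>2 y - 1/y\<close> at the abscissas \<open>x\<close>, \<open>y\<close> of \<open>m\<close> and \<open>n\<close>, cleared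
  of denominators, with \<open>t\<^sup>2\<close> replaced by its expression in \<open>z\<close>.
\<close>

lemma kernel_factors:
  fixes z m n :: "'a::idom"
  shows "16 * z^3 * (1 - m\<^sup>2) * ck z m * (1 - n\<^sup>2) * ck z n
     - (z\<^sup>2 - 1) * (z\<^sup>2 + 3)^3 * ((1 - m\<^sup>2)\<^sup>2 * (1 - n\<^sup>2) * ck z n + (1 - n\<^sup>2)\<^sup>2 * (1 - m\<^sup>2) * ck z m)
     - (ck z m)\<^sup>2 * (1 - n\<^sup>2) * ck z n - (ck z n)\<^sup>2 * (1 - m\<^sup>2) * ck z m
   = bi z m n * bi (-z) (-m) (-n) * bj z m n"
  unfolding curve_defs by algebra


definition cd :: "'a::comm_ring_1 \<Rightarrow> 'a \<Rightarrow> 'a" where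
  "cd z m = z^4 * m^4 - 2 * z^4 * m\<^sup>2 + z^4 + 16 * z^3 * m - 24 * z\<^sup>2 * m\<^sup>2 - 24 * z\<^sup>2 + 48 * z * m - m^4 - 6 * m\<^sup>2 - 9"
definition e2 :: "'a::comm_ring_1 \<Rightarrow> 'a \<Rightarrow> 'a \<Rightarrow> 'a" where
  "e2 z n m = (z - 3) * qa z n - (z + 1) * (qb z n + qa z n * m)"
definition e3 :: "'a::comm_ring_1 \<Rightarrow> 'a \<Rightarrow> 'a \<Rightarrow> 'a" where
  "e3 z n m = qa z n - (qb z n + qa z n * m)"
definition e4 :: "'a::comm_ring_1 \<Rightarrow> 'a \<Rightarrow> 'a \<Rightarrow> 'a" where
  "e4 z n m = - (z + 3) * qa z n - (z - 1) * (qb z n + qa z n * m)"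

text \<open>
  If \<open>bi z m n = 0\<close>, then the reciprocals of \<open>h2 z m\<close>, \<open>m + 1\<close> and \<open>h3 z m\<close> are linear in \<open>m\<close> with
  coefficients depending on \<open>n\<close>, namely \<open>e2\<close>, \<open>e3\<close>, \<open>e4\<close> up to factors. They are the remaining
  denominators of the partial fractions of \<open>F1\<close> and \<open>F4\<close>.
\<close>

lemma conj_products:
  fixes z m n :: "'a::idom"
  assumes "bi z m n = 0"
  shows "h2 z m * e2 z n m = - 8 * (z - 1) * (z\<^sup>2 + 3) * (n + 1) * h1 z n"
    "(m + 1) * e3 z n m = - 8 * (z + 1)\<^sup>2 * h2 z n"
    "h3 z m * e4 z n m = 8 * (z\<^sup>2 - 1) * (z\<^sup>2 + 3) * h3 z n"
proof -
  have "h2 z m * e2 z n m + (z + 1)\<^sup>2 * bi z m n = - 8 * (z - 1) * (z\<^sup>2 + 3) * (n + 1) * h1 z n"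
    unfolding e2_def curve_defs by algebra
  then show "h2 z m * e2 z n m = - 8 * (z - 1) * (z\<^sup>2 + 3) * (n + 1) * h1 z n"
    using assms by simp
  have "(m + 1) * e3 z n m + bi z m n = - 8 * (z + 1)\<^sup>2 * h2 z n"
    unfolding e3_def curve_defs by algebra
  then show "(m + 1) * e3 z n m = - 8 * (z + 1)\<^sup>2 * h2 z n"
    using assms by simp
  have "h3 z m * e4 z n m + (z - 1)\<^sup>2 * bi z m n = 8 * (z\<^sup>2 - 1) * (z\<^sup>2 + 3) * h3 z n"
    unfolding e4_def curve_defs by algebra
  then show "h3 z m * e4 z n m = 8 * (z\<^sup>2 - 1) * (z\<^sup>2 + 3) * h3 z n"
    using assms by simp
qed

text \<open>
  The derivative \<open>2 qa n + qb\<close> of the quadratic polynomial at its root \<open>n\<close> agrees up to the factor \<open>cd\<close> and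
  a denominator with the difference of the two solutions of the kernel equation, cf. \<open>disc_num\<close>. This is the
  origin of the polynomial \<open>D\<close>, of which \<open>cd\<close> is a scaled form.
\<close>

lemma kernel_root_difference:
  fixes z m n :: "'a::idom"
  assumes "bi z n m = 0"
  shows "2 * ((ck z n)\<^sup>2 - (z\<^sup>2 - 1) * (z\<^sup>2 + 3)^3 * (1 - n\<^sup>2)\<^sup>2) * (1 - m\<^sup>2) * ck z m
    = cd z m * (2 * qa z m * n + qb z m) * (1 - n\<^sup>2) * ck z n"
  using assms unfolding curve_defs cd_def by algebra

text \<open>
  The rational expressions of the parametrization. \<open>F1\<close> and \<open>F4\<close> belong to \<open>L(x,0)\<close> and \<open>B(0,x)\<close>, the
  functions \<open>F2\<close> and \<open>F3\<close> below to \<open>x L(0,x) / t\<close> and \<open>x B(x,0) / t\<close>.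
\<close>

definition F1 :: "'a::field \<Rightarrow> 'a \<Rightarrow> 'a" where
  "F1 z u = 256 * z ^ 4 * (u * z ^ 2 - 2 * z ^ 2 + u) / ((u * z + z ^ 2 + u - 3 * z) * (u + z) * (z - 1) * (z ^ 2 + 3) ^ 3)"
definition F4 :: "'a::field \<Rightarrow> 'a \<Rightarrow> 'a" where
  "F4 z u = 16 * z ^ 2 * (u * z ^ 2 - 2 * z ^ 2 + u) * poly_N2 z u
                / ((u + z) * (1 - z ^ 2) * (z ^ 2 + 3) ^ 3 * (u * z - z ^ 2 - u - 3 * z))"

text \<open>
  The constant \<open>L(0,0) - B(0,0)\<close>.
\<close>

definition kap :: "'a::field \<Rightarrow> 'a" where
  "kap z = 32 * z^3 * (z^3 - 3 * z\<^sup>2 + 3 * z + 3) / ((z + 1) * (z\<^sup>2 + 3)^3)"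
definition N2r :: "'a::comm_ring_1 \<Rightarrow> 'a \<Rightarrow> 'a" where
  "N2r z m = (z + 1) * (z - 1)\<^sup>2 * m\<^sup>2 - 4 * (3 * z + 1) * (z - 1) * m - (z^3 + 3 * z\<^sup>2 - 25 * z - 11)"

definition good_param :: "'a::field_char_0 \<Rightarrow> bool" where
  "good_param z \<longleftrightarrow> z \<noteq> 0 \<and> z \<noteq> 1 \<and> z + 1 \<noteq> 0 \<and> z\<^sup>2 + 3 \<noteq> 0 \<and> z\<^sup>2 + 1 \<noteq> 0"
definition good_point :: "'a::field_char_0 \<Rightarrow> 'a \<Rightarrow> bool" where
  "good_point z m \<longleftrightarrow> m + 1 \<noteq> 0 \<and> h1 z m \<noteq> 0 \<and> h2 z m \<noteq> 0 \<and> h3 z m \<noteq> 0"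

lemma F1_scaled:
  assumes "z \<noteq> 0"
  shows "F1 z (z * m) = 256 * z^3 * h1 z m / (h2 z m * (m + 1) * (z - 1) * (z\<^sup>2 + 3)^3)"
proof -
  have u: "z * m * z + z\<^sup>2 + z * m - 3 * z = z * h2 z m" "z * m + z = z * (m + 1)"
    "z * m * z\<^sup>2 - 2 * z\<^sup>2 + z * m = z * h1 z m"
    unfolding h1_def h2_def by algebra+
  have "256 * z ^ 4 * (z * h1 z m) / (z * h2 z m * (z * (m + 1)) * (z - 1) * (z ^ 2 + 3) ^ 3)
    = (z\<^sup>2 * (256 * z^3 * h1 z m)) / (z\<^sup>2 * (h2 z m * (m + 1) * (z - 1) * (z\<^sup>2 + 3)^3))"
    by (rule arg_cong2[where f = "(/)"]) algebra+
  then show ?thesis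
    unfolding F1_def u using assms by simp
qed

lemma F4_scaled:
  assumes "z \<noteq> 0"
  shows "F4 z (z * m) = 16 * z^3 * h1 z m * N2r z m / ((m + 1) * (1 - z\<^sup>2) * (z\<^sup>2 + 3)^3 * h3 z m)"
proof -
  have u: "z * m * z - z\<^sup>2 - z * m - 3 * z = z * h3 z m" "z * m + z = z * (m + 1)"
    "z * m * z\<^sup>2 - 2 * z\<^sup>2 + z * m = z * h1 z m" "poly_N2 z (z * m) = z\<^sup>2 * N2r z m"
    unfolding h1_def h3_def poly_N2_def N2r_def by algebra+
  have "16 * z ^ 2 * (z * h1 z m) * (z\<^sup>2 * N2r z m) / (z * (m + 1) * (1 - z ^ 2) * (z ^ 2 + 3) ^ 3 * (z * h3 z m))
    = (z\<^sup>2 * (16 * z^3 * h1 z m * N2r z m)) / (z\<^sup>2 * ((m + 1) * (1 - z\<^sup>2) * (z\<^sup>2 + 3)^3 * h3 z m))"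
    by (rule arg_cong2[where f = "(/)"]) algebra+
  then show ?thesis
    unfolding F4_def u using assms by simp
qed

lemma conj_quotients:
  assumes "bi z m n = 0" "good_param z" "good_point z m" "good_point z n"
  shows "1 / h2 z m = e2 z n m / (- 8 * (z - 1) * (z\<^sup>2 + 3) * (n + 1) * h1 z n)"
    "1 / (m + 1) = e3 z n m / (- 8 * (z + 1)\<^sup>2 * h2 z n)"
    "1 / h3 z m = e4 z n m / (8 * (z\<^sup>2 - 1) * (z\<^sup>2 + 3) * h3 z n)"
proof -
  have z: "z\<^sup>2 \<noteq> 1"
    using assms(2) by (auto simp: good_param_def power2_eq_1_iff)
  have q: "1 / a = b / c" if "a * b = c" "a \<noteq> 0" "c \<noteq> 0" for a b c :: 'a
    using that by (simp add: frac_eq_eq mult.commute)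
  note nz = assms(2,3,4)[unfolded good_param_def good_point_def]
  show "1 / h2 z m = e2 z n m / (- 8 * (z - 1) * (z\<^sup>2 + 3) * (n + 1) * h1 z n)"
    by (rule q[OF conj_products(1)[OF assms(1)]]) (use nz in auto)
  show "1 / (m + 1) = e3 z n m / (- 8 * (z + 1)\<^sup>2 * h2 z n)"
    by (rule q[OF conj_products(2)[OF assms(1)]]) (use nz in auto)
  show "1 / h3 z m = e4 z n m / (8 * (z\<^sup>2 - 1) * (z\<^sup>2 + 3) * h3 z n)"
    by (rule q[OF conj_products(3)[OF assms(1)]]) (use nz z in auto)
qed

text \<open>
  Partial fractions in \<open>m\<close>, followed by the linear expressions for the reciprocals.
\<close>

lemma F1_lin:
  assumes "bi z m n = 0" "good_param z" "good_point z m" "good_point z n"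
  shows "F1 z (z * m) = 8 * z^3 / ((z - 1) * (z\<^sup>2 + 3)^3) * (e2 z n m / ((n + 1) * h1 z n) - e3 z n m / h2 z n)"
proof -
  note nz = assms(2,3,4)[unfolded good_param_def good_point_def]
  have "F1 z (z * m) = 64 * z^3 / (z\<^sup>2 + 3)^3 * (- (z\<^sup>2 + 3) * (1 / h2 z m) + (z + 1)\<^sup>2 / (z - 1) * (1 / (m + 1)))"
    unfolding F1_scaled[OF conjunct1[OF nz(1)]]
    apply (simp add: divide_simps nz) apply (unfold h1_def h2_def)[1] apply algebra done
  also have "\<dots> = 8 * z^3 / ((z - 1) * (z\<^sup>2 + 3)^3) * (e2 z n m / ((n + 1) * h1 z n) - e3 z n m / h2 z n)"
    unfolding conj_quotients[OF assms]
    apply (simp add: divide_simps nz) apply algebra done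
  finally show ?thesis .
qed

lemma F4_lin:
  assumes "bi z m n = 0" "good_param z" "good_point z m" "good_point z n"
  shows "F4 z (z * m) = 16 * z^3 / (z\<^sup>2 + 3)^3 * ((z\<^sup>2 + 1) * - m + 2 * (5 * z^3 + 3 * z) / (z\<^sup>2 - 1)
     + e4 z n m / (2 * (z\<^sup>2 - 1) * h3 z n) + e3 z n m / (2 * (z - 1) * h2 z n))"
proof -
  note nz = assms(2,3,4)[unfolded good_param_def good_point_def]
  have z: "z\<^sup>2 \<noteq> 1" "1 \<noteq> z\<^sup>2"
    using assms(2) by (auto simp: good_param_def power2_eq_1_iff)
  have "F4 z (z * m) = 16 * z^3 / (z\<^sup>2 + 3)^3 * ((z\<^sup>2 + 1) * - m + 2 * (5 * z^3 + 3 * z) / (z\<^sup>2 - 1)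
     + 4 * (z\<^sup>2 + 3) * (1 / h3 z m) - 4 * (z + 1)\<^sup>2 / (z - 1) * (1 / (m + 1)))"
    unfolding F4_scaled[OF conjunct1[OF nz(1)]]
    apply (simp add: divide_simps nz z) apply (unfold h1_def h3_def N2r_def)[1] apply algebra done
  also have "\<dots> = 16 * z^3 / (z\<^sup>2 + 3)^3 * ((z\<^sup>2 + 1) * - m + 2 * (5 * z^3 + 3 * z) / (z\<^sup>2 - 1)
     + e4 z n m / (2 * (z\<^sup>2 - 1) * h3 z n) + e3 z n m / (2 * (z - 1) * h2 z n))"
    unfolding conj_quotients[OF assms]
    apply (simp add: divide_simps nz z) apply algebra done
  finally show ?thesis .
qed


lemma bi_roots_sum:
  fixes z m n k :: "'a::idom"
  assumes "bi z m k = 0" "bi z n k = 0" "m \<noteq> n"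
  shows "qa z k * (m + n) = - qb z k"
proof -
  have "(m - n) * (qa z k * (m + n) + qb z k) = 0"
    using assms(1,2) unfolding bi_def by algebra
  then show ?thesis
    using assms(3) by (simp add: eq_neg_iff_add_eq_0)
qed

text \<open>
  The first equation of the system for \<open>L(x,0)\<close> and \<open>B(0,x)\<close>, with \<open>m\<close>, \<open>n\<close> over \<open>x\<close>, \<open>1/x\<close> and \<open>k\<close> over
  \<open>Y\<close>. Only the sum of the roots \<open>m\<close>, \<open>n\<close> enters, since both values are linear in the root.
\<close>

lemma F1_sum:
  assumes "bi z m k = 0" "bi z n k = 0" "m \<noteq> n"
    and "good_param z" "good_point z m" "good_point z n" "good_point z k"
  shows "F1 z (z * m) + F1 z (z * n) = 16 * z^3 * (1 - k\<^sup>2) / ck z k + F4 z (z * k) + kap z"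
proof -
  note nz = assms(4,7)[unfolded good_param_def good_point_def]
  have z: "z\<^sup>2 \<noteq> 1" "1 \<noteq> z\<^sup>2"
    using assms(4) by (auto simp: good_param_def power2_eq_1_iff)
  note s = bi_roots_sum[OF assms(1-3)]
  have e: "e2 z k m + e2 z k n = 2 * (z - 3) * qa z k - (z + 1) * qb z k" "e3 z k m + e3 z k n = 2 * qa z k - qb z k"
    using s unfolding e2_def e3_def by algebra+
  have fractions: "c * (a / p - b / q) + c * (a' / p - b' / q) = c * ((a + a') / p - (b + b') / q)"
    for c a b p q a' b' :: 'a
    by (simp add: algebra_simps add_divide_distrib)
  have "F1 z (z * m) + F1 z (z * n) = 8 * z^3 / ((z - 1) * (z\<^sup>2 + 3)^3) *
      ((e2 z k m + e2 z k n) / ((k + 1) * h1 z k) - (e3 z k m + e3 z k n) / h2 z k)"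
    unfolding F1_lin[OF assms(1,4,5,7)] F1_lin[OF assms(2,4,6,7)] by (rule fractions)
  also have "\<dots> = 16 * z^3 * (1 - k\<^sup>2) / ck z k + F4 z (z * k) + kap z"
    unfolding e F4_scaled[OF conjunct1[OF nz(1)]] kap_def ck_def
    apply (simp add: divide_simps nz z)
    apply (unfold curve_defs N2r_def)[1]
    apply algebra
    done
  finally show ?thesis .
qed

text \<open>
  The second equation of the system.
\<close>

lemma F4_sum:
  assumes "bi z m k = 0" "bi z n k = 0" "m \<noteq> n"
    and "good_param z" "good_point z m" "good_point z n" "good_point z k"
  shows "F4 z (z * m) + F4 z (z * n) = F1 z (z * k) - kap z"
proof -
  note nz = assms(4,7)[unfolded good_param_def good_point_def]
  have z: "z\<^sup>2 \<noteq> 1" "1 \<noteq> z\<^sup>2"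
    using assms(4) by (auto simp: good_param_def power2_eq_1_iff)
  note s = bi_roots_sum[OF assms(1-3)]
  have e: "e4 z k m + e4 z k n = - 2 * (z + 3) * qa z k - (z - 1) * qb z k" "e3 z k m + e3 z k n = 2 * qa z k - qb z k"
    using s unfolding e4_def e3_def by algebra+
  have q: "m + n = - qb z k / qa z k"
  proof -
    have "qa z k \<noteq> 0"
      using nz by (simp add: qa_def)
    then have "m + n = (qa z k * (m + n)) / qa z k"
      by simp
    then show ?thesis
      unfolding s .
  qed
  have fractions: "c * (w * - m + r + a / p + b / q) + c * (w * - n + r + a' / p + b' / q) =
      c * (w * - (m + n) + 2 * r + (a + a') / p + (b + b') / q)" for c w r a b p q a' b' :: 'a
    by (simp add: algebra_simps add_divide_distrib)
  have "F4 z (z * m) + F4 z (z * n) = 16 * z^3 / (z\<^sup>2 + 3)^3 * ((z\<^sup>2 + 1) * - (m + n) + 2 * (2 * (5 * z^3 + 3 * z) / (z\<^sup>2 - 1))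
     + (e4 z k m + e4 z k n) / (2 * (z\<^sup>2 - 1) * h3 z k) + (e3 z k m + e3 z k n) / (2 * (z - 1) * h2 z k))"
    unfolding F4_lin[OF assms(1,4,5,7)] F4_lin[OF assms(2,4,6,7)] by (rule fractions)
  also have "\<dots> = F1 z (z * k) - kap z"
    unfolding e q F1_scaled[OF conjunct1[OF nz(1)]] kap_def qa_def
    apply (simp add: divide_simps nz z)
    apply (unfold curve_defs)[1]
    apply algebra
    done
  finally show ?thesis .
qed


definition F2 :: "'a::field \<Rightarrow> 'a \<Rightarrow> 'a" where
  "F2 z u = 256 * z ^ 6 * (u - z) * (u * z - z ^ 2 - u - 3 * z) * (u ^ 2 * z ^ 2 - z ^ 4 - 4 * u * z ^ 2 + u ^ 2 + 3 * z ^ 2)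
     / (poly_D z u * (z - 1) * (z ^ 2 + 3) ^ 3)"
definition F3 :: "'a::field \<Rightarrow> 'a \<Rightarrow> 'a" where
  "F3 z u = - (512 * z ^ 6 * (u * z ^ 2 - 2 * z ^ 2 + u) * (u - z) * poly_N1 z u
     / ((z ^ 2 - 1) * (z ^ 2 + 3) ^ 3 * poly_D z u))"
definition qd :: "'a::comm_ring_1 \<Rightarrow> 'a \<Rightarrow> 'a" where
  "qd z m = m\<^sup>2 * z\<^sup>2 - z\<^sup>2 - 4 * m * z + m\<^sup>2 + 3"
definition N1r :: "'a::comm_ring_1 \<Rightarrow> 'a \<Rightarrow> 'a" where
  "N1r z m = z\<^sup>2 * m\<^sup>2 + 2 * z\<^sup>2 * m + z\<^sup>2 - 2 * z * m - 6 * z - m\<^sup>2 - 3"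

lemma poly_D_scaled: "poly_D z (z * m) = z^4 * cd z m" for z m :: "'a::idom"
  unfolding poly_D_def cd_def by algebra

lemma F2_scaled:
  assumes "z \<noteq> 0"
  shows "F2 z (z * m) = 256 * z^6 * (m - 1) * h3 z m * qd z m / (cd z m * (z - 1) * (z\<^sup>2 + 3)^3)"
proof -
  have u: "z * m * z - z\<^sup>2 - z * m - 3 * z = z * h3 z m" "z * m - z = z * (m - 1)"
    "(z * m)\<^sup>2 * z\<^sup>2 - z ^ 4 - 4 * (z * m) * z\<^sup>2 + (z * m)\<^sup>2 + 3 * z\<^sup>2 = z\<^sup>2 * qd z m"
    unfolding h3_def qd_def by algebra+
  have "256 * z ^ 6 * (z * (m - 1)) * (z * h3 z m) * (z\<^sup>2 * qd z m) / (z^4 * cd z m * (z - 1) * (z ^ 2 + 3) ^ 3)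
    = (z^4 * (256 * z^6 * (m - 1) * h3 z m * qd z m)) / (z^4 * (cd z m * (z - 1) * (z\<^sup>2 + 3)^3))"
    by (rule arg_cong2[where f = "(/)"]) algebra+
  then show ?thesis
    unfolding F2_def u poly_D_scaled using assms by simp
qed

lemma F3_scaled:
  assumes "z \<noteq> 0"
  shows "F3 z (z * m) = - (512 * z^6 * (m - 1) * h1 z m * N1r z m / (cd z m * (z\<^sup>2 - 1) * (z\<^sup>2 + 3)^3))"
proof -
  have u: "z * m * z\<^sup>2 - 2 * z\<^sup>2 + z * m = z * h1 z m" "z * m - z = z * (m - 1)"
    "poly_N1 z (z * m) = z\<^sup>2 * N1r z m"
    unfolding h1_def poly_N1_def N1r_def by algebra+
  have "512 * z ^ 6 * (z * h1 z m) * (z * (m - 1)) * (z\<^sup>2 * N1r z m) / ((z\<^sup>2 - 1) * (z ^ 2 + 3) ^ 3 * (z^4 * cd z m))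
    = (z^4 * (512 * z^6 * (m - 1) * h1 z m * N1r z m)) / (z^4 * (cd z m * (z\<^sup>2 - 1) * (z\<^sup>2 + 3)^3))"
    by (rule arg_cong2[where f = "(/)"]) algebra+
  then show ?thesis
    unfolding F3_def u poly_D_scaled using assms by simp
qed

text \<open>
  The numerator of \<open>t(1/y - y)\<close> at the point with parameter \<open>n\<close>, where \<open>y\<close> is \<open>t\<close> times its abscissa.
\<close>

definition disc_num :: "'a::comm_ring_1 \<Rightarrow> 'a \<Rightarrow> 'a" where
  "disc_num z n = (ck z n)\<^sup>2 - (z\<^sup>2 - 1) * (z\<^sup>2 + 3)^3 * (1 - n\<^sup>2)\<^sup>2"

lemma disc_num_transfer:
  assumes "bi z n m = 0" "good_param z" "good_point z m" "good_point z n" "disc_num z n \<noteq> 0"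
    "m \<noteq> 1" "n \<noteq> 1"
  shows "disc_num z n / (16 * z^3 * (1 - n\<^sup>2) * ck z n) =
      cd z m * ((2 * qa z m * n + qb z m) / (32 * z^3 * (1 - m\<^sup>2) * ck z m))" "cd z m \<noteq> 0"
proof -
  note nz = assms(2,3,4)[unfolded good_param_def good_point_def]
  have k: "ck z m \<noteq> 0" "ck z n \<noteq> 0"
    using nz by (auto simp: ck_def)
  have s: "m\<^sup>2 \<noteq> 1" "n\<^sup>2 \<noteq> 1" "1 \<noteq> m\<^sup>2" "1 \<noteq> n\<^sup>2"
    using nz assms(6,7) by (auto simp: power2_eq_1_iff eq_neg_iff_add_eq_0)
  have e: "2 * disc_num z n * (1 - m\<^sup>2) * ck z m = cd z m * (2 * qa z m * n + qb z m) * (1 - n\<^sup>2) * ck z n"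
    unfolding disc_num_def by (rule kernel_root_difference[OF assms(1)])
  then show "cd z m \<noteq> 0"
    using assms(5) k s by auto
  have "disc_num z n * (32 * z^3 * (1 - m\<^sup>2) * ck z m) = cd z m * (2 * qa z m * n + qb z m) * (16 * z^3 * (1 - n\<^sup>2) * ck z n)"
    using e by algebra
  then show "disc_num z n / (16 * z^3 * (1 - n\<^sup>2) * ck z n) =
      cd z m * ((2 * qa z m * n + qb z m) / (32 * z^3 * (1 - m\<^sup>2) * ck z m))"
    unfolding times_divide_eq_right using nz k s by (subst frac_eq_eq) auto
qed

text \<open>
  The equation of \<open>L\<close> at a kernel pair, solved for \<open>L(0,x)\<close>; the first factor is \<open>t(1/y - y)\<close>.
\<close>

lemma F2_identity:
  assumes "bi z n m = 0" "good_param z" "good_point z m" "good_point z n" "disc_num z n \<noteq> 0"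
    "m \<noteq> 1" "n \<noteq> 1"
  shows "disc_num z n / (16 * z^3 * (1 - n\<^sup>2) * ck z n) * F2 z (z * m) =
     16 * z^3 * (1 - m\<^sup>2) / ck z m - 2 * F1 z (z * n) + F4 z (z * m) + kap z"
proof -
  note nz = assms(2,3,4)[unfolded good_param_def good_point_def]
  note c = disc_num_transfer(2)[OF assms]
  have z: "z\<^sup>2 \<noteq> 1" "1 \<noteq> z\<^sup>2" and m: "m\<^sup>2 \<noteq> 1" "1 \<noteq> m\<^sup>2"
    using assms(2) nz assms(6) by (auto simp: good_param_def power2_eq_1_iff eq_neg_iff_add_eq_0)
  have "disc_num z n / (16 * z^3 * (1 - n\<^sup>2) * ck z n) * F2 z (z * m) =
      - 8 * z^3 * (2 * qa z m * n + qb z m) * qd z m / ((z - 1) * (z\<^sup>2 + 3)^3 * (m + 1) * h1 z m * h2 z m)"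
    unfolding disc_num_transfer(1)[OF assms] F2_scaled[OF conjunct1[OF nz(1)]]
    unfolding ck_def
    apply (simp add: divide_simps nz z c m)
    apply algebra
    done
  also have "\<dots> = 16 * z^3 * (1 - m\<^sup>2) / ck z m - 2 * F1 z (z * n) + F4 z (z * m) + kap z"
    unfolding F1_lin[OF assms(1,2,4,3)] F4_scaled[OF conjunct1[OF nz(1)]] kap_def e2_def e3_def ck_def
    apply (simp add: divide_simps nz z m)
    apply (unfold curve_defs N2r_def qd_def)[1]
    apply algebra
    done
  finally show ?thesis .
qed

text \<open>
  The equation of \<open>B\<close> at a kernel pair, solved for \<open>B(x,0)\<close>.
\<close>

lemma F3_identity:
  assumes "bi z n m = 0" "good_param z" "good_point z m" "good_point z n" "disc_num z n \<noteq> 0"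
    "m \<noteq> 1" "n \<noteq> 1"
  shows "disc_num z n / (16 * z^3 * (1 - n\<^sup>2) * ck z n) * F3 z (z * m) =
     F1 z (z * m) - 2 * F4 z (z * n) - kap z"
proof -
  note nz = assms(2,3,4)[unfolded good_param_def good_point_def]
  note c = disc_num_transfer(2)[OF assms]
  have z: "z\<^sup>2 \<noteq> 1" "1 \<noteq> z\<^sup>2" and m: "m\<^sup>2 \<noteq> 1" "1 \<noteq> m\<^sup>2"
    using assms(2) nz assms(6) by (auto simp: good_param_def power2_eq_1_iff eq_neg_iff_add_eq_0)
  have "disc_num z n / (16 * z^3 * (1 - n\<^sup>2) * ck z n) * F3 z (z * m) =
      16 * z^3 * (2 * qa z m * n + qb z m) * N1r z m / ((z\<^sup>2 - 1) * (z\<^sup>2 + 3)^3 * (m + 1) * h2 z m * h3 z m)"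
    unfolding disc_num_transfer(1)[OF assms] F3_scaled[OF conjunct1[OF nz(1)]]
    unfolding ck_def
    apply (simp add: divide_simps nz z c m)
    apply algebra
    done
  also have "\<dots> = F1 z (z * m) - 2 * F4 z (z * n) - kap z"
    unfolding F4_lin[OF assms(1,2,4,3)] F1_scaled[OF conjunct1[OF nz(1)]] kap_def e4_def e3_def
    apply (simp add: divide_simps nz z m)
    apply (unfold curve_defs N1r_def)[1]
    apply algebra
    done
  finally show ?thesis .
qed

section \<open>The series T, Z and U\<close>

lemma fps_nth_numeral_0: "fps_nth (numeral k :: 'a::comm_ring_1 fps) 0 = numeral k"
  by (simp add: numeral_fps_const)

lemmas const_simps = fps_mult_nth_0 fps_nth_numeral_0 fps_power_zeroth

definition T_poly :: "rat fps poly" where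
  "T_poly = [:-1, 1:] * [:3, 1:] ^ 3 - [:256 * fps_X\<^sup>2:] * [:0, 1:] ^ 3"

lemma is_T_iff: "is_T T \<longleftrightarrow> fps_nth T 0 = 1 \<and> poly T_poly T = 0"
proof -
  have "T = 1 + 256 * fps_X ^ 2 * (T ^ 3 / (T + 3) ^ 3) \<longleftrightarrow> poly T_poly T = 0" if T: "fps_nth T 0 = 1"
  proof -
    have u: "fps_nth ((T + 3) ^ 3) 0 \<noteq> 0"
      using T by (simp add: const_simps)
    have i: "inverse ((T + 3)^3) * (T + 3)^3 = 1"
      by (rule inverse_mult_eq_1) (rule u)
    have d: "T ^ 3 / (T + 3) ^ 3 = T^3 * inverse ((T + 3)^3)"
      by (rule fps_divide_unit) (rule u)
    have nz: "(T + 3)^3 \<noteq> 0"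
      using u by (metis fps_zero_nth)
    have "T = 1 + 256 * fps_X ^ 2 * (T ^ 3 * inverse ((T + 3) ^ 3)) \<longleftrightarrow>
      T * (T + 3)^3 = (1 + 256 * fps_X ^ 2 * (T ^ 3 * inverse ((T + 3) ^ 3))) * (T + 3)^3"
      using nz by simp
    also have "(1 + 256 * fps_X ^ 2 * (T ^ 3 * inverse ((T + 3) ^ 3))) * (T + 3)^3 = (T + 3)^3 + 256 * fps_X ^ 2 * T ^ 3"
      using i by algebra
    finally show ?thesis
      unfolding d by (simp add: T_poly_def algebra_simps)
  qed
  then show ?thesis
    unfolding is_T_def by blast
qed

lemma ex1_T: "\<exists>!T. is_T T"
  unfolding is_T_iff
proof (rule hensel)
  show "fps_nth (poly T_poly (fps_const 1)) 0 = 0"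
    by (simp add: T_poly_def const_simps)
  show "fps_nth (poly (pderiv T_poly) (fps_const 1)) 0 * (1/64) = 1"
    by (simp add: T_poly_def pderiv_diff pderiv_smult pderiv_mult pderiv_power pderiv_pCons const_simps)
qed

lemma ex1_Z:
  assumes "is_T T"
  shows "\<exists>!Z. is_Z T Z"
proof -
  have "\<exists>!Z. fps_nth Z 0 = 1 \<and> poly [:-T, 0, 1:] Z = 0"
  proof (rule hensel)
    show "fps_nth (poly [:-T, 0, 1:] (fps_const 1)) 0 = 0"
      using assms by (simp add: is_T_def)
    show "fps_nth (poly (pderiv [:-T, 0, 1:]) (fps_const 1)) 0 * (1/2) = 1"
      by (simp add: pderiv_pCons const_simps)
  qed
  moreover have "poly [:-T, 0, 1:] Z = 0 \<longleftrightarrow> Z\<^sup>2 = T" for Z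
    by (auto simp: power2_eq_square algebra_simps)
  ultimately show ?thesis
    by (simp add: is_Z_def)
qed

text \<open>
  The series \<open>Z - 1\<close> vanishes to order exactly 2. Its cofactor \<open>zeta\<close> makes the orders of the
  denominators at \<open>t = 0\<close> explicit. Its constant term is 2 because the equation of \<open>z\<close> reduces to
  \<open>2 \<cdot> 4\<^sup>3 zeta = 256\<close>.
\<close>

definition zeta_poly :: "rat fps poly" where
  "zeta_poly = [:0, 1:] * [:2, fps_X\<^sup>2:] * ([:1, fps_X\<^sup>2:] ^ 2 + [:3:]) ^ 3 - [:256:] * [:1, fps_X\<^sup>2:] ^ 6"

definition zeta :: "rat fps" where
  "zeta = (THE a. fps_nth a 0 = 2 \<and> poly zeta_poly a = 0)"

lemma zeta: "fps_nth zeta 0 = 2" "poly zeta_poly zeta = 0"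
proof -
  have "\<exists>!a. fps_nth a 0 = 2 \<and> poly zeta_poly a = 0"
  proof (rule hensel)
    show "fps_nth (poly zeta_poly (fps_const 2)) 0 = 0"
      by (simp add: zeta_poly_def const_simps)
    show "fps_nth (poly (pderiv zeta_poly) (fps_const 2)) 0 * (1/128) = 1"
      unfolding zeta_poly_def pderiv_diff pderiv_add pderiv_mult pderiv_power pderiv_pCons
      by (simp add: const_simps)
  qed
  from theI'[OF this] show "fps_nth zeta 0 = 2" "poly zeta_poly zeta = 0"
    by (simp_all add: zeta_def)
qed

definition ZQ :: "rat fps" where "ZQ = 1 + fps_X\<^sup>2 * zeta"

lemma ZQ_curve: "(ZQ\<^sup>2 - 1) * (ZQ\<^sup>2 + 3)^3 = 256 * fps_X\<^sup>2 * ZQ^6"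
proof -
  have "zeta * (2 + fps_X\<^sup>2 * zeta) * (ZQ\<^sup>2 + 3)^3 = 256 * ZQ^6"
    using zeta(2) unfolding zeta_poly_def ZQ_def by (simp add: algebra_simps)
  then show ?thesis
    unfolding ZQ_def by algebra
qed

lemma is_T_ZQ: "is_T (ZQ\<^sup>2)"
proof -
  have "poly T_poly (ZQ\<^sup>2) = (ZQ\<^sup>2 - 1) * (ZQ\<^sup>2 + 3)^3 - 256 * fps_X\<^sup>2 * (ZQ\<^sup>2)^3"
    by (simp add: T_poly_def algebra_simps)
  also have "\<dots> = 0"
    using ZQ_curve by algebra
  finally have "poly T_poly (ZQ\<^sup>2) = 0" .
  moreover have "fps_nth (ZQ\<^sup>2) 0 = 1"
    by (simp add: ZQ_def const_simps)
  ultimately show ?thesis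
    by (simp add: is_T_iff)
qed

lemma is_T_unique: "is_T T \<Longrightarrow> T = ZQ\<^sup>2"
  using ex1_T is_T_ZQ by blast

lemma is_Z_unique: "is_Z (ZQ\<^sup>2) Z \<Longrightarrow> Z = ZQ"
proof -
  assume "is_Z (ZQ\<^sup>2) Z"
  moreover have "is_Z (ZQ\<^sup>2) ZQ"
    by (simp add: is_Z_def) (simp add: ZQ_def const_simps)
  ultimately show ?thesis
    using ex1_Z[OF is_T_ZQ] by blast
qed

definition U_poly :: "'a::idom fps \<Rightarrow> 'a fps \<Rightarrow> 'a fps poly" where
  "U_poly T x = [:16 * T\<^sup>2:] * ([:0, 1:]\<^sup>2 - [:T:])
     - [:x:] * [:- 2 * T, 1 + T:] * ([:0, 1:]\<^sup>2 - [:9 * T:] + [:0, 8 * T:] + [:T\<^sup>2:] - [:T:] * [:0, 1:]\<^sup>2)"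

lemma poly_U_poly:
  "poly (U_poly T x) u = 16 * T\<^sup>2 * (u\<^sup>2 - T)
     - x * (u + u * T - 2 * T) * (u\<^sup>2 - 9 * T + 8 * T * u + T\<^sup>2 - T * u\<^sup>2)"
  by (simp add: U_poly_def algebra_simps)

lemma U_poly_hensel:
  fixes T x :: "'a::idom fps" and d :: 'a
  assumes "fps_nth T 0 = 1" "32 * d = 1"
  shows "\<exists>!u. fps_nth u 0 = 1 \<and> poly (U_poly T x) u = 0"
proof (rule hensel)
  show "fps_nth (poly (U_poly T x) (fps_const 1)) 0 = 0"
    using assms by (simp add: poly_U_poly const_simps)
  show "fps_nth (poly (pderiv (U_poly T x)) (fps_const 1)) 0 * d = 1"
    using assms by (simp add: U_poly_def pderiv_diff pderiv_smult pderiv_add pderiv_mult pderiv_power pderiv_pCons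
        const_simps power2_eq_square)
qed

definition LQx :: "rat poly fps \<Rightarrow> qxy fps" where "LQx f = Abs_fps (\<lambda>n. emb_poly [:fps_nth f n:])"
definition LQ :: "rat fps \<Rightarrow> qxy fps" where "LQ f = Abs_fps (\<lambda>n. emb_poly [:[:fps_nth f n:]:])"
definition liftP :: "rat fps \<Rightarrow> rat poly poly fps" where "liftP f = Abs_fps (\<lambda>n. [:[:fps_nth f n:]:])"

lemma lift_Q_LQ: "lift_Q f = fps_to_fls (LQ f)" and lift_Qx_LQx: "lift_Qx g = fps_to_fls (LQx g)"
  by (simp_all add: lift_Q_def LQ_def lift_Qx_def LQx_def)

lemma ring_map_LQx: "ring_map LQx" and ring_map_LQ: "ring_map LQ" and ring_map_liftP: "ring_map liftP"
proof -
  show "ring_map LQx"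
    unfolding LQx_def
    by (intro ring_map_coeffwise ring_map_compose[OF ring_map_emb_poly] ring_map_const_poly)
  show "ring_map LQ"
    unfolding LQ_def
    by (intro ring_map_coeffwise ring_map_compose[OF ring_map_emb_poly]
        ring_map_compose[OF ring_map_const_poly] ring_map_const_poly)
  show "ring_map liftP"
    unfolding liftP_def
    by (intro ring_map_coeffwise ring_map_compose[OF ring_map_const_poly] ring_map_const_poly)
qed

lemma subst_xy_liftP: "subst_xy (liftP f) a b = LQ f"
proof (rule fps_ext)
  fix n
  have p: "poly2 [:[:c:]:] a b = emb_rat c" for c
    by (simp add: poly2_def map_poly_pCons ring_map_simps[OF ring_map_emb_rat])
  have "(\<Sum>m\<le>n. fps_nth (poly2 [:[:fps_nth f m:]:] a b) (n - m)) =
      (\<Sum>m\<in>{n}. fps_nth (poly2 [:[:fps_nth f m:]:] a b) (n - m))"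
    unfolding p by (rule sum.mono_neutral_right) (auto simp: emb_rat_def)
  then show "fps_nth (subst_xy (liftP f) a b) n = fps_nth (LQ f) n"
    by (simp add: subst_xy_def liftP_def LQ_def p) (simp add: emb_rat_def)
qed

lemma LQ_X: "LQ fps_X = fps_X" and LQx_X: "LQx fps_X = fps_X" and liftP_X: "liftP fps_X = fps_X"
  by (auto simp: LQ_def LQx_def liftP_def fps_eq_iff one_pCons[symmetric])

lemma LQx_const: "LQx (Abs_fps (\<lambda>n. [:fps_nth f n:])) = LQ f"
  and LQx_x: "LQx (fps_const [:0, 1:]) = vx"
  by (auto simp: LQ_def LQx_def fps_eq_iff vx_def)

lemma is_U_iff:
  "is_U T U \<longleftrightarrow> fps_nth U 0 = 1 \<and> poly (U_poly (Abs_fps (\<lambda>n. [:fps_nth T n:])) (fps_const [:0, 1:])) U = 0"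
  unfolding is_U_def Let_def poly_U_poly by (simp add: mult.assoc)

lemma ex1_U:
  assumes "is_T T"
  shows "\<exists>!U. is_U T U"
  unfolding is_U_iff
  by (rule U_poly_hensel[of _ "[:1/32:]"])
     (use assms in \<open>simp_all add: is_T_def one_pCons numeral_poly\<close>)

definition ZP :: "rat poly poly fps" where "ZP = liftP ZQ"
definition zetaP :: "rat poly poly fps" where "zetaP = liftP zeta"
definition ZF :: "qxy fps" where "ZF = LQ ZQ"
definition zetaF :: "qxy fps" where "zetaF = LQ zeta"

lemma ZF: "ZF = 1 + fps_X\<^sup>2 * zetaF" "(ZF\<^sup>2 - 1) * (ZF\<^sup>2 + 3)^3 = 256 * fps_X\<^sup>2 * ZF^6"
  "fps_nth zetaF 0 = 2" "fps_nth ZF 0 = 1"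
proof -
  note h = ring_map_simps[OF ring_map_LQ] LQ_X
  show 1: "ZF = 1 + fps_X\<^sup>2 * zetaF"
    by (simp add: ZF_def zetaF_def ZQ_def h)
  show "(ZF\<^sup>2 - 1) * (ZF\<^sup>2 + 3)^3 = 256 * fps_X\<^sup>2 * ZF^6"
    using arg_cong[OF ZQ_curve, of LQ] by (simp only: ZF_def h)
  show "fps_nth zetaF 0 = 2"
    using ring_map_simps(8)[OF ring_map_compose[OF ring_map_emb_poly ring_map_compose[OF ring_map_const_poly ring_map_const_poly]], of "Num.Bit0 Num.One"]
    by (simp add: zetaF_def LQ_def zeta)
  show "fps_nth ZF 0 = 1"
    by (simp add: 1 const_simps)
qed

lemma ZP: "ZP = 1 + fps_X\<^sup>2 * zetaP" "fps_nth zetaP 0 = 2" "fps_nth ZP 0 = 1"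
proof -
  note h = ring_map_simps[OF ring_map_liftP] liftP_X
  show 1: "ZP = 1 + fps_X\<^sup>2 * zetaP"
    by (simp add: ZP_def zetaP_def ZQ_def h)
  show "fps_nth zetaP 0 = 2"
    by (simp add: zetaP_def liftP_def zeta numeral_poly)
  show "fps_nth ZP 0 = 1"
    by (simp add: 1 const_simps)
qed

text \<open>
  The series \<open>U\<close> for the abscissa \<open>x/t\<close> agrees with \<open>Z\<close> below order 5. The quotient
  \<open>r = (U - Z) / t\<^sup>5\<close> has coefficients in \<open>\<rat>[x]\<close>, with constant term \<open>2 x\<close>; so every series, also one that
  depends on \<open>t\<close>, can be substituted for \<open>x\<close>.
\<close>

definition r_poly :: "rat poly poly fps poly" where
  "r_poly = [:16 * ZP^4:] * [:0, 1:] * [:2 * ZP, fps_X^5:]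
     + [:xx:] * [:ZP * zetaP\<^sup>2, fps_X * (1 + ZP\<^sup>2):] * [:2 * ZP * zetaP, (ZP + 1) * fps_X^3:]
       * [:(ZP - 1) * ZP - ZP * (ZP + 3), (ZP - 1) * fps_X^5:]"

lemma ex1_r: "\<exists>!r. fps_nth r 0 = 2 * fps_nth xx 0 \<and> poly r_poly r = 0"
proof (rule hensel)
  show "fps_nth (poly r_poly (fps_const (2 * fps_nth xx 0))) 0 = 0"
    by (simp add: r_poly_def const_simps ZP algebra_simps)
  show "fps_nth (poly (pderiv r_poly) (fps_const (2 * fps_nth xx 0))) 0 * [:[:1/32:]:] = 1"
    by (simp add: r_poly_def pderiv_add pderiv_smult pderiv_mult pderiv_pCons const_simps ZP)
       (simp add: numeral_poly one_pCons)
qed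

definition rP :: "rat poly poly fps" where "rP = (THE r. fps_nth r 0 = 2 * fps_nth xx 0 \<and> poly r_poly r = 0)"
definition rF :: "qxy fps \<Rightarrow> qxy fps" where "rF X = subst_xy rP X 0"
definition UF :: "qxy fps \<Rightarrow> qxy fps" where "UF X = ZF + fps_X^5 * rF X"

lemma rP: "fps_nth rP 0 = 2 * fps_nth xx 0" "poly r_poly rP = 0"
  using theI'[OF ex1_r] by (simp_all add: rP_def)

lemma subst_xy_ZP: "subst_xy ZP a b = ZF" "subst_xy zetaP a b = zetaF"
  by (simp_all add: ZP_def zetaP_def ZF_def zetaF_def subst_xy_liftP)

lemma rF_eq:
  "16 * ZF^4 * rF X * (2 * ZF + fps_X^5 * rF X) =
     - X * (ZF * zetaF\<^sup>2 + fps_X * (1 + ZF\<^sup>2) * rF X) * (2 * ZF * zetaF + (ZF + 1) * fps_X^3 * rF X)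
       * ((ZF - 1) * UF X - ZF * (ZF + 3))"
proof -
  have "16 * ZP^4 * rP * (2 * ZP + fps_X^5 * rP) +
     xx * (ZP * zetaP\<^sup>2 + fps_X * (1 + ZP\<^sup>2) * rP) * (2 * ZP * zetaP + (ZP + 1) * fps_X^3 * rP)
       * ((ZP - 1) * ZP - ZP * (ZP + 3) + (ZP - 1) * fps_X^5 * rP) = 0"
    using rP(2) by (simp add: r_poly_def algebra_simps)
  from arg_cong[OF this, of "\<lambda>S. subst_xy S X 0"]
  have "16 * ZF^4 * rF X * (2 * ZF + fps_X^5 * rF X) +
     X * (ZF * zetaF\<^sup>2 + fps_X * (1 + ZF\<^sup>2) * rF X) * (2 * ZF * zetaF + (ZF + 1) * fps_X^3 * rF X)
       * ((ZF - 1) * ZF - ZF * (ZF + 3) + (ZF - 1) * fps_X^5 * rF X) = 0"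
    by (simp only: subst_xy_simps subst_xy_ZP rF_def)
  then show ?thesis
    unfolding UF_def by algebra
qed

text \<open>The equation that defines \<open>U\<close>, with \<open>x\<close> replaced by \<open>X/t\<close> and the right side split into linear factors.\<close>

lemma UF_eq:
  "16 * fps_X * ZF^4 * ((UF X)\<^sup>2 - ZF\<^sup>2) =
     - X * (UF X * (ZF\<^sup>2 + 1) - 2 * ZF\<^sup>2) * ((ZF + 1) * UF X + ZF\<^sup>2 - 3 * ZF) * ((ZF - 1) * UF X - ZF\<^sup>2 - 3 * ZF)"
  using rF_eq[of X] unfolding UF_def ZF(1) by algebra

lemma UF_0: "UF 0 = ZF"
proof -
  have "16 * ZF^4 * (2 * ZF + fps_X^5 * rF 0) * rF 0 = 0"
    using rF_eq[of 0] by (simp add: mult_ac)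
  moreover have "16 * ZF^4 * (2 * ZF + fps_X^5 * rF 0) \<noteq> 0"
  proof -
    have "fps_nth (16 * ZF^4 * (2 * ZF + fps_X^5 * rF 0)) 0 = 32"
      by (simp add: const_simps ZF)
    then show ?thesis by force
  qed
  ultimately show ?thesis
    by (simp add: UF_def)
qed

text \<open>
  The series of the theorem is the instance \<open>X = x t\<close>.
\<close>

lemma UF_unique:
  assumes "is_U (ZQ\<^sup>2) U"
  shows "LQx U = UF (vx * vt)"
proof -
  define p where "p = U_poly (ZF\<^sup>2) vx"
  note h = ring_map_simps[OF ring_map_LQx]
  have *: "\<exists>!u. fps_nth u 0 = 1 \<and> poly p u = 0"
    unfolding p_def by (rule U_poly_hensel[of _ "1/32"]) (simp_all add: const_simps ZF)
  have T: "LQx (Abs_fps (\<lambda>n. [:fps_nth (ZQ\<^sup>2) n:])) = ZF\<^sup>2"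
    unfolding LQx_const ZF_def by (rule ring_map_simps[OF ring_map_LQ])
  have "poly p (LQx U) = 0"
    using arg_cong[OF conjunct2[OF assms[unfolded is_U_iff poly_U_poly]], of LQx]
    unfolding p_def poly_U_poly h T LQx_x .
  moreover have "fps_nth (LQx U) 0 = 1"
    using assms by (simp add: is_U_def LQx_def one_pCons[symmetric])
  moreover have "fps_X * poly p (UF (vx * vt)) = 0"
    using UF_eq[of "vx * vt"] unfolding p_def poly_U_poly by algebra
  then have "poly p (UF (vx * vt)) = 0"
    by simp
  moreover have "fps_nth (UF (vx * vt)) 0 = 1"
    by (simp add: UF_def const_simps ZF)
  ultimately show ?thesis
    using * by blast
qed

section \<open>The points of the kernel curve over a series\<close>

lemmas fls_hom = fls_times_fps_to_fls fps_to_fls_power fps_to_fls_plus fps_to_fls_minus fps_to_fls_uminus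
  fps_to_fls_numeral fps_one_to_fls fps_zero_to_fls

lemma fls_unit: "fps_nth f 0 \<noteq> 0 \<Longrightarrow> fps_to_fls f \<noteq> 0"
  by (metis fps_to_fls_eq_0_iff fps_zero_nth)

definition tt :: "qxy fls" where "tt = fps_to_fls fps_X"
definition zz :: "qxy fls" where "zz = fps_to_fls ZF"
definition mm :: "qxy fps \<Rightarrow> qxy fls" where "mm X = fps_to_fls (UF X) / zz"

lemma tt_nonzero: "tt \<noteq> 0"
  by (simp add: tt_def)

lemma zz_nonzero: "zz \<noteq> 0"
  unfolding zz_def by (rule fls_unit) (simp add: ZF)

lemma zz_mm: "zz * mm X = fps_to_fls (UF X)"
  using zz_nonzero by (simp add: mm_def)

lemma zz_curve: "(zz\<^sup>2 - 1) * (zz\<^sup>2 + 3)^3 = 256 * tt\<^sup>2 * zz^6"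
  using arg_cong[OF ZF(2), of fps_to_fls] by (simp only: zz_def tt_def fls_hom)

lemma zz_zeta: "zz = 1 + tt\<^sup>2 * fps_to_fls zetaF"
  using arg_cong[OF ZF(1), of fps_to_fls] by (simp only: zz_def tt_def fls_hom)

lemma zeta_nonzero: "fps_to_fls zetaF \<noteq> 0"
  by (rule fls_unit) (simp add: ZF)

lemma good_zz: "good_param zz"
proof -
  have "zz \<noteq> 1"
    using zz_zeta tt_nonzero zeta_nonzero by auto
  moreover have "fps_to_fls (ZF + 1) \<noteq> 0" "fps_to_fls (ZF\<^sup>2 + 3) \<noteq> 0" "fps_to_fls (ZF\<^sup>2 + 1) \<noteq> 0"
    by (rule fls_unit, simp add: ZF const_simps)+
  then have "zz + 1 \<noteq> 0" "zz\<^sup>2 + 3 \<noteq> 0" "zz\<^sup>2 + 1 \<noteq> 0"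
    by (simp_all add: zz_def fls_hom)
  ultimately show ?thesis
    using zz_nonzero by (simp add: good_param_def)
qed

definition H1 :: "qxy fps \<Rightarrow> qxy fps" where "H1 X = ZF * zetaF\<^sup>2 + fps_X * (1 + ZF\<^sup>2) * rF X"
definition H2 :: "qxy fps \<Rightarrow> qxy fps" where "H2 X = 2 * ZF * zetaF + (ZF + 1) * fps_X^3 * rF X"
definition H3 :: "qxy fps \<Rightarrow> qxy fps" where "H3 X = (ZF - 1) * UF X - ZF * (ZF + 3)"

text \<open>
  The orders at \<open>t = 0\<close> of the factors of all denominators; the cofactors are units (\<open>H_units\<close>).
\<close>

lemma h_mm:
  "zz * h1 zz (mm X) = tt^4 * fps_to_fls (H1 X)" "zz * h2 zz (mm X) = tt\<^sup>2 * fps_to_fls (H2 X)"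
  "zz * h3 zz (mm X) = fps_to_fls (H3 X)" "zz * (mm X + 1) = fps_to_fls (2 * ZF + fps_X^5 * rF X)"
  "zz * (mm X - 1) = tt^5 * fps_to_fls (rF X)"
proof -
  have *: "zz * mm X = zz + tt^5 * fps_to_fls (rF X)"
    unfolding zz_mm UF_def by (simp only: fls_hom zz_def tt_def)
  show "zz * h1 zz (mm X) = tt^4 * fps_to_fls (H1 X)"
  proof -
    have "zz * h1 zz (mm X) = (zz\<^sup>2 + 1) * (zz * mm X) - 2 * zz\<^sup>2"
      unfolding h1_def by algebra
    also have "\<dots> = zz * (zz - 1)\<^sup>2 + (zz\<^sup>2 + 1) * tt^5 * fps_to_fls (rF X)"
      unfolding * by algebra
    also have "\<dots> = tt^4 * (zz * (fps_to_fls zetaF)\<^sup>2 + tt * (1 + zz\<^sup>2) * fps_to_fls (rF X))"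
      using zz_zeta by algebra
    finally show ?thesis
      by (simp only: H1_def fls_hom zz_def tt_def)
  qed
  show "zz * h2 zz (mm X) = tt\<^sup>2 * fps_to_fls (H2 X)"
  proof -
    have "zz * h2 zz (mm X) = (zz + 1) * (zz * mm X) + zz\<^sup>2 - 3 * zz"
      unfolding h2_def by algebra
    also have "\<dots> = tt\<^sup>2 * (2 * zz * fps_to_fls zetaF + (zz + 1) * tt^3 * fps_to_fls (rF X))"
      unfolding * using zz_zeta by algebra
    finally show ?thesis
      by (simp only: H2_def fls_hom zz_def tt_def)
  qed
  show "zz * h3 zz (mm X) = fps_to_fls (H3 X)"
  proof -
    have "zz * h3 zz (mm X) = (zz - 1) * (zz * mm X) - zz * (zz + 3)"
      unfolding h3_def by algebra
    then show ?thesis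
      unfolding zz_mm by (simp only: H3_def fls_hom zz_def tt_def)
  qed
  show "zz * (mm X + 1) = fps_to_fls (2 * ZF + fps_X^5 * rF X)" "zz * (mm X - 1) = tt^5 * fps_to_fls (rF X)"
    using * by (simp_all only: fls_hom flip: zz_def tt_def) algebra+
qed

lemma H_units: "fps_nth (H1 X) 0 = 4" "fps_nth (H2 X) 0 = 4" "fps_nth (H3 X) 0 = -4"
  "fps_nth (2 * ZF + fps_X^5 * rF X) 0 = 2"
  by (simp_all add: H1_def H2_def H3_def const_simps ZF)

lemma good_mm: "good_point zz (mm X)"
proof -
  have "fps_to_fls (H1 X) \<noteq> 0" "fps_to_fls (H2 X) \<noteq> 0" "fps_to_fls (H3 X) \<noteq> 0"
    "fps_to_fls (2 * ZF + fps_X^5 * rF X) \<noteq> 0"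
    by (rule fls_unit, simp add: H_units ZF)+
  then have "zz * h1 zz (mm X) \<noteq> 0" "zz * h2 zz (mm X) \<noteq> 0" "zz * h3 zz (mm X) \<noteq> 0" "zz * (mm X + 1) \<noteq> 0"
    unfolding h_mm using tt_nonzero by (simp_all del: fps_to_fls_eq_0_iff)
  then show ?thesis
    by (simp add: good_point_def)
qed

lemma ck_mm_nonzero: "ck zz (mm X) \<noteq> 0"
  using good_mm by (simp add: good_point_def ck_def)

text \<open>The abscissa of the point with parameter \<open>mm X\<close> is \<open>X / t\<close>.\<close>

lemma abscissa: "16 * zz^3 * (1 - (mm X)\<^sup>2) * tt = fps_to_fls X * ck zz (mm X)"
proof -
  have "16 * tt * zz^4 * ((zz * mm X)\<^sup>2 - zz\<^sup>2) =
     - fps_to_fls X * (zz * mm X * (zz\<^sup>2 + 1) - 2 * zz\<^sup>2) * ((zz + 1) * (zz * mm X) + zz\<^sup>2 - 3 * zz)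
       * ((zz - 1) * (zz * mm X) - zz\<^sup>2 - 3 * zz)"
    using arg_cong[OF UF_eq[of X], of fps_to_fls] unfolding zz_mm by (simp only: zz_def tt_def fls_hom)
  moreover have "zz * mm X * (zz\<^sup>2 + 1) - 2 * zz\<^sup>2 = zz * h1 zz (mm X)"
    "(zz + 1) * (zz * mm X) + zz\<^sup>2 - 3 * zz = zz * h2 zz (mm X)"
    "(zz - 1) * (zz * mm X) - zz\<^sup>2 - 3 * zz = zz * h3 zz (mm X)"
    "(zz * mm X)\<^sup>2 - zz\<^sup>2 = zz\<^sup>2 * ((mm X)\<^sup>2 - 1)"
    unfolding h1_def h2_def h3_def by algebra+
  ultimately have e: "16 * tt * zz^4 * (zz\<^sup>2 * ((mm X)\<^sup>2 - 1)) =
     - fps_to_fls X * (zz * h1 zz (mm X)) * (zz * h2 zz (mm X)) * (zz * h3 zz (mm X))"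
    by (simp only:)
  have "zz^3 * (16 * zz^3 * (1 - (mm X)\<^sup>2) * tt) = - (16 * tt * zz^4 * (zz\<^sup>2 * ((mm X)\<^sup>2 - 1)))"
    by algebra
  also have "\<dots> = zz^3 * (fps_to_fls X * ck zz (mm X))"
    unfolding e ck_def by algebra
  finally have "zz^3 * (16 * zz^3 * (1 - (mm X)\<^sup>2) * tt) = zz^3 * (fps_to_fls X * ck zz (mm X))" .
  then show ?thesis
    using zz_nonzero by simp
qed

lemma abscissa_quotient: "16 * zz^3 * (1 - (mm X)\<^sup>2) / ck zz (mm X) = fps_to_fls X / tt"
proof -
  have "a / k = x / t" if "a * t = x * k" "k \<noteq> 0" "t \<noteq> 0" for a k x t :: "qxy fls"
    using that by (simp add: frac_eq_eq)
  then show ?thesis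
    using abscissa ck_mm_nonzero tt_nonzero by blast
qed

lemma mm_square_ne_1:
  assumes "X \<noteq> 0"
  shows "(mm X)\<^sup>2 \<noteq> 1"
proof
  assume "(mm X)\<^sup>2 = 1"
  then have "fps_to_fls X * ck zz (mm X) = 0"
    unfolding abscissa[symmetric] by simp
  then show False
    using assms ck_mm_nonzero by simp
qed

lemma mm_inject: "mm X = mm X' \<Longrightarrow> X = X'"
proof -
  assume e: "mm X = mm X'"
  have "fps_to_fls X * ck zz (mm X') = fps_to_fls X' * ck zz (mm X')"
    using abscissa[of X] abscissa[of X'] unfolding e by (rule trans[OF sym])
  then show "X = X'"
    using ck_mm_nonzero by simp
qed

lemma mm_0: "mm 0 = 1"
  using zz_nonzero by (simp add: mm_def UF_0 flip: zz_def)

text \<open>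
  Both factors are expanded in \<open>m - 1\<close> and \<open>n - 1\<close>, which have order at least 5, and in \<open>z - 1\<close>, which has
  order 2. Their leading terms \<open>32 z\<^sup>4 (z - 1)\<^sup>2\<close> and \<open>4 z\<^sup>3 (z - 1)\<^sup>4\<close> have order 4 and 8 and are not
  cancelled.
\<close>

lemma conjugate_factors_nonzero:
  "bi (- zz) (- mm X) (- mm Y) \<noteq> 0" "bj zz (mm X) (mm Y) \<noteq> 0"
proof -
  define a b e where "a = fps_to_fls (rF X)" "b = fps_to_fls (rF Y)" "e = fps_to_fls zetaF"
  have u: "zz * mm X = zz + tt^5 * a" "zz * mm Y = zz + tt^5 * b"
    using h_mm(5)[of X] h_mm(5)[of Y] unfolding a_b_e_def by algebra+
  have ze: "zz = 1 + tt\<^sup>2 * e"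
    unfolding a_b_e_def by (rule zz_zeta)
  have "zz^4 * bi (- zz) (- mm X) (- mm Y) = 32 * zz^4 * (zz - 1)\<^sup>2 - 8 * zz^3 * (zz - 1)^3 * (tt^5 * a + tt^5 * b)
     + zz\<^sup>2 * (4 * zz^4 - 16 * zz^3 + 8 * zz\<^sup>2 - 16 * zz - 12) * (tt^5 * a * (tt^5 * b))
     + 2 * zz * (zz - 1) * (zz + 1) * (zz\<^sup>2 + 1) * (tt^5 * a * (tt^5 * b)\<^sup>2 + (tt^5 * a)\<^sup>2 * (tt^5 * b))
     + (zz + 1)\<^sup>2 * (zz\<^sup>2 + 1) * (tt^5 * a * (tt^5 * b))\<^sup>2"
    using u(1,2) unfolding curve_defs by algebra
  also have "\<dots> = tt^4 * (32 * zz^4 * e\<^sup>2 + tt * (- 8 * zz^3 * e^3 * tt^6 * (a + b)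
     + zz\<^sup>2 * (4 * zz^4 - 16 * zz^3 + 8 * zz\<^sup>2 - 16 * zz - 12) * tt^5 * a * b
     + 2 * zz * e * (zz + 1) * (zz\<^sup>2 + 1) * tt^12 * a * b * (a + b)
     + (zz + 1)\<^sup>2 * (zz\<^sup>2 + 1) * tt^15 * (a * b)\<^sup>2))"
  proof -
    have "zz - 1 = tt\<^sup>2 * e" using ze by algebra
    then show ?thesis by algebra
  qed
  also have "\<dots> = tt^4 * fps_to_fls (32 * ZF^4 * zetaF\<^sup>2 + fps_X * (- 8 * ZF^3 * zetaF^3 * fps_X^6 * (rF X + rF Y)
     + ZF\<^sup>2 * (4 * ZF^4 - 16 * ZF^3 + 8 * ZF\<^sup>2 - 16 * ZF - 12) * fps_X^5 * rF X * rF Y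
     + 2 * ZF * zetaF * (ZF + 1) * (ZF\<^sup>2 + 1) * fps_X^12 * rF X * rF Y * (rF X + rF Y)
     + (ZF + 1)\<^sup>2 * (ZF\<^sup>2 + 1) * fps_X^15 * (rF X * rF Y)\<^sup>2))" (is "_ = _ * fps_to_fls ?f")
    by (simp only: a_b_e_def zz_def tt_def fls_hom)
  finally have 1: "zz^4 * bi (- zz) (- mm X) (- mm Y) = tt^4 * fps_to_fls ?f" .
  have "fps_to_fls ?f \<noteq> 0"
    by (rule fls_unit) (simp add: const_simps ZF)
  then show "bi (- zz) (- mm X) (- mm Y) \<noteq> 0"
    using 1 tt_nonzero by auto
  have "zz^3 * bj zz (mm X) (mm Y) = 4 * zz^3 * (zz - 1)^4 + 4 * zz^3 * (zz - 1)^3 * (tt^5 * a + tt^5 * b)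
     + zz * (zz - 1)^3 * (zz + 1) * ((tt^5 * a)\<^sup>2 + (tt^5 * b)\<^sup>2)
     + zz * (zz\<^sup>2 + 1) * (4 * zz\<^sup>2 - 8 * zz - 4) * (tt^5 * a * (tt^5 * b))
     + (zz - 1) * (zz + 1) * (zz\<^sup>2 + 1) * (tt^5 * a * (tt^5 * b)\<^sup>2 + (tt^5 * a)\<^sup>2 * (tt^5 * b))"
    using u(1,2) unfolding bj_def by algebra
  also have "\<dots> = tt^8 * (4 * zz^3 * e^4 + tt * (4 * zz^3 * e^3 * tt\<^sup>2 * (a + b)
     + zz * e^3 * (zz + 1) * tt^7 * (a\<^sup>2 + b\<^sup>2)
     + zz * (zz\<^sup>2 + 1) * (4 * zz\<^sup>2 - 8 * zz - 4) * tt * a * b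
     + e * (zz + 1) * (zz\<^sup>2 + 1) * tt^8 * a * b * (a + b)))"
  proof -
    have "zz - 1 = tt\<^sup>2 * e" using ze by algebra
    then show ?thesis by algebra
  qed
  also have "\<dots> = tt^8 * fps_to_fls (4 * ZF^3 * zetaF^4 + fps_X * (4 * ZF^3 * zetaF^3 * fps_X\<^sup>2 * (rF X + rF Y)
     + ZF * zetaF^3 * (ZF + 1) * fps_X^7 * ((rF X)\<^sup>2 + (rF Y)\<^sup>2)
     + ZF * (ZF\<^sup>2 + 1) * (4 * ZF\<^sup>2 - 8 * ZF - 4) * fps_X * rF X * rF Y
     + zetaF * (ZF + 1) * (ZF\<^sup>2 + 1) * fps_X^8 * rF X * rF Y * (rF X + rF Y)))" (is "_ = _ * fps_to_fls ?g")
    by (simp only: a_b_e_def zz_def tt_def fls_hom)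
  finally have 2: "zz^3 * bj zz (mm X) (mm Y) = tt^8 * fps_to_fls ?g" .
  have "fps_to_fls ?g \<noteq> 0"
    by (rule fls_unit) (simp add: const_simps ZF)
  then show "bj zz (mm X) (mm Y) \<noteq> 0"
    using 2 tt_nonzero by auto
qed

text \<open>
  The zeros of the kernel, multiplied by \<open>X Y\<close>.
\<close>

definition kernel_pair :: "qxy fps \<Rightarrow> qxy fps \<Rightarrow> bool" where
  "kernel_pair X Y \<longleftrightarrow> X \<noteq> 0 \<and> Y \<noteq> 0 \<and> X * Y = vt * (X * (X * Y) + Y + X * (Y * Y) + X)"

lemma kernel_pair_sym: "kernel_pair X Y \<Longrightarrow> kernel_pair Y X"
  unfolding kernel_pair_def by (simp add: algebra_simps)

text \<open>
  Of the three factors of the kernel, the other two do not vanish.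
\<close>

lemma kernel_pair_bi:
  assumes "kernel_pair X Y"
  shows "bi zz (mm X) (mm Y) = 0"
proof -
  define x y m n where "x = fps_to_fls X" "y = fps_to_fls Y" "m = mm X" "n = mm Y"
  have xy: "x \<noteq> 0" "y \<noteq> 0" and eq: "X * Y = vt * (X * (X * Y) + Y + X * (Y * Y) + X)"
    using assms by (auto simp: kernel_pair_def x_y_m_n_def)
  have "x * y = tt * (x * (x * y) + y + x * (y * y) + x)"
    using arg_cong[OF eq, of fps_to_fls] unfolding x_y_m_n_def tt_def by (simp only: fls_hom)
  then have k: "x * y = tt * (x\<^sup>2 * y + y + x * y\<^sup>2 + x)"
    by algebra
  define q r a b w where "q = 1 - m\<^sup>2" "r = 1 - n\<^sup>2" "a = x * ck zz m" "b = y * ck zz n" "w = 16 * zz^3 * tt"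
  have ab: "a = w * q" "b = w * r"
    using abscissa[of X] abscissa[of Y] unfolding q_r_a_b_w_def x_y_m_n_def by (simp_all add: mult_ac)
  have "x\<^sup>2 * y\<^sup>2 * (bi zz m n * bi (-zz) (-m) (-n) * bj zz m n) =
      16 * zz^3 * q * r * x * y * a * b
      - (zz\<^sup>2 - 1) * (zz\<^sup>2 + 3)^3 * (q\<^sup>2 * r * x\<^sup>2 * y * b + r\<^sup>2 * q * y\<^sup>2 * x * a)
      - a\<^sup>2 * r * y * b - b\<^sup>2 * q * x * a"
    unfolding kernel_factors[symmetric] q_r_a_b_w_def by algebra
  also have "\<dots> = 16^3 * zz^9 * tt\<^sup>2 * q\<^sup>2 * r\<^sup>2 * (x * y - tt * (x\<^sup>2 * y + y + x * y\<^sup>2 + x))"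
    unfolding ab zz_curve q_r_a_b_w_def(5) by algebra
  also have "\<dots> = 0"
    using k by simp
  finally show ?thesis
    using xy conjugate_factors_nonzero[of X Y] unfolding x_y_m_n_def by simp
qed

section \<open>Identification of the series\<close>

definition ev1 :: "rat poly fps \<Rightarrow> qxy fps \<Rightarrow> qxy fps" where
  "ev1 f X = Abs_fps (\<lambda>n. \<Sum>m\<le>n. fps_nth (poly (map_poly emb_rat (fps_nth f m)) X) (n - m))"

definition y0_part :: "rat poly poly fps \<Rightarrow> rat poly fps" where
  "y0_part S = Abs_fps (\<lambda>n. coeff (fps_nth S n) 0)"
definition x0_part :: "rat poly poly fps \<Rightarrow> rat poly fps" where
  "x0_part S = Abs_fps (\<lambda>n. map_poly (\<lambda>q. coeff q 0) (fps_nth S n))"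

lemma subst_xy_y0: "subst_xy S X 0 = ev1 (y0_part S) X"
proof -
  have "poly2 p X 0 = poly (map_poly emb_rat (coeff p 0)) X" for p
    by (simp add: poly2_def poly_0_coeff_0 coeff_map_poly)
  then show ?thesis
    by (simp add: subst_xy_def ev1_def y0_part_def)
qed

lemma subst_xy_x0: "subst_xy S 0 X = ev1 (x0_part S) X"
proof -
  have "poly2 p 0 X = poly (map_poly emb_rat (map_poly (\<lambda>q. coeff q 0) p)) X" for p
    unfolding poly2_def
    by (subst map_poly_map_poly) (simp_all add: o_def poly_0_coeff_0 coeff_map_poly)
  then show ?thesis
    by (simp add: subst_xy_def ev1_def x0_part_def)
qed

lemma ev1_diff: "ev1 (f - g) X = ev1 f X - ev1 g X"
  using ring_map_simps(6)[OF ring_map_poly_eval[OF ring_map_emb_rat]]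
  by (simp add: ev1_def fps_eq_iff sum_subtractf)

definition emb1 :: "rat \<Rightarrow> qxy" where "emb1 c = emb_poly [:[:c:]:]"
definition evc :: "rat poly \<Rightarrow> qxy \<Rightarrow> qxy" where "evc p a = poly (map_poly emb1 p) a"

lemma ring_map_emb1: "ring_map emb1"
  unfolding emb1_def
  by (intro ring_map_compose[OF ring_map_emb_poly] ring_map_compose[OF ring_map_const_poly] ring_map_const_poly)

lemma ring_map_evc: "ring_map (\<lambda>p. evc p a)"
  unfolding evc_def by (rule ring_map_poly_eval[OF ring_map_emb1])

lemma emb_rat_poly_nth0: "fps_nth (poly (map_poly emb_rat p) X) 0 = evc p (fps_nth X 0)"
  by (induction p) (simp_all add: evc_def map_poly_pCons ring_map_simps[OF ring_map_emb_rat]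
      ring_map_simps[OF ring_map_emb1], simp add: emb_rat_def emb1_def)

lemma ev1_leading:
  assumes "\<And>m. m < n \<Longrightarrow> fps_nth f m = 0"
  shows "fps_nth (ev1 f X) n = evc (fps_nth f n) (fps_nth X 0)"
proof -
  have "(\<Sum>m\<le>n. fps_nth (poly (map_poly emb_rat (fps_nth f m)) X) (n - m)) =
      (\<Sum>m\<in>{n}. fps_nth (poly (map_poly emb_rat (fps_nth f m)) X) (n - m))"
    by (rule sum.mono_neutral_right) (use assms in \<open>auto simp: less_le\<close>)
  then show ?thesis
    by (simp add: ev1_def emb_rat_poly_nth0)
qed

definition xq :: qxy where "xq = emb_poly [:[:0, 1:]:]"

lemma emb_poly_eq_0_iff: "emb_poly p = 0 \<longleftrightarrow> p = 0"
  by (simp add: emb_poly_def Zero_fract_def eq_fract)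

lemma evc_xq: "evc p xq = emb_poly [:p:]"
proof (induction p)
  case 0
  then show ?case by (simp add: evc_def)
next
  case (pCons c p)
  have "evc (pCons c p) xq = emb1 c + xq * evc p xq"
    by (simp add: evc_def map_poly_pCons ring_map_simps[OF ring_map_emb1])
  also have "\<dots> = emb_poly ([:[:c:]:] + [:[:0, 1:]:] * [:p:])"
    unfolding pCons.IH by (simp only: emb_poly_add emb_poly_mult emb1_def xq_def)
  also have "[:[:c:]:] + [:[:0, 1:]:] * [:p:] = [:pCons c p:]"
    by simp
  finally show ?case .
qed

text \<open>
  Multiplied by \<open>x\<^sup>d\<close>, \<open>d\<close> being the degree, the hypothesis is a polynomial identity whose coefficient of
  \<open>x\<^sup>2\<^sup>d\<close> is the leading coefficient of \<open>p\<close>, also for \<open>d = 0\<close>.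
\<close>

lemma evc_symmetric_sum:
  assumes "evc p xq + evc p (inverse xq) = evc p 0"
  shows "p = 0"
proof (rule ccontr)
  assume p: "p \<noteq> 0"
  have x0: "xq \<noteq> 0"
    using emb_var_nonzero by (simp add: xq_def)
  define d where "d = degree p"
  note h = ring_map_simps[OF ring_map_evc]
  have mono: "evc (monom c k) a = emb1 c * a ^ k" for c k a
    by (simp add: evc_def map_poly_monom ring_map_simps[OF ring_map_emb1] poly_monom)
  have refl: "evc (reflect_poly p) xq = xq ^ d * evc p (inverse xq)"
  proof -
    have inj: "map_poly emb1 (reflect_poly p) = reflect_poly (map_poly emb1 p)"
    proof (rule poly_eqI)
      fix n
      have e: "emb1 c = 0 \<longleftrightarrow> c = 0" for c
        by (simp add: emb1_def emb_poly_eq_0_iff)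
      have "degree (map_poly emb1 p) = degree p"
        by (rule degree_map_poly) (simp add: e)
      then show "coeff (map_poly emb1 (reflect_poly p)) n = coeff (reflect_poly (map_poly emb1 p)) n"
        by (simp add: coeff_map_poly coeff_reflect_poly e)
    qed
    have "degree (map_poly emb1 p) = d"
      unfolding d_def by (rule degree_map_poly) (simp add: emb1_def emb_poly_eq_0_iff)
    then show ?thesis
      using x0 by (simp add: evc_def inj poly_reflect_poly_nz)
  qed
  have "evc (monom 1 d * p + reflect_poly p - monom (coeff p 0) d) xq =
      xq ^ d * (evc p xq + evc p (inverse xq) - evc p 0)"
    unfolding h mono refl
    by (simp add: algebra_simps evc_def[of p 0] poly_0_coeff_0 coeff_map_poly ring_map_simps[OF ring_map_emb1])
  also have "\<dots> = 0"
    using assms by simp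
  finally have "monom 1 d * p + reflect_poly p - monom (coeff p 0) d = 0"
    unfolding evc_xq emb_poly_eq_0_iff by simp
  then have "coeff (monom 1 d * p + reflect_poly p - monom (coeff p 0) d) (d + d) = 0"
    by simp
  moreover have "coeff (monom 1 d * p) (d + d) = lead_coeff p"
    using coeff_monom_mult[of 1 d p "d + d"] by (simp add: d_def)
  moreover have "coeff (reflect_poly p) (d + d) = (if d = 0 then coeff p 0 else 0)"
    by (simp add: coeff_reflect_poly d_def)
  ultimately have "lead_coeff p = 0"
    by (cases "d = 0") (auto simp: d_def)
  then show False
    using p by simp
qed

text \<open>
  At the lowest order at which \<open>a\<close> or \<open>c\<close> does not vanish, the terms at \<open>Y\<close> only contribute their constant
  coefficient since \<open>Y\<close> has no constant term. Both equations then have the form of \<open>evc_symmetric_sum\<close>.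
\<close>

lemma kernel_system_unique:
  assumes Y: "fps_nth Y 0 = 0"
    and 1: "ev1 a vx + ev1 a (inverse vx) = ev1 c Y + ev1 a 0 - ev1 c 0"
    and 2: "ev1 c vx + ev1 c (inverse vx) = ev1 a Y - ev1 a 0 + ev1 c 0"
  shows "a = 0 \<and> c = 0"
proof -
  have x: "fps_nth vx 0 = xq" "fps_nth (inverse vx) 0 = inverse xq"
    by (simp_all add: vx_def xq_def fps_const_inverse)
  have "fps_nth a n = 0 \<and> fps_nth c n = 0" for n
  proof (induction n rule: less_induct)
    case (less n)
    then have a: "fps_nth (ev1 a X) n = evc (fps_nth a n) (fps_nth X 0)"
      and c: "fps_nth (ev1 c X) n = evc (fps_nth c n) (fps_nth X 0)" for X
      by (simp_all add: ev1_leading)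
    show ?case
      using arg_cong[OF 1, of "\<lambda>f. fps_nth f n"] arg_cong[OF 2, of "\<lambda>f. fps_nth f n"]
      by (intro conjI evc_symmetric_sum) (simp_all add: a c x Y)
  qed
  then show ?thesis
    by (simp add: fps_eq_iff)
qed

lemma fps_unit_inverse:
  fixes D :: "rat poly poly fps"
  assumes "fps_nth D 0 = [:[:c:]:]" "c \<noteq> 0"
  obtains I where "D * I = 1"
proof -
  have c: "[:[:c:]:] * [:[:1 / c:]:] = 1"
    using assms(2) by (simp add: one_pCons)
  have "\<exists>!I. fps_nth I 0 = [:[:1/c:]:] \<and> poly [:-1, D:] I = 0"
  proof (rule hensel)
    show "fps_nth (poly [:-1, D:] (fps_const [:[:1/c:]:])) 0 = 0"
      using c assms(1) by (simp add: mult.commute)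
    show "fps_nth (poly (pderiv [:-1, D:]) (fps_const [:[:1/c:]:])) 0 * [:[:1/c:]:] = 1"
      using c assms(1) by (simp add: pderiv_pCons)
  qed
  then obtain I where "poly [:-1, D:] I = 0" by blast
  then have "D * I = 1"
    by (simp add: mult.commute)
  then show thesis by (rule that)
qed

text \<open>
  The uniqueness statement is about series with coefficients in \<open>\<rat>[x]\<close>. After cancellation of the power
  \<open>t\<^sup>4\<close> the denominator of \<open>F1\<close> is a series over \<open>\<rat>[x]\<close> with a nonzero rational constant term, which is
  invertible there.
\<close>

lemma candidate_1: "\<exists>S. \<forall>X. fps_to_fls (subst_xy S X 0) = F1 zz (zz * mm X)"
proof -
  define D where "D = (2 * ZP * zetaP + (ZP + 1) * fps_X^3 * rP) * (2 * ZP + fps_X^5 * rP) * zetaP * (ZP\<^sup>2 + 3)^3"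
  define N where "N = 256 * ZP^4 * (ZP * zetaP\<^sup>2 + fps_X * (1 + ZP\<^sup>2) * rP)"
  have "fps_nth D 0 = [:[:1024:]:]"
    by (simp add: D_def const_simps ZP) (simp add: numeral_poly)
  then obtain I where I: "D * I = 1"
    by (rule fps_unit_inverse) simp
  have "fps_to_fls (subst_xy (N * I) X 0) = F1 zz (zz * mm X)" for X
  proof -
    define d n where "d = fps_to_fls (H2 X) * fps_to_fls (2 * ZF + fps_X^5 * rF X) * fps_to_fls zetaF * (zz\<^sup>2 + 3)^3"
      "n = 256 * zz^4 * fps_to_fls (H1 X)"
    have "subst_xy D X 0 * subst_xy I X 0 = 1"
      using arg_cong[OF I, of "\<lambda>S. subst_xy S X 0"] by (simp only: subst_xy_simps)
    moreover have "fps_to_fls (subst_xy D X 0) = d"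
      unfolding D_def subst_xy_simps subst_xy_ZP d_n_def H2_def rF_def[symmetric] zz_def by (simp only: fls_hom)
    ultimately have di: "d * fps_to_fls (subst_xy I X 0) = 1"
      by (metis fls_times_fps_to_fls fps_one_to_fls)
    have "fps_to_fls (subst_xy N X 0) = n"
      unfolding N_def subst_xy_simps subst_xy_ZP d_n_def H1_def rF_def[symmetric] zz_def by (simp only: fls_hom)
    then have 1: "fps_to_fls (subst_xy (N * I) X 0) = n * fps_to_fls (subst_xy I X 0)"
      by (simp only: subst_xy_simps fls_hom)
    have z1: "zz - 1 = tt\<^sup>2 * fps_to_fls zetaF"
      using zz_zeta by algebra
    have "h2 zz (mm X) * (mm X + 1) * (zz - 1) * (zz\<^sup>2 + 3)^3 * zz\<^sup>2
        = (zz * h2 zz (mm X)) * (zz * (mm X + 1)) * (zz - 1) * (zz\<^sup>2 + 3)^3"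
      by algebra
    also have "\<dots> = tt^4 * d"
      unfolding d_n_def h_mm z1 by algebra
    finally have d: "h2 zz (mm X) * (mm X + 1) * (zz - 1) * (zz\<^sup>2 + 3)^3 * zz\<^sup>2 = tt^4 * d" .
    have "256 * zz^3 * h1 zz (mm X) * zz\<^sup>2 = 256 * zz^4 * (zz * h1 zz (mm X))"
      by algebra
    also have "\<dots> = tt^4 * n"
      unfolding d_n_def h_mm by algebra
    finally have n: "256 * zz^3 * h1 zz (mm X) * zz\<^sup>2 = tt^4 * n" .
    have "F1 zz (zz * mm X) = (256 * zz^3 * h1 zz (mm X) * zz\<^sup>2) / (h2 zz (mm X) * (mm X + 1) * (zz - 1) * (zz\<^sup>2 + 3)^3 * zz\<^sup>2)"
      unfolding F1_scaled[OF zz_nonzero] using zz_nonzero by simp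
    also have "\<dots> = n / d"
      unfolding d n using tt_nonzero by simp
    also have "\<dots> = n * fps_to_fls (subst_xy I X 0)"
    proof -
      have "d \<noteq> 0"
        using di by auto
      then have "fps_to_fls (subst_xy I X 0) = 1 / d"
        using di by (simp add: nonzero_eq_divide_eq mult.commute)
      then show ?thesis by simp
    qed
    finally show ?thesis
      using 1 by simp
  qed
  then show ?thesis by blast
qed

text \<open>
  As for \<open>F1\<close>, with the common power \<open>t\<^sup>2\<close>.
\<close>

lemma candidate_4: "\<exists>S. \<forall>X. fps_to_fls (subst_xy S X 0) = F4 zz (zz * mm X)"
proof -
  define UP where "UP = ZP + fps_X^5 * rP"
  define D where "D = (2 * ZP + fps_X^5 * rP) * - (zetaP * (ZP + 1)) * (ZP\<^sup>2 + 3)^3 * ((ZP - 1) * UP - ZP * (ZP + 3))"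
  define N where "N = 16 * ZP\<^sup>2 * fps_X\<^sup>2 * (ZP * zetaP\<^sup>2 + fps_X * (1 + ZP\<^sup>2) * rP) * poly_N2 ZP UP"
  have "fps_nth D 0 = [:[:2048:]:]"
    by (simp add: D_def const_simps ZP) (simp add: numeral_poly)
  then obtain I where I: "D * I = 1"
    by (rule fps_unit_inverse) simp
  have "fps_to_fls (subst_xy (N * I) X 0) = F4 zz (zz * mm X)" for X
  proof -
    define d n where "d = fps_to_fls (2 * ZF + fps_X^5 * rF X) * - (fps_to_fls zetaF * (zz + 1)) * (zz\<^sup>2 + 3)^3 * fps_to_fls (H3 X)"
      "n = 16 * zz\<^sup>2 * tt\<^sup>2 * fps_to_fls (H1 X) * poly_N2 zz (zz * mm X)"
    have u: "subst_xy UP X 0 = UF X"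
      by (simp add: UP_def UF_def subst_xy_simps subst_xy_ZP rF_def)
    have "subst_xy D X 0 * subst_xy I X 0 = 1"
      using arg_cong[OF I, of "\<lambda>S. subst_xy S X 0"] by (simp only: subst_xy_simps)
    moreover have "fps_to_fls (subst_xy D X 0) = d"
      unfolding D_def subst_xy_simps subst_xy_ZP u d_n_def H3_def rF_def[symmetric] zz_def by (simp only: fls_hom)
    ultimately have di: "d * fps_to_fls (subst_xy I X 0) = 1"
      by (metis fls_times_fps_to_fls fps_one_to_fls)
    have "fps_to_fls (subst_xy N X 0) = n"
      unfolding N_def poly_N2_def subst_xy_simps subst_xy_ZP u d_n_def H1_def rF_def[symmetric] zz_mm
      unfolding zz_def tt_def by (simp only: fls_hom)
    then have 1: "fps_to_fls (subst_xy (N * I) X 0) = n * fps_to_fls (subst_xy I X 0)"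
      by (simp only: subst_xy_simps fls_hom)
    have z1: "1 - zz\<^sup>2 = tt\<^sup>2 * - (fps_to_fls zetaF * (zz + 1))"
      using zz_zeta by algebra
    have "(mm X + 1) * (1 - zz\<^sup>2) * (zz\<^sup>2 + 3)^3 * h3 zz (mm X) * zz\<^sup>2
        = (zz * (mm X + 1)) * (1 - zz\<^sup>2) * (zz\<^sup>2 + 3)^3 * (zz * h3 zz (mm X))"
      by algebra
    also have "\<dots> = tt\<^sup>2 * d"
      unfolding d_n_def h_mm z1 by algebra
    finally have d: "(mm X + 1) * (1 - zz\<^sup>2) * (zz\<^sup>2 + 3)^3 * h3 zz (mm X) * zz\<^sup>2 = tt\<^sup>2 * d" .
    have N2: "poly_N2 zz (zz * mm X) = zz\<^sup>2 * N2r zz (mm X)"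
      unfolding poly_N2_def N2r_def by algebra
    have "16 * zz^3 * h1 zz (mm X) * N2r zz (mm X) * zz\<^sup>2 = 16 * zz\<^sup>2 * (zz * h1 zz (mm X)) * (zz\<^sup>2 * N2r zz (mm X))"
      by algebra
    also have "\<dots> = tt\<^sup>2 * n"
      unfolding d_n_def N2 h_mm by algebra
    finally have n: "16 * zz^3 * h1 zz (mm X) * N2r zz (mm X) * zz\<^sup>2 = tt\<^sup>2 * n" .
    have "F4 zz (zz * mm X) = (16 * zz^3 * h1 zz (mm X) * N2r zz (mm X) * zz\<^sup>2) / ((mm X + 1) * (1 - zz\<^sup>2) * (zz\<^sup>2 + 3)^3 * h3 zz (mm X) * zz\<^sup>2)"
      unfolding F4_scaled[OF zz_nonzero] using zz_nonzero by simp
    also have "\<dots> = n / d"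
      unfolding d n using tt_nonzero by simp
    also have "\<dots> = n * fps_to_fls (subst_xy I X 0)"
    proof -
      have "d \<noteq> 0"
        using di by auto
      then have "fps_to_fls (subst_xy I X 0) = 1 / d"
        using di by (simp add: nonzero_eq_divide_eq mult.commute)
      then show ?thesis by simp
    qed
    finally show ?thesis
      using 1 by simp
  qed
  then show ?thesis by blast
qed

subsection \<open>Kernel pairs\<close>

lemma xq_nonzero: "xq \<noteq> 0" and xq_ne_1: "1 - xq \<noteq> 0"
proof -
  show "xq \<noteq> 0"
    using emb_var_nonzero by (simp add: xq_def)
  have "1 - xq = emb_poly (1 - [:[:0, 1:]:])"
    by (simp only: ring_map_simps[OF ring_map_emb_poly] xq_def)
  moreover have "(1 - [:[:0, 1:]:] :: rat poly poly) \<noteq> 0"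
    by (simp add: one_pCons)
  ultimately show "1 - xq \<noteq> 0"
    using emb_poly_eq_0_iff by metis
qed

lemma vx_nth_0: "fps_nth vx 0 = xq"
  by (simp add: vx_def xq_def)

lemma kernel_pair_const:
  assumes "c \<noteq> 0"
  shows "\<exists>Y. fps_nth Y 0 = 0 \<and> kernel_pair (fps_const c) Y"
proof -
  define X where "X = fps_const c"
  have X: "fps_nth X 0 = c" "X \<noteq> 0"
    using assms by (auto simp: X_def)
  define p where "p = [:vt * X, vt * (X\<^sup>2 + 1) - X, vt * X:]"
  have "\<exists>!Y. fps_nth Y 0 = 0 \<and> poly p Y = 0"
  proof (rule hensel)
    show "fps_nth (poly p (fps_const 0)) 0 = 0"
      by (simp add: p_def)
    show "fps_nth (poly (pderiv p) (fps_const 0)) 0 * - inverse c = 1"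
      using assms by (simp add: p_def pderiv_pCons X)
  qed
  then obtain Y where Y: "fps_nth Y 0 = 0" "poly p Y = 0" by blast
  have eq: "X * Y = vt * (X * (X * Y) + Y + X * (Y * Y) + X)"
    using Y(2) unfolding p_def by (simp add: algebra_simps power2_eq_square)
  have "Y \<noteq> 0"
    using eq X by auto
  then show ?thesis
    using Y(1) eq X unfolding kernel_pair_def X_def[symmetric] by auto
qed

lemma kernel_pair_vx: "\<exists>Y. fps_nth Y 0 = 0 \<and> kernel_pair vx Y \<and> kernel_pair (inverse vx) Y"
proof -
  have "vx = fps_const xq"
    by (simp add: vx_def xq_def)
  then obtain Y where Y: "fps_nth Y 0 = 0" "kernel_pair vx Y"
    using kernel_pair_const[OF xq_nonzero] by auto
  have eq: "vx * Y = vt * (vx * (vx * Y) + Y + vx * (Y * Y) + vx)" and "Y \<noteq> 0"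
    using Y(2) by (auto simp: kernel_pair_def)
  moreover have "inverse vx * Y = vt * (inverse vx * (inverse vx * Y) + Y + inverse vx * (Y * Y) + inverse vx)"
    using eq vx_inverse(1) by algebra
  moreover have "inverse vx \<noteq> 0"
    using vx_inverse(1) by (metis mult_zero_right zero_neq_one)
  ultimately show ?thesis
    using Y by (auto simp: kernel_pair_def)
qed

lemma kernel_pair_vx_vt: "\<exists>Y. fps_nth Y 0 = 0 \<and> kernel_pair (vx * vt) Y"
proof -
  define p where "p = [:vt * vx, vt\<^sup>2 * vx\<^sup>2 + 1 - vx, vt * vx:]"
  have "\<exists>!Y. fps_nth Y 0 = 0 \<and> poly p Y = 0"
  proof (rule hensel)
    show "fps_nth (poly p (fps_const 0)) 0 = 0"
      by (simp add: p_def)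
    show "fps_nth (poly (pderiv p) (fps_const 0)) 0 * inverse (1 - xq) = 1"
      using xq_ne_1 by (simp add: p_def pderiv_pCons vx_nth_0 const_simps)
  qed
  then obtain Y where Y: "fps_nth Y 0 = 0" "poly p Y = 0" by blast
  have "vt * vx + (vt\<^sup>2 * vx\<^sup>2 + 1 - vx) * Y + vt * vx * Y\<^sup>2 = 0"
    using Y(2) unfolding p_def by (simp add: algebra_simps power2_eq_square)
  then have eq: "vx * vt * Y = vt * (vx * vt * (vx * vt * Y) + Y + vx * vt * (Y * Y) + vx * vt)"
    by algebra
  have "Y \<noteq> 0"
    using eq vx_nonzero by auto
  then show ?thesis
    using Y(1) eq vx_nonzero by (auto simp: kernel_pair_def)
qed

lemma kernel_L:
  assumes "kernel_pair X Y"
  shows "X * Y - 2 * (vt * (X * L X 0)) + vt * (X * (X * (Y * L 0 Y))) - vt * (Y * L 0 Y)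
     + vt * (X * B 0 Y) + vt * (X * L 0 0) - vt * (X * B 0 0) = 0"
proof -
  have "X * Y - vt * (X * (X * Y) + Y + X * (Y * Y) + X) = 0"
    using assms by (simp add: kernel_pair_def)
  then show ?thesis
    using L_at[of X Y] by (simp only: mult_zero_left)
qed

lemma kernel_B:
  assumes "kernel_pair X Y"
  shows "vt * (X * (Y * (Y * B X 0))) - vt * (X * B X 0) - 2 * (vt * (Y * B 0 Y)) + vt * (Y * L X 0)
     - vt * (Y * L 0 0) + vt * (Y * B 0 0) = 0"
proof -
  have "X * Y - vt * (X * (X * Y) + Y + X * (Y * Y) + X) = 0"
    using assms by (simp add: kernel_pair_def)
  then show ?thesis
    using B_at[of X Y] by (simp only: mult_zero_left)
qed

text \<open>
  In the equations of \<open>L\<close> at \<open>(x,Y)\<close> and \<open>(1/x,Y)\<close>, divided by the product of the arguments, the series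
  \<open>L(0,Y)\<close> has the opposite coefficients \<open>t(x - 1/x)\<close> and \<open>t(1/x - x)\<close>, and it disappears from their sum.
  In the same way \<open>B(Y,0)\<close> is eliminated from the equations of \<open>B\<close> at \<open>(Y,x)\<close> and \<open>(Y,1/x)\<close>.
\<close>

lemma series_system:
  assumes "kernel_pair vx Y" "kernel_pair (inverse vx) Y"
  shows "vt * (L vx 0 + L (inverse vx) 0) = Y + vt * (B 0 Y + L 0 0 - B 0 0)"
    "B 0 vx + B 0 (inverse vx) = L Y 0 - L 0 0 + B 0 0"
proof -
  note x = vx_inverse(1)
  have "2 * (vt * (L vx 0 + L (inverse vx) 0)) = 2 * (Y + vt * (B 0 Y + L 0 0 - B 0 0))"
    using kernel_L[OF assms(1)] kernel_L[OF assms(2)] x by algebra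
  moreover have "(2 :: qxy fps) \<noteq> 0"
    by simp
  ultimately show "vt * (L vx 0 + L (inverse vx) 0) = Y + vt * (B 0 Y + L 0 0 - B 0 0)"
    using mult_left_cancel by blast
  have "(2 * vt) * (B 0 vx + B 0 (inverse vx)) = (2 * vt) * (L Y 0 - L 0 0 + B 0 0)"
    using kernel_B[OF kernel_pair_sym[OF assms(1)]] kernel_B[OF kernel_pair_sym[OF assms(2)]] x by algebra
  moreover have "2 * vt \<noteq> 0"
    by simp
  ultimately show "B 0 vx + B 0 (inverse vx) = L Y 0 - L 0 0 + B 0 0"
    using mult_left_cancel by blast
qed

lemma vx_ne_inverse: "vx \<noteq> inverse vx"
proof
  assume "vx = inverse vx"
  then have "xq = inverse xq"
    using arg_cong[of vx "inverse vx" "\<lambda>f. fps_nth f 0"] by (simp add: vx_def xq_def fps_const_inverse)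
  then have "xq * xq = 1"
    using xq_nonzero by (metis right_inverse)
  then have "emb_poly ([:[:0, 1:]:] * [:[:0, 1:]:] - 1) = 0"
    by (simp only: ring_map_simps[OF ring_map_emb_poly] flip: xq_def)
  then show False
    by (simp add: emb_poly_eq_0_iff one_pCons)
qed

lemma kap_eq:
  fixes z :: "'a::field_char_0"
  assumes "good_param z"
  shows "kap z = F1 z (z * 1) - F4 z (z * 1)"
proof -
  note nz = assms[unfolded good_param_def]
  have z: "z\<^sup>2 \<noteq> 1" "1 \<noteq> z\<^sup>2"
    using nz by (auto simp: power2_eq_1_iff eq_neg_iff_add_eq_0)
  have h: "h1 z 1 = (z - 1)\<^sup>2" "h2 z 1 = 2 * (z - 1)" "h3 z 1 = -4" "N2r z 1 = 16 + 32 * z - 16 * z\<^sup>2"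
    unfolding h1_def h2_def h3_def N2r_def mult_1_right power_one by algebra+
  show ?thesis
    unfolding F1_scaled[OF conjunct1[OF nz]] F4_scaled[OF conjunct1[OF nz]] kap_def h
    apply (simp add: divide_simps nz z)
    apply algebra
    done
qed

lemma kap_zz: "kap zz = F1 zz (zz * mm 0) - F4 zz (zz * mm 0)"
  unfolding mm_0 by (rule kap_eq[OF good_zz])

text \<open>
  The two sides solve the same system, which determines them as series over \<open>\<rat>[x]\<close>; so they agree at \<open>x\<close>
  and therefore at every series \<open>X\<close>.
\<close>

theorem L_B_series:
  "fps_to_fls (L X 0) = F1 zz (fps_to_fls (UF X))" "fps_to_fls (B 0 X) = F4 zz (fps_to_fls (UF X))"
proof -
  obtain S1 where S1: "\<And>X. fps_to_fls (subst_xy S1 X 0) = F1 zz (zz * mm X)"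
    using candidate_1 by blast
  obtain S4 where S4: "\<And>X. fps_to_fls (subst_xy S4 X 0) = F4 zz (zz * mm X)"
    using candidate_4 by blast
  obtain Y where Y: "fps_nth Y 0 = 0" "kernel_pair vx Y" "kernel_pair (inverse vx) Y"
    using kernel_pair_vx by blast
  define A where "A X = subst_xy S1 X 0" for X
  define C where "C X = subst_xy S4 X 0" for X
  note b = kernel_pair_bi[OF Y(2)] kernel_pair_bi[OF Y(3)]
  have ne: "mm vx \<noteq> mm (inverse vx)"
    using mm_inject vx_ne_inverse by blast
  note s = b ne good_zz good_mm[of vx] good_mm[of "inverse vx"] good_mm[of Y]
  have "F1 zz (zz * mm vx) + F1 zz (zz * mm (inverse vx)) = fps_to_fls Y / tt + F4 zz (zz * mm Y) + kap zz"
    unfolding abscissa_quotient[symmetric] by (rule F1_sum[OF s])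
  then have "tt * (fps_to_fls (A vx) + fps_to_fls (A (inverse vx))) =
      fps_to_fls Y + tt * (fps_to_fls (C Y) + fps_to_fls (A 0) - fps_to_fls (C 0))"
    using tt_nonzero by (simp add: A_def C_def S1 S4 kap_zz field_simps)
  then have "fps_to_fls (vt * (A vx + A (inverse vx))) = fps_to_fls (Y + vt * (C Y + A 0 - C 0))"
    by (simp only: fls_hom flip: tt_def)
  then have 1: "vt * (A vx + A (inverse vx)) = Y + vt * (C Y + A 0 - C 0)"
    by (rule fps_to_fls_eq_imp_fps_eq)
  have "F4 zz (zz * mm vx) + F4 zz (zz * mm (inverse vx)) = F1 zz (zz * mm Y) - kap zz"
    by (rule F4_sum[OF s])
  then have "fps_to_fls (C vx) + fps_to_fls (C (inverse vx)) = fps_to_fls (A Y) - fps_to_fls (A 0) + fps_to_fls (C 0)"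
    by (simp add: A_def C_def S1 S4 kap_zz)
  then have "fps_to_fls (C vx + C (inverse vx)) = fps_to_fls (A Y - A 0 + C 0)"
    by (simp only: fls_hom)
  then have 2: "C vx + C (inverse vx) = A Y - A 0 + C 0"
    by (rule fps_to_fls_eq_imp_fps_eq)
  define a where "a = y0_part L_series - y0_part S1"
  define c where "c = x0_part B_series - y0_part S4"
  have a: "ev1 a X = L X 0 - A X" and c: "ev1 c X = B 0 X - C X" for X
    by (simp_all add: a_def c_def ev1_diff A_def C_def subst_xy_y0 subst_xy_x0)
  have "vt * (ev1 a vx + ev1 a (inverse vx)) = vt * (ev1 c Y + ev1 a 0 - ev1 c 0)"
    unfolding a c using 1 series_system(1)[OF Y(2,3)] by algebra
  then have e1: "ev1 a vx + ev1 a (inverse vx) = ev1 c Y + ev1 a 0 - ev1 c 0"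
    by simp
  have e2: "ev1 c vx + ev1 c (inverse vx) = ev1 a Y - ev1 a 0 + ev1 c 0"
    unfolding a c using 2 series_system(2)[OF Y(2,3)] by algebra
  have "a = 0" "c = 0"
    using kernel_system_unique[OF Y(1) e1 e2] by auto
  moreover have "ev1 0 X = 0"
    by (simp add: ev1_def fps_eq_iff)
  ultimately have "L X 0 = A X" "B 0 X = C X"
    using a[of X] c[of X] by simp_all
  then show "fps_to_fls (L X 0) = F1 zz (fps_to_fls (UF X))" "fps_to_fls (B 0 X) = F4 zz (fps_to_fls (UF X))"
    by (simp_all add: A_def C_def S1 S4 zz_mm)
qed

lemma disc_num_mm:
  assumes "kernel_pair X Y" "fps_nth Y 0 = 0"
  shows "disc_num zz (mm Y) / (16 * zz^3 * (1 - (mm Y)\<^sup>2) * ck zz (mm Y)) = tt * (1 - (fps_to_fls Y)\<^sup>2) / fps_to_fls Y"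
    "disc_num zz (mm Y) \<noteq> 0" "1 - (fps_to_fls Y)\<^sup>2 \<noteq> 0"
proof -
  define y w k where "y = fps_to_fls Y" "w = 16 * zz^3 * (1 - (mm Y)\<^sup>2)" "k = ck zz (mm Y)"
  have Y: "Y \<noteq> 0"
    using assms(1) by (simp add: kernel_pair_def)
  have y: "y \<noteq> 0" and w: "w \<noteq> 0" and k: "k \<noteq> 0"
    using Y zz_nonzero mm_square_ne_1[OF Y] ck_mm_nonzero unfolding y_w_k_def by auto
  have "fps_nth (1 - Y\<^sup>2) 0 \<noteq> 0"
    using assms(2) by (simp add: const_simps)
  then have "fps_to_fls (1 - Y\<^sup>2) \<noteq> 0"
    by (rule fls_unit)
  then show y1: "1 - (fps_to_fls Y)\<^sup>2 \<noteq> 0"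
    by (simp only: fls_hom not_False_eq_True)
  have e: "k = w * tt / y"
    using abscissa[of Y] y unfolding y_w_k_def by (simp add: field_simps)
  have "disc_num zz (mm Y) = k\<^sup>2 - 256 * tt\<^sup>2 * zz^6 * (1 - (mm Y)\<^sup>2)\<^sup>2"
    unfolding disc_num_def zz_curve y_w_k_def by simp
  also have "\<dots> = k\<^sup>2 - tt\<^sup>2 * w\<^sup>2"
    unfolding y_w_k_def by algebra
  finally have d: "disc_num zz (mm Y) = k\<^sup>2 - tt\<^sup>2 * w\<^sup>2" .
  have "(k\<^sup>2 - tt\<^sup>2 * w\<^sup>2) / (w * k) = tt * (1 - y\<^sup>2) / y"
    unfolding e using w y tt_nonzero by (simp add: field_simps power2_eq_square)
  then show q: "disc_num zz (mm Y) / (16 * zz^3 * (1 - (mm Y)\<^sup>2) * ck zz (mm Y)) = tt * (1 - (fps_to_fls Y)\<^sup>2) / fps_to_fls Y"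
    unfolding d unfolding y_w_k_def .
  have "tt * (1 - (fps_to_fls Y)\<^sup>2) / fps_to_fls Y \<noteq> 0"
    using y1 tt_nonzero y unfolding y_w_k_def by simp
  then show "disc_num zz (mm Y) \<noteq> 0"
    using q by auto
qed

text \<open>
  The functional equations at the kernel pairs \<open>(Y,X)\<close> and \<open>(X,Y)\<close> determine the remaining two series
  because \<open>1/Y - Y\<close> is not zero.
\<close>

theorem L_B_series_boundary:
  assumes "kernel_pair X Y" "fps_nth Y 0 = 0"
  shows "fps_to_fls X * fps_to_fls (L 0 X) = tt * F2 zz (fps_to_fls (UF X))"
    "fps_to_fls X * fps_to_fls (B X 0) = tt * F3 zz (fps_to_fls (UF X))"
proof -
  define x y where "x = fps_to_fls X" "y = fps_to_fls Y"
  have XY: "X \<noteq> 0" "Y \<noteq> 0"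
    using assms(1) by (auto simp: kernel_pair_def)
  then have y: "y \<noteq> 0"
    by (simp add: x_y_def)
  note d = disc_num_mm[OF assms]
  have ne: "mm X \<noteq> 1" "mm Y \<noteq> 1"
    using mm_square_ne_1[OF XY(1)] mm_square_ne_1[OF XY(2)] by auto
  note id = kernel_pair_bi[OF kernel_pair_sym[OF assms(1)]] good_zz good_mm good_mm d(2) ne
  have k: "kap zz = fps_to_fls (L 0 0) - fps_to_fls (B 0 0)"
    unfolding kap_zz zz_mm L_B_series ..
  have "tt * (1 - y\<^sup>2) / y * F2 zz (zz * mm X) = x / tt - 2 * fps_to_fls (L Y 0) + fps_to_fls (B 0 X) + kap zz"
    using F2_identity[OF id] unfolding d(1) abscissa_quotient x_y_def L_B_series zz_mm .
  then have 1: "tt * (tt * (1 - y\<^sup>2) * F2 zz (zz * mm X)) =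
      y * (x - 2 * tt * fps_to_fls (L Y 0) + tt * fps_to_fls (B 0 X) + tt * kap zz)"
    using y tt_nonzero by (simp add: field_simps)
  have "y * x - 2 * (tt * (y * fps_to_fls (L Y 0))) + tt * (y * (y * (x * fps_to_fls (L 0 X)))) - tt * (x * fps_to_fls (L 0 X))
     + tt * (y * fps_to_fls (B 0 X)) + tt * (y * fps_to_fls (L 0 0)) - tt * (y * fps_to_fls (B 0 0)) = 0"
    using arg_cong[OF kernel_L[OF kernel_pair_sym[OF assms(1)]], of fps_to_fls]
    unfolding x_y_def tt_def by (simp only: fls_hom)
  then have "tt * (1 - y\<^sup>2) * (x * fps_to_fls (L 0 X)) = tt * (1 - y\<^sup>2) * (tt * F2 zz (zz * mm X))"
    using 1 unfolding k by algebra
  then show "fps_to_fls X * fps_to_fls (L 0 X) = tt * F2 zz (fps_to_fls (UF X))"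
    using tt_nonzero d(3) unfolding x_y_def zz_mm by simp
  have "tt * (1 - y\<^sup>2) / y * F3 zz (zz * mm X) = fps_to_fls (L X 0) - 2 * fps_to_fls (B 0 Y) - kap zz"
    using F3_identity[OF id] unfolding d(1) x_y_def L_B_series zz_mm .
  then have 2: "tt * (1 - y\<^sup>2) * F3 zz (zz * mm X) = y * (fps_to_fls (L X 0) - 2 * fps_to_fls (B 0 Y) - kap zz)"
    using y by (simp add: field_simps)
  have "tt * (x * (y * (y * fps_to_fls (B X 0)))) - tt * (x * fps_to_fls (B X 0)) - 2 * (tt * (y * fps_to_fls (B 0 Y)))
     + tt * (y * fps_to_fls (L X 0)) - tt * (y * fps_to_fls (L 0 0)) + tt * (y * fps_to_fls (B 0 0)) = 0"
    using arg_cong[OF kernel_B[OF assms(1)], of fps_to_fls]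
    unfolding x_y_def tt_def by (simp only: fls_hom)
  then have "tt * (1 - y\<^sup>2) * (x * fps_to_fls (B X 0)) = tt * (1 - y\<^sup>2) * (tt * F3 zz (zz * mm X))"
    using 2 unfolding k by algebra
  then show "fps_to_fls X * fps_to_fls (B X 0) = tt * F3 zz (fps_to_fls (UF X))"
    using tt_nonzero d(3) unfolding x_y_def zz_mm by simp
qed

section \<open>The parametrization\<close>

lemma gen_field_zero: "0 \<in> gen_field S"
  using gen_field_diff[OF gen_field_one gen_field_one] by simp

lemma gen_field_uminus: "a \<in> gen_field S \<Longrightarrow> - a \<in> gen_field S"
  using gen_field_diff[OF gen_field_zero, of a S] by simp

lemma gen_field_add: "a \<in> gen_field S \<Longrightarrow> b \<in> gen_field S \<Longrightarrow> a + b \<in> gen_field S"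
  using gen_field_diff[OF _ gen_field_uminus, of a S b] by simp

lemma gen_field_divide: "a \<in> gen_field S \<Longrightarrow> b \<in> gen_field S \<Longrightarrow> a / b \<in> gen_field S"
  unfolding divide_inverse by (intro gen_field_mult gen_field_inverse)

lemma gen_field_power: "a \<in> gen_field S \<Longrightarrow> a ^ n \<in> gen_field S"
  by (induction n) (auto intro: gen_field_one gen_field_mult)

lemma gen_field_of_nat: "of_nat n \<in> gen_field S"
  by (induction n) (auto intro: gen_field_zero gen_field_one gen_field_add)

lemma gen_field_numeral: "numeral n \<in> gen_field S"
  using gen_field_of_nat[of "numeral n"] by simp

lemmas gen_field_intros = gen_field_zero gen_field_one gen_field_uminus gen_field_add gen_field_diff
  gen_field_mult gen_field_inverse gen_field_divide gen_field_power gen_field_numeral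

lemma F_in_gen_field:
  assumes "z \<in> gen_field S" "u \<in> gen_field S"
  shows "F1 z u \<in> gen_field S" "F2 z u \<in> gen_field S" "F3 z u \<in> gen_field S" "F4 z u \<in> gen_field S"
  unfolding F1_def F2_def F3_def F4_def poly_D_def poly_N1_def poly_N2_def
  by (intro gen_field_intros assms)+

lemma parametrization:
  assumes Z: "is_Z (ZQ\<^sup>2) Z'" and U: "is_U (ZQ\<^sup>2) U'"
  defines "Z \<equiv> lift_Q Z'" and "U \<equiv> lift_Qx U'" and "x \<equiv> fps_to_fls vx"
    and "L1 \<equiv> fps_to_fls (L (vx * vt) 0)" and "L2 \<equiv> fps_to_fls (L 0 (vx * vt))"
    and "B1 \<equiv> fps_to_fls (B (vx * vt) 0)" and "B2 \<equiv> fps_to_fls (B 0 (vx * vt))"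
  shows "{x, L1, L2, B1, B2} \<subseteq> gen_field {Z, U}"
    "L1 = F1 Z U" "x * L2 = F2 Z U" "x * B1 = F3 Z U" "B2 = F4 Z U"
proof -
  have Zz: "Z = zz"
    unfolding Z_def is_Z_unique[OF Z] lift_Q_LQ zz_def ZF_def ..
  have Uu: "U = fps_to_fls (UF (vx * vt))"
    unfolding U_def lift_Qx_LQx UF_unique[OF U] ..
  have x: "fps_to_fls (vx * vt) = tt * x"
    unfolding fls_hom tt_def x_def by (rule mult.commute)
  obtain Y where Y: "kernel_pair (vx * vt) Y" "fps_nth Y 0 = 0"
    using kernel_pair_vx_vt by blast
  show 1: "L1 = F1 Z U" and 4: "B2 = F4 Z U"
    unfolding L1_def B2_def Zz Uu by (rule L_B_series)+
  show 2: "x * L2 = F2 Z U" and 3: "x * B1 = F3 Z U"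
    using L_B_series_boundary[OF Y] tt_nonzero unfolding x L2_def[symmetric] B1_def[symmetric] Zz Uu
    by (simp_all add: mult.assoc)
  have g: "Z \<in> gen_field {Z, U}" "U \<in> gen_field {Z, U}"
    by (auto intro: gen_field_base)
  have m: "mm (vx * vt) = U / Z"
    unfolding mm_def Zz Uu ..
  have "x = 16 * zz^3 * (1 - (mm (vx * vt))\<^sup>2) / ck zz (mm (vx * vt))"
    unfolding abscissa_quotient x using tt_nonzero by simp
  also have "\<dots> \<in> gen_field {Z, U}"
    unfolding m unfolding Zz[symmetric] ck_def h1_def h2_def h3_def by (intro gen_field_intros g)
  finally have xg: "x \<in> gen_field {Z, U}" .
  have x0: "x \<noteq> 0"
    using vx_nonzero by (simp add: x_def)
  have "L2 = F2 Z U / x" "B1 = F3 Z U / x"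
    using 2 3 x0 by (simp_all add: nonzero_eq_divide_eq mult.commute)
  then show "{x, L1, L2, B1, B2} \<subseteq> gen_field {Z, U}"
    using 1 4 xg F_in_gen_field[OF g] by (auto intro: gen_field_divide)
qed

lemma parametrization_theorem:
  "(\<exists>!T. is_T T)
   \<and> (\<forall>T. is_T T \<longrightarrow>
        (\<exists>!Z. is_Z T Z) \<and> (\<exists>!U. is_U T U) \<and>
        (\<forall>Z' U'. is_Z T Z' \<and> is_U T U' \<longrightarrow>
          (let Z = lift_Q Z'; U = lift_Qx U'; x = fps_to_fls vx;
               L1 = fps_to_fls (L (vx * vt) 0); L2 = fps_to_fls (L 0 (vx * vt));
               B1 = fps_to_fls (B (vx * vt) 0); B2 = fps_to_fls (B 0 (vx * vt))
           in {x, L1, L2, B1, B2} \<subseteq> gen_field {Z, U}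
            \<and> L1 = 256 * Z ^ 4 * (U * Z ^ 2 - 2 * Z ^ 2 + U)
                / ((U * Z + Z ^ 2 + U - 3 * Z) * (U + Z) * (Z - 1) * (Z ^ 2 + 3) ^ 3)
            \<and> x * L2 = 256 * Z ^ 6 * (U - Z) * (U * Z - Z ^ 2 - U - 3 * Z)
                  * (U ^ 2 * Z ^ 2 - Z ^ 4 - 4 * U * Z ^ 2 + U ^ 2 + 3 * Z ^ 2)
                / (poly_D Z U * (Z - 1) * (Z ^ 2 + 3) ^ 3)
            \<and> x * B1 = - (512 * Z ^ 6 * (U * Z ^ 2 - 2 * Z ^ 2 + U) * (U - Z) * poly_N1 Z U
                / ((Z ^ 2 - 1) * (Z ^ 2 + 3) ^ 3 * poly_D Z U))
            \<and> B2 = 16 * Z ^ 2 * (U * Z ^ 2 - 2 * Z ^ 2 + U) * poly_N2 Z U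
                / ((U + Z) * (1 - Z ^ 2) * (Z ^ 2 + 3) ^ 3 * (U * Z - Z ^ 2 - U - 3 * Z)))))"
proof (intro conjI allI impI)
  show "\<exists>!T. is_T T" by (rule ex1_T)
next
  fix T assume "is_T T"
  then show "\<exists>!Z. is_Z T Z" by (rule ex1_Z)
next
  fix T assume "is_T T"
  then show "\<exists>!U. is_U T U" by (rule ex1_U)
next
  fix T Z' U' assume T: "is_T T" and "is_Z T Z' \<and> is_U T U'"
  then have "is_Z (ZQ\<^sup>2) Z'" "is_U (ZQ\<^sup>2) U'"
    using is_T_unique[OF T] by auto
  note p = parametrization[OF this, unfolded F1_def F2_def F3_def F4_def]
  show "let Z = lift_Q Z'; U = lift_Qx U'; x = fps_to_fls vx;
               L1 = fps_to_fls (L (vx * vt) 0); L2 = fps_to_fls (L 0 (vx * vt));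
               B1 = fps_to_fls (B (vx * vt) 0); B2 = fps_to_fls (B 0 (vx * vt))
           in {x, L1, L2, B1, B2} \<subseteq> gen_field {Z, U}
            \<and> L1 = 256 * Z ^ 4 * (U * Z ^ 2 - 2 * Z ^ 2 + U)
                / ((U * Z + Z ^ 2 + U - 3 * Z) * (U + Z) * (Z - 1) * (Z ^ 2 + 3) ^ 3)
            \<and> x * L2 = 256 * Z ^ 6 * (U - Z) * (U * Z - Z ^ 2 - U - 3 * Z)
                  * (U ^ 2 * Z ^ 2 - Z ^ 4 - 4 * U * Z ^ 2 + U ^ 2 + 3 * Z ^ 2)
                / (poly_D Z U * (Z - 1) * (Z ^ 2 + 3) ^ 3)
            \<and> x * B1 = - (512 * Z ^ 6 * (U * Z ^ 2 - 2 * Z ^ 2 + U) * (U - Z) * poly_N1 Z U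
                / ((Z ^ 2 - 1) * (Z ^ 2 + 3) ^ 3 * poly_D Z U))
            \<and> B2 = 16 * Z ^ 2 * (U * Z ^ 2 - 2 * Z ^ 2 + U) * poly_N2 Z U
                / ((U + Z) * (1 - Z ^ 2) * (Z ^ 2 + 3) ^ 3 * (U * Z - Z ^ 2 - U - 3 * Z))"
    unfolding Let_def by (intro conjI p)
qed

section \<open>Finite extensions inside a field\<close>

definition is_subfield :: "'a::field set \<Rightarrow> bool" where
  "is_subfield k \<longleftrightarrow> 1 \<in> k \<and> (\<forall>a\<in>k. \<forall>b\<in>k. a - b \<in> k \<and> a * b \<in> k) \<and> (\<forall>a\<in>k. inverse a \<in> k)"

lemma is_subfield_gen_field: "is_subfield (gen_field S)"
  by (auto simp: is_subfield_def intro: gen_field.intros)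

lemma gen_field_subset: "is_subfield k \<Longrightarrow> S \<subseteq> k \<Longrightarrow> gen_field S \<subseteq> k"
proof
  fix a assume "is_subfield k" "S \<subseteq> k" "a \<in> gen_field S"
  from this(3,1,2) show "a \<in> k"
    by (induction rule: gen_field.induct) (auto simp: is_subfield_def)
qed

lemma is_subfield_gen_field_eq: "is_subfield k \<Longrightarrow> gen_field k = k"
  using gen_field_subset[of k k] by (auto intro: gen_field_base)

lemma is_subfield_sum: "is_subfield k \<Longrightarrow> (\<And>i. i \<in> A \<Longrightarrow> f i \<in> k) \<Longrightarrow> sum f A \<in> k"
proof (induction A rule: infinite_finite_induct)
  case (insert x A)
  then have "f x \<in> gen_field k" "sum f A \<in> gen_field k"
    by (auto intro: gen_field_base)
  then have "f x + sum f A \<in> gen_field k"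
    by (rule gen_field_add)
  with insert show ?case
    by (simp add: is_subfield_gen_field_eq)
qed (use gen_field_zero[of k] is_subfield_gen_field_eq[of k] in auto)

lemma subfield_ops:
  assumes "is_subfield k"
  shows "0 \<in> k" "1 \<in> k" "a \<in> k \<Longrightarrow> - a \<in> k" "a \<in> k \<Longrightarrow> b \<in> k \<Longrightarrow> a + b \<in> k" "a \<in> k \<Longrightarrow> b \<in> k \<Longrightarrow> a - b \<in> k"
    "a \<in> k \<Longrightarrow> b \<in> k \<Longrightarrow> a * b \<in> k" "a \<in> k \<Longrightarrow> inverse a \<in> k" "a \<in> k \<Longrightarrow> b \<in> k \<Longrightarrow> a / b \<in> k"
    "a \<in> k \<Longrightarrow> a ^ n \<in> k" "numeral w \<in> k"
  using gen_field_intros[where S = k] unfolding is_subfield_gen_field_eq[OF assms] by auto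

text \<open>
  Gaussian elimination over the subfield \<open>k\<close>: a homogeneous system with fewer equations (\<open>C\<close>) than
  unknowns (\<open>R\<close>) has a nontrivial solution in \<open>k\<close>.
\<close>

lemma linear_dependence:
  fixes c :: "'i \<Rightarrow> 'j \<Rightarrow> 'a::field"
  assumes k: "is_subfield k" and "finite C" "finite R" "card C < card R"
    and "\<And>i j. i \<in> R \<Longrightarrow> j \<in> C \<Longrightarrow> c i j \<in> k"
  shows "\<exists>d. (\<forall>i\<in>R. d i \<in> k) \<and> (\<exists>i\<in>R. d i \<noteq> 0) \<and> (\<forall>j\<in>C. (\<Sum>i\<in>R. d i * c i j) = 0)"
  using assms(2-)
proof (induction C arbitrary: R c rule: finite_induct)
  case empty
  then have "R \<noteq> {}" by auto
  then show ?case
    using subfield_ops[OF k] by (intro exI[of _ "\<lambda>_. 1"]) auto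
next
  case (insert j0 C)
  show ?case
  proof (cases "\<forall>i\<in>R. c i j0 = 0")
    case True
    then show ?thesis
      using insert.IH[of R c] insert.prems insert.hyps by auto
  next
    case False
    then obtain p where p: "p \<in> R" "c p j0 \<noteq> 0" by auto
    define R' where "R' = R - {p}"
    define c' where "c' i j = c i j - c i j0 / c p j0 * c p j" for i j
    have "finite R'" "card C < card R'"
      using insert p by (auto simp: R'_def)
    moreover have "c' i j \<in> k" if "i \<in> R'" "j \<in> C" for i j
      using that p insert.prems(3) unfolding c'_def R'_def by (intro subfield_ops[OF k]) auto
    ultimately obtain d' where d': "\<forall>i\<in>R'. d' i \<in> k" "\<exists>i\<in>R'. d' i \<noteq> 0" "\<forall>j\<in>C. (\<Sum>i\<in>R'. d' i * c' i j) = 0"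
      using insert.IH[of R' c'] by blast
    define s where "s = (\<Sum>i\<in>R'. d' i * c i j0) / c p j0"
    define d where "d i = (if i = p then - s else d' i)" for i
    have s: "s \<in> k"
      using d'(1) p insert.prems(3) unfolding s_def R'_def
      by (intro subfield_ops[OF k] is_subfield_sum[OF k]) auto
    have sum: "(\<Sum>i\<in>R. d i * c i j) = - s * c p j + (\<Sum>i\<in>R'. d' i * c i j)" for j
    proof -
      have "(\<Sum>i\<in>R. d i * c i j) = d p * c p j + (\<Sum>i\<in>R'. d i * c i j)"
        unfolding R'_def using p insert.prems(1) by (simp add: sum.remove)
      also have "(\<Sum>i\<in>R'. d i * c i j) = (\<Sum>i\<in>R'. d' i * c i j)"
        by (intro sum.cong) (auto simp: d_def R'_def)
      finally show ?thesis by (simp add: d_def)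
    qed
    have "(\<Sum>i\<in>R. d i * c i j) = 0" if "j \<in> insert j0 C" for j
    proof (cases "j = j0")
      case True
      then show ?thesis
        unfolding sum using p by (simp add: s_def)
    next
      case False
      then have "(\<Sum>i\<in>R'. d' i * c' i j) = 0"
        using that d'(3) by auto
      moreover have "(\<Sum>i\<in>R'. d' i * c' i j) = (\<Sum>i\<in>R'. d' i * c i j) - s * c p j"
        unfolding c'_def s_def right_diff_distrib sum_subtractf sum_divide_distrib sum_distrib_right
        by (simp add: mult_ac)
      ultimately show ?thesis
        unfolding sum by simp
    qed
    moreover have "\<forall>i\<in>R. d i \<in> k" "\<exists>i\<in>R. d i \<noteq> 0"
      using d' s subfield_ops[OF k] by (auto simp: d_def R'_def)
    ultimately show ?thesis by blast
  qed
qed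

text \<open>\<open>M\<close> is a field that is spanned over its subfield \<open>k\<close> by \<open>n\<close> elements.\<close>

definition fin_ext :: "'a::field set \<Rightarrow> nat \<Rightarrow> 'a set \<Rightarrow> bool" where
  "fin_ext k n M \<longleftrightarrow> is_subfield k \<and> is_subfield M \<and> k \<subseteq> M \<and>
     (\<exists>b. \<forall>a\<in>M. \<exists>c. (\<forall>i<n. c i \<in> k) \<and> a = (\<Sum>i<n. c i * b i))"

lemma fin_ext_refl:
  assumes "is_subfield k"
  shows "fin_ext k 1 k"
proof -
  have *: "\<forall>a\<in>k. \<exists>c. (\<forall>i<1::nat. c i \<in> k) \<and> a = (\<Sum>i<1::nat. c i * 1)"
  proof
    fix a assume "a \<in> k"
    then have "(\<forall>i<1::nat. (\<lambda>_. a) i \<in> k) \<and> a = (\<Sum>i<1::nat. (\<lambda>_. a) i * 1)"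
      by (simp add: lessThan_Suc)
    then show "\<exists>c. (\<forall>i<1::nat. c i \<in> k) \<and> a = (\<Sum>i<1::nat. c i * 1)"
      by (rule exI[where x = "\<lambda>_. a"])
  qed
  show ?thesis
    unfolding fin_ext_def by (intro conjI exI[of _ "\<lambda>_. 1"] assms subset_refl) (rule *)
qed

text \<open>
  The \<open>n + 1\<close> powers \<open>1, a, \<dots>, a\<^sup>n\<close> lie in a space spanned by \<open>n\<close> elements.
\<close>

lemma spanned_annihilator:
  assumes k: "is_subfield k" and "\<And>j. \<exists>c. (\<forall>i<n. c i \<in> k) \<and> a ^ j = (\<Sum>i<n. c i * b i)"
  shows "\<exists>p. annihilates k p a \<and> degree p \<le> n"
proof -
  obtain c where c: "\<And>j i. i < n \<Longrightarrow> c j i \<in> k" "\<And>j. a ^ j = (\<Sum>i<n. c j i * b i)"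
    using assms(2) by metis
  obtain d where d: "\<forall>j\<in>{..n}. d j \<in> k" "\<exists>j\<in>{..n}. d j \<noteq> 0" "\<forall>i\<in>{..<n}. (\<Sum>j\<in>{..n}. d j * c j i) = 0"
    using linear_dependence[OF k, of "{..<n}" "{..n}" c] c(1) by auto
  define p where "p = (\<Sum>j\<le>n. monom (d j) j)"
  have coeff: "coeff p j = (if j \<le> n then d j else 0)" for j
    by (simp add: p_def coeff_sum coeff_monom)
  have "poly p a = (\<Sum>j\<le>n. d j * (\<Sum>i<n. c j i * b i))"
    by (simp add: p_def poly_sum poly_monom c(2))
  also have "\<dots> = (\<Sum>i<n. (\<Sum>j\<le>n. d j * c j i) * b i)"
    unfolding sum_distrib_left sum_distrib_right by (subst sum.swap) (simp add: mult.assoc)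
  also have "\<dots> = 0"
    using d(3) by simp
  finally have "poly p a = 0" .
  moreover have "p \<noteq> 0"
    using d(2) coeff by (metis atMost_iff coeff_0)
  moreover have "degree p \<le> n"
    by (rule degree_le) (simp add: coeff)
  ultimately show ?thesis
    unfolding annihilates_def using d(1) coeff subfield_ops(1)[OF k] by auto
qed

lemma fin_ext_annihilator:
  assumes "fin_ext k n M" "a \<in> M"
  shows "\<exists>p. annihilates k p a \<and> degree p \<le> n"
proof -
  have k: "is_subfield k" and M: "is_subfield M"
    using assms(1) by (auto simp: fin_ext_def)
  obtain b where b: "\<forall>a\<in>M. \<exists>c. (\<forall>i<n. c i \<in> k) \<and> a = (\<Sum>i<n. c i * b i)"
    using assms(1) unfolding fin_ext_def by blast
  have "a ^ j \<in> M" for j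
    using subfield_ops(9)[OF M assms(2)] .
  then show ?thesis
    using b by (intro spanned_annihilator[OF k, of n a b]) blast
qed

text \<open>
  Since \<open>f\<close> may be reducible, inverses do not come from Bezout's identity: every nonzero \<open>a\<close> of
  \<open>N\<close> has an annihilator over \<open>M\<close>, and its lowest nonzero coefficient is a multiple of \<open>a\<close> by an element of \<open>N\<close>.
\<close>

lemma adjoin_root:
  assumes M: "is_subfield M" and f: "annihilates M f g"
  defines "N \<equiv> {a. \<exists>c. (\<forall>i<degree f. c i \<in> M) \<and> a = (\<Sum>i<degree f. c i * g ^ i)}"
  shows "is_subfield N" "M \<subseteq> N" "g \<in> N"
proof -
  define m where "m = degree f"
  note M_ops = subfield_ops[OF M]
  have f0: "lead_coeff f \<noteq> 0" and fM: "\<And>i. coeff f i \<in> M" and fg: "poly f g = 0"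
    using f by (auto simp: annihilates_def)
  have N_iff: "a \<in> N \<longleftrightarrow> (\<exists>c. (\<forall>i<m. c i \<in> M) \<and> a = (\<Sum>i<m. c i * g ^ i))" for a
    by (simp add: N_def m_def)
  have m: "m > 0"
  proof (rule ccontr)
    assume "\<not> m > 0"
    then obtain c where "f = [:c:]"
      by (metis degree_eq_zeroE m_def neq0_conv)
    then show False using f0 fg by auto
  qed
  have N0: "0 \<in> N"
    unfolding N_iff using M_ops(1) by (intro exI[of _ "\<lambda>_. 0"]) auto
  have add: "a + b \<in> N" if ab: "a \<in> N" "b \<in> N" for a b
  proof -
    obtain c d where "\<forall>i<m. c i \<in> M" "a = (\<Sum>i<m. c i * g ^ i)" "\<forall>i<m. d i \<in> M" "b = (\<Sum>i<m. d i * g ^ i)"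
      using ab[unfolded N_iff] by (elim exE conjE)
    then show ?thesis
      unfolding N_iff by (intro exI[of _ "\<lambda>i. c i + d i"]) (auto simp: sum.distrib distrib_right intro: M_ops(4))
  qed
  have smult: "e * a \<in> N" if eM: "e \<in> M" and aN: "a \<in> N" for e a
  proof -
    obtain c where "\<forall>i<m. c i \<in> M" "a = (\<Sum>i<m. c i * g ^ i)"
      using aN[unfolded N_iff] by (elim exE conjE)
    then show ?thesis
      unfolding N_iff using eM
      by (intro exI[of _ "\<lambda>i. e * c i"]) (auto simp: sum_distrib_left mult.assoc intro: M_ops(6))
  qed
  have sumN: "sum h A \<in> N" if "\<And>i. i \<in> A \<Longrightarrow> h i \<in> N" for h and A :: "nat set"
    using that by (induction A rule: infinite_finite_induct) (auto intro: N0 add)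
  have low: "g ^ i \<in> N" if "i < m" for i
    unfolding N_iff using that M_ops(1,2)
    by (intro exI[of _ "\<lambda>j. if j = i then 1 else 0"]) (auto simp: if_distrib[of "\<lambda>x. x * _"] cong: if_cong)
  have fsum: "poly f g = (\<Sum>i<m. coeff f i * g ^ i) + coeff f m * g ^ m"
    unfolding poly_altdef m_def by (simp add: lessThan_Suc_atMost[symmetric])
  have gm_eq: "g ^ m = - inverse (coeff f m) * (\<Sum>i<m. coeff f i * g ^ i)"
  proof -
    have c0: "coeff f m \<noteq> 0"
      using f0 by (simp add: m_def)
    have "coeff f m * g ^ m = - (\<Sum>i<m. coeff f i * g ^ i)"
      using fsum fg by (simp add: eq_neg_iff_add_eq_0 add.commute)
    then have "inverse (coeff f m) * (coeff f m * g ^ m) = inverse (coeff f m) * - (\<Sum>i<m. coeff f i * g ^ i)"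
      by simp
    then show ?thesis
      using c0 by (simp only: mult.assoc[symmetric] left_inverse mult_1_left mult_minus_right mult_minus_left simp_thms)
  qed
  have gm: "g ^ m \<in> N"
    unfolding gm_eq by (intro smult sumN low M_ops fM) auto
  have gN: "g * a \<in> N" if aN: "a \<in> N" for a
  proof -
    obtain c where c: "\<forall>i<m. c i \<in> M" "a = (\<Sum>i<m. c i * g ^ i)"
      using aN[unfolded N_iff] by (elim exE conjE)
    have "g * a = (\<Sum>i<m. c i * g ^ Suc i)"
      unfolding c(2) sum_distrib_left by (simp add: mult_ac)
    also have "\<dots> \<in> N"
    proof (intro sumN smult)
      fix i assume i: "i \<in> {..<m}"
      then show "c i \<in> M"
        using c(1) by simp
      show "g ^ Suc i \<in> N"
      proof (cases "Suc i < m")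
        case True
        then show ?thesis by (rule low)
      next
        case False
        then have "Suc i = m" using i by simp
        then show ?thesis using gm by (simp only:)
      qed
    qed
    finally show ?thesis .
  qed
  have pow_mult: "g ^ j * a \<in> N" if "a \<in> N" for j a
    by (induction j) (auto simp: mult.assoc that intro: gN)
  have mult: "a * b \<in> N" if ab: "a \<in> N" "b \<in> N" for a b
  proof -
    obtain c where c: "\<forall>i<m. c i \<in> M" "a = (\<Sum>i<m. c i * g ^ i)"
      using ab(1)[unfolded N_iff] by (elim exE conjE)
    have "a * b = (\<Sum>i<m. c i * (g ^ i * b))"
      unfolding c(2) sum_distrib_right by (simp add: mult.assoc)
    also have "\<dots> \<in> N"
      using c(1) ab(2) by (intro sumN smult pow_mult) auto
    finally show ?thesis .
  qed
  have one: "1 \<in> N"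
    using low[of 0] m by simp
  show MN: "M \<subseteq> N"
    using smult[OF _ one] by auto
  show "g \<in> N"
    using pow_mult[OF one, of 1] by simp
  have neg: "- a \<in> N" if "a \<in> N" for a
    using smult[OF _ that, of "-1"] M_ops(2,3) by simp
  have pow: "a ^ j \<in> N" if "a \<in> N" for a j
    by (induction j) (auto intro: one mult that)
  have "inverse a \<in> N" if a: "a \<in> N" for a
  proof (cases "a = 0")
    case False
    obtain p where p: "annihilates M p a"
      using spanned_annihilator[OF M, of m a "\<lambda>i. g ^ i"] pow[OF a] unfolding N_iff by blast
    then have p0: "p \<noteq> 0" and pa: "poly p a = 0" and pM: "\<And>i. coeff p i \<in> M"
      by (auto simp: annihilates_def)
    define l where "l = (LEAST i. coeff p i \<noteq> 0)"
    have "coeff p (degree p) \<noteq> 0"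
      using p0 by simp
    then have l: "coeff p l \<noteq> 0"
      unfolding l_def by (rule LeastI)
    have l_least: "coeff p i = 0" if "i < l" for i
      using not_less_Least[OF that[unfolded l_def]] by simp
    have ln: "l \<le> degree p"
      using l by (rule le_degree)
    have "0 = (\<Sum>i\<le>degree p. coeff p i * a ^ i)"
      using pa by (simp add: poly_altdef)
    also have "\<dots> = (\<Sum>i\<in>{l..degree p}. coeff p i * a ^ i)"
      by (rule sum.mono_neutral_right) (auto simp: l_least)
    also have "\<dots> = coeff p l * a ^ l + (\<Sum>i\<in>{Suc l..degree p}. coeff p i * a ^ i)"
      using ln by (simp add: sum.atLeast_Suc_atMost)
    also have "(\<Sum>i\<in>{Suc l..degree p}. coeff p i * a ^ i) = a ^ Suc l * (\<Sum>i\<in>{Suc l..degree p}. coeff p i * a ^ (i - Suc l))"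
      unfolding sum_distrib_left by (intro sum.cong refl) (simp add: mult.left_commute flip: power_add power_Suc)
    finally have "0 = coeff p l * a ^ l + a ^ Suc l * (\<Sum>i\<in>{Suc l..degree p}. coeff p i * a ^ (i - Suc l))" .
    then have "a ^ l * (coeff p l + a * (\<Sum>i\<in>{Suc l..degree p}. coeff p i * a ^ (i - Suc l))) = 0"
      by (simp only: power_Suc2 distrib_left mult.assoc mult.commute[of _ "a ^ l"])
    then have "coeff p l + a * (\<Sum>i\<in>{Suc l..degree p}. coeff p i * a ^ (i - Suc l)) = 0" (is "_ + a * ?s = 0")
      using False by simp
    then have as: "a * ?s = - coeff p l"
      by (simp add: eq_neg_iff_add_eq_0 add.commute)
    have "a * (- inverse (coeff p l) * ?s) = - inverse (coeff p l) * (a * ?s)"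
      by (rule mult.left_commute)
    also have "\<dots> = 1"
      unfolding as using l by simp
    finally have "a * (- inverse (coeff p l) * ?s) = 1" .
    then have "inverse a = - inverse (coeff p l) * ?s"
      by (rule inverse_unique)
    moreover have "- inverse (coeff p l) * ?s \<in> N"
      using a pM by (intro smult sumN M_ops pow) auto
    ultimately show ?thesis by simp
  qed (simp add: N0)
  then show "is_subfield N"
    unfolding is_subfield_def using one mult add[OF _ neg] by simp
qed

lemma fin_ext_adjoin:
  assumes M: "fin_ext k n M" and f: "annihilates M f g"
  shows "\<exists>N. fin_ext k (n * degree f) N \<and> M \<subseteq> N \<and> g \<in> N"
proof -
  define N where "N = {a. \<exists>c. (\<forall>i<degree f. c i \<in> M) \<and> a = (\<Sum>i<degree f. c i * g ^ i)}"
  have k: "is_subfield k" "is_subfield M" "k \<subseteq> M"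
    using M by (auto simp: fin_ext_def)
  obtain b where b: "\<And>a. a \<in> M \<Longrightarrow> \<exists>c. (\<forall>i<n. c i \<in> k) \<and> a = (\<Sum>i<n. c i * b i)"
    using M unfolding fin_ext_def by blast
  note N = adjoin_root[OF k(2) f, folded N_def]
  define bb where "bb i = b (i mod n) * g ^ (i div n)" for i
  have "\<exists>c. (\<forall>i<n * degree f. c i \<in> k) \<and> a = (\<Sum>i<n * degree f. c i * bb i)" if aN: "a \<in> N" for a
  proof -
    obtain e where e: "\<forall>j<degree f. e j \<in> M" "a = (\<Sum>j<degree f. e j * g ^ j)"
      using aN[unfolded N_def mem_Collect_eq] by (elim exE conjE)
    have "\<forall>j<degree f. \<exists>c. (\<forall>i<n. c i \<in> k) \<and> e j = (\<Sum>i<n. c i * b i)"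
      using e(1) b by blast
    then obtain c where c: "\<And>j i. j < degree f \<Longrightarrow> i < n \<Longrightarrow> c j i \<in> k"
      "\<And>j. j < degree f \<Longrightarrow> e j = (\<Sum>i<n. c j i * b i)"
      by metis
    define F where "F l = c (l div n) (l mod n) * bb l" for l
    have "a = (\<Sum>j<degree f. \<Sum>i<n. c j i * b i * g ^ j)"
      unfolding e(2) using c(2) by (intro sum.cong) (auto simp: sum_distrib_right)
    also have "\<dots> = (\<Sum>j<degree f. \<Sum>i\<in>{..<n}. c ((i + j * n) div n) ((i + j * n) mod n) * bb (i + j * n))"
      unfolding bb_def by (intro sum.cong refl) (auto simp: mult.assoc)
    also have "\<dots> = (\<Sum>j<degree f. sum F {j * n..<j * n + n})"
    proof (rule sum.cong[OF refl])
      fix j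
      show "(\<Sum>i<n. c ((i + j * n) div n) ((i + j * n) mod n) * bb (i + j * n)) = sum F {j * n..<j * n + n}"
        using sum.shift_bounds_nat_ivl[of F 0 "j * n" n, symmetric]
        by (simp only: F_def atLeast0LessThan add_0 add.commute[of n "j * n"])
    qed
    also have "\<dots> = (\<Sum>l<degree f * n. c (l div n) (l mod n) * bb l)"
      unfolding sum.nat_group F_def ..
    finally have "a = (\<Sum>l<n * degree f. c (l div n) (l mod n) * bb l)"
      by (simp add: mult.commute)
    moreover have "c (l div n) (l mod n) \<in> k" if "l < n * degree f" for l
      using that by (intro c(1)) (auto simp: less_mult_imp_div_less mult.commute intro!: mod_less_divisor Nat.gr0I)
    ultimately have "(\<forall>l<n * degree f. c (l div n) (l mod n) \<in> k) \<and>
        a = (\<Sum>l<n * degree f. c (l div n) (l mod n) * bb l)"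
      by blast
    then show ?thesis
      by (rule exI[where x = "\<lambda>l. c (l div n) (l mod n)"])
  qed
  then show ?thesis
    using k N unfolding fin_ext_def by blast
qed

section \<open>The series are algebraic\<close>

lemma zz_annihilated:
  assumes M: "is_subfield M" "tt \<in> M"
  shows "\<exists>f. annihilates M f zz \<and> degree f = 8"
proof -
  note ops = subfield_ops[OF M(1)]
  define f where "f = [:-27, 0, 0, 0, 18, 0, 8 - 256 * tt\<^sup>2, 0, 1:]"
  have "poly f zz = (zz\<^sup>2 - 1) * (zz\<^sup>2 + 3)^3 - 256 * tt\<^sup>2 * zz^6"
    unfolding f_def by (simp only: poly_pCons poly_0) algebra
  also have "\<dots> = 0"
    using zz_curve by simp
  finally have "poly f zz = 0" .
  moreover have "coeff f i \<in> M" for i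
    unfolding f_def by (auto simp: coeff_pCons split: nat.splits intro!: ops M)
  moreover have "degree f = 8" "f \<noteq> 0"
    by (simp_all add: f_def)
  ultimately show ?thesis
    unfolding annihilates_def by blast
qed

lemma mm_annihilated:
  assumes M: "is_subfield M" "tt \<in> M" "zz \<in> M" "fps_to_fls X \<in> M" and X: "X \<noteq> 0"
  shows "\<exists>f. annihilates M f (mm X) \<and> degree f = 3"
proof -
  note ops = subfield_ops[OF M(1)]
  define x where "x = fps_to_fls X"
  have xM: "x \<in> M" and x0: "x \<noteq> 0"
    using M(4) X by (auto simp: x_def)
  define a b c a' b' c' where "a = zz\<^sup>2 + 1" "b = zz + 1" "c = zz - 1" "a' = - 2 * zz" "b' = zz - 3" "c' = - zz - 3"
  note d = this
  have in_M: "a \<in> M" "b \<in> M" "c \<in> M" "a' \<in> M" "b' \<in> M" "c' \<in> M" "16 * zz^3 * tt \<in> M"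
    unfolding d by (intro ops M)+
  define f where "f = [: 16 * zz^3 * tt - x * (a' * b' * c'), - (x * (a * b' * c' + a' * b * c' + a' * b' * c)),
      - (16 * zz^3 * tt) - x * (a * b * c' + a * b' * c + a' * b * c), - (x * (a * b * c)) :]"
  have "poly f (mm X) = 16 * zz^3 * (1 - (mm X)\<^sup>2) * tt - x * ck zz (mm X)"
    unfolding f_def d ck_def h1_def h2_def h3_def by (simp only: poly_pCons poly_0) algebra
  also have "\<dots> = 0"
    using abscissa[of X] by (simp add: x_def)
  finally have "poly f (mm X) = 0" .
  moreover have "coeff f i \<in> M" for i
    unfolding f_def by (auto simp: coeff_pCons split: nat.splits intro!: ops(1,3-6) in_M xM)
  moreover have "a \<noteq> 0" "b \<noteq> 0" "c \<noteq> 0"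
    using good_zz unfolding d good_param_def by auto
  then have "degree f = 3" "f \<noteq> 0"
    using x0 by (simp_all add: f_def)
  ultimately show ?thesis
    unfolding annihilates_def by blast
qed

lemma fin_ext_zz:
  assumes "is_subfield k" "tt \<in> k"
  shows "\<exists>M. fin_ext k 8 M \<and> zz \<in> M"
proof -
  obtain f where "annihilates k f zz" "degree f = 8"
    using zz_annihilated[OF assms] by blast
  then show ?thesis
    using fin_ext_adjoin[OF fin_ext_refl[OF assms(1)], of f zz] by auto
qed

lemma fin_ext_mm:
  assumes M: "fin_ext k n M" "tt \<in> k" "zz \<in> M" "fps_to_fls X \<in> k" "X \<noteq> 0"
  shows "\<exists>N. fin_ext k (n * 3) N \<and> M \<subseteq> N \<and> mm X \<in> N"
proof -
  have "is_subfield M" "k \<subseteq> M"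
    using M(1) by (auto simp: fin_ext_def)
  then obtain f where "annihilates M f (mm X)" "degree f = 3"
    using mm_annihilated[of M X] M by blast
  then show ?thesis
    using fin_ext_adjoin[OF M(1), of f "mm X"] by auto
qed

lemma F_in_subfield:
  assumes "is_subfield M" "z \<in> M" "u \<in> M"
  shows "F1 z u \<in> M" "F2 z u \<in> M" "F3 z u \<in> M" "F4 z u \<in> M"
  using F_in_gen_field[of z M u] assms unfolding is_subfield_gen_field_eq[OF assms(1)] by auto

lemma boundary_series_in_subfield:
  assumes M: "is_subfield M" "tt \<in> M" "zz \<in> M" "fps_to_fls (fps_const c) \<in> M" "mm (fps_const c) \<in> M"
    and c: "c \<noteq> 0"
  shows "fps_to_fls (L (fps_const c) 0) \<in> M" "fps_to_fls (L 0 (fps_const c)) \<in> M"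
    "fps_to_fls (B (fps_const c) 0) \<in> M" "fps_to_fls (B 0 (fps_const c)) \<in> M"
proof -
  note ops = subfield_ops[OF M(1)]
  define X where "X = fps_const c"
  have u: "fps_to_fls (UF X) \<in> M"
    unfolding zz_mm[symmetric] X_def by (rule ops(6)[OF M(3,5)])
  note F = F_in_subfield[OF M(1,3) u]
  obtain Y where Y: "kernel_pair X Y" "fps_nth Y 0 = 0"
    using kernel_pair_const[OF c] unfolding X_def by blast
  have x0: "fps_to_fls X \<noteq> 0"
    using c by (simp add: X_def)
  have q: "b = a / c" if "c * b = a" "c \<noteq> 0" for a b c :: "qxy fls"
    using that by (simp add: nonzero_eq_divide_eq mult.commute)
  have x: "fps_to_fls X \<in> M"
    using M(4) by (simp only: X_def)
  show "fps_to_fls (L (fps_const c) 0) \<in> M" "fps_to_fls (B 0 (fps_const c)) \<in> M"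
    unfolding X_def[symmetric] L_B_series by (rule F)+
  show "fps_to_fls (L 0 (fps_const c)) \<in> M"
    unfolding X_def[symmetric] q[OF L_B_series_boundary(1)[OF Y] x0] by (intro ops(6,8) M(2) F x)
  show "fps_to_fls (B (fps_const c) 0) \<in> M"
    unfolding X_def[symmetric] q[OF L_B_series_boundary(2)[OF Y] x0] by (intro ops(6,8) M(2) F x)
qed

lemma corner_series_in_subfield:
  assumes "is_subfield M" "zz \<in> M"
  shows "fps_to_fls (L 0 0) \<in> M" "fps_to_fls (B 0 0) \<in> M"
  unfolding L_B_series UF_0 zz_def[symmetric] using F_in_subfield[OF assms assms(2)] by auto

lemma inner_series_in_subfield:
  assumes M: "is_subfield M" "tt \<in> M" "zz \<in> M"
    and a: "fps_to_fls (fps_const a) \<in> M" "mm (fps_const a) \<in> M" "a \<noteq> 0"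
    and b: "fps_to_fls (fps_const b) \<in> M" "mm (fps_const b) \<in> M" "b \<noteq> 0"
  shows "fps_to_fls (L (fps_const a) (fps_const b)) \<in> M" "fps_to_fls (B (fps_const a) (fps_const b)) \<in> M"
    "fps_to_fls (P (fps_const a) (fps_const b)) \<in> M"
proof -
  note ops = subfield_ops[OF M(1)]
  define X Y where "X = fps_const a" "Y = fps_const b"
  note d = this[symmetric]
  define k where "k = fps_to_fls (X * Y - vt * (X * (X * Y) + Y + X * (Y * Y) + X))"
  note in_M = M(2,3) a(1)[unfolded d] b(1)[unfolded d] corner_series_in_subfield[OF M(1,3)]
    boundary_series_in_subfield[OF M a, unfolded d] boundary_series_in_subfield[OF M b, unfolded d]
  have k_eq: "k = fps_to_fls X * fps_to_fls Y - tt * (fps_to_fls X * (fps_to_fls X * fps_to_fls Y)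
      + fps_to_fls Y + fps_to_fls X * (fps_to_fls Y * fps_to_fls Y) + fps_to_fls X)"
    by (simp only: k_def fls_hom tt_def)
  have kM: "k \<in> M"
    unfolding k_eq by (intro ops in_M)
  have k0: "k \<noteq> 0"
    unfolding k_def by (rule fls_unit) (use a b in \<open>simp add: X_Y_def\<close>)
  have div: "l \<in> M" if "k * (2 * l - e) = r" "r \<in> M" "e \<in> M" for l e r
  proof -
    have "l = (r / k + e) / 2"
      using that(1) k0 by (simp add: field_simps)
    moreover have "(r / k + e) / 2 \<in> M"
      by (intro ops(4,8,10) that(2,3) kM)
    ultimately show ?thesis
      by (simp only:)
  qed
  show LM: "fps_to_fls (L (fps_const a) (fps_const b)) \<in> M"
    unfolding d using arg_cong[OF L_at[of X Y], of fps_to_fls]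
    unfolding fls_hom tt_def[symmetric] k_eq[symmetric]
    by (rule div) (intro ops in_M)+
  show BM: "fps_to_fls (B (fps_const a) (fps_const b)) \<in> M"
    unfolding d using arg_cong[OF B_at[of X Y], of fps_to_fls]
    unfolding fls_hom tt_def[symmetric] k_eq[symmetric]
    by (rule div) (intro ops in_M)+
  define x y where "x = fps_to_fls X" "y = fps_to_fls Y"
  have xy: "x \<noteq> 0" "y \<noteq> 0"
    using a b by (auto simp: x_y_def X_Y_def)
  have "x * (y * fps_to_fls (P X Y)) = y * (fps_to_fls (L X Y) - fps_to_fls (L 0 Y)) + x * (fps_to_fls (B X Y) - fps_to_fls (B X 0))"
    using arg_cong[OF P_at[of X Y], of fps_to_fls] unfolding x_y_def by (simp only: fls_hom)
  then have "fps_to_fls (P X Y) = (y * (fps_to_fls (L X Y) - fps_to_fls (L 0 Y)) + x * (fps_to_fls (B X Y) - fps_to_fls (B X 0))) / (x * y)"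
    using xy by (simp add: nonzero_eq_divide_eq mult_ac)
  also have "\<dots> \<in> M"
    unfolding x_y_def by (intro ops in_M LM[unfolded d] BM[unfolded d])
  finally show "fps_to_fls (P (fps_const a) (fps_const b)) \<in> M"
    unfolding d .
qed

definition yq :: qxy where "yq = emb_poly [:0, 1:]"

lemma variables: "vx = fps_const xq" "vy = fps_const yq" "inverse vx = fps_const (inverse xq)"
  "inverse vy = fps_const (inverse yq)" "yq \<noteq> 0"
  using emb_var_nonzero by (simp_all add: vx_def vy_def xq_def yq_def fps_const_inverse)

lemma Q_xyt_facts: "is_subfield Q_xyt" "tt \<in> Q_xyt" "fps_to_fls vx \<in> Q_xyt" "fps_to_fls vy \<in> Q_xyt"
  "fps_to_fls (inverse vx) \<in> Q_xyt" "fps_to_fls (inverse vy) \<in> Q_xyt"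
  and Q_xt_facts: "is_subfield Q_xt" "tt \<in> Q_xt" "fps_to_fls vx \<in> Q_xt" "Q_xt \<subseteq> Q_xyt"
proof -
  show s: "is_subfield Q_xyt" "is_subfield Q_xt"
    unfolding Q_xyt_def Q_xt_def by (rule is_subfield_gen_field)+
  show g: "tt \<in> Q_xyt" "fps_to_fls vx \<in> Q_xyt" "fps_to_fls vy \<in> Q_xyt" "tt \<in> Q_xt" "fps_to_fls vx \<in> Q_xt"
    by (auto simp: Q_xyt_def Q_xt_def tt_def intro: gen_field_base)
  have "fps_to_fls (inverse vx) = inverse (fps_to_fls vx)" "fps_to_fls (inverse vy) = inverse (fps_to_fls vy)"
    using vx_inverse by (metis fps_one_to_fls fls_times_fps_to_fls inverse_unique)+
  then show "fps_to_fls (inverse vx) \<in> Q_xyt" "fps_to_fls (inverse vy) \<in> Q_xyt"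
    using g subfield_ops(7)[OF s(1)] by auto
  show "Q_xt \<subseteq> Q_xyt"
    unfolding Q_xt_def by (rule gen_field_subset[OF s(1)]) (use g in \<open>auto simp: tt_def\<close>)
qed

lemma fin_ext_1:
  assumes "is_subfield k" "tt \<in> k" "fps_to_fls (fps_const a) \<in> k" "a \<noteq> 0"
  shows "\<exists>M. fin_ext k 24 M \<and> zz \<in> M \<and> mm (fps_const a) \<in> M"
proof -
  obtain M where M: "fin_ext k 8 M" "zz \<in> M"
    using fin_ext_zz[OF assms(1,2)] by blast
  then show ?thesis
    using fin_ext_mm[OF M(1) assms(2) M(2) assms(3)] assms(4) by auto
qed

lemma fin_ext_2:
  assumes "is_subfield k" "tt \<in> k" "fps_to_fls (fps_const a) \<in> k" "a \<noteq> 0" "fps_to_fls (fps_const b) \<in> k" "b \<noteq> 0"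
  shows "\<exists>M. fin_ext k 72 M \<and> zz \<in> M \<and> mm (fps_const a) \<in> M \<and> mm (fps_const b) \<in> M"
proof -
  obtain M where M: "fin_ext k 24 M" "zz \<in> M" "mm (fps_const a) \<in> M"
    using fin_ext_1[OF assms(1-4)] by blast
  then show ?thesis
    using fin_ext_mm[OF M(1) assms(2) M(2) assms(5)] assms(6) by auto
qed

theorem boundary_series_degree_le:
  assumes "f \<in> {L vx 0, L 0 vx, B vx 0, B 0 vx}"
  shows "\<exists>p. annihilates Q_xt p (fps_to_fls f) \<and> degree p \<le> 24"
proof -
  obtain M where M: "fin_ext Q_xt 24 M" "zz \<in> M" "mm vx \<in> M"
    using fin_ext_1[of Q_xt xq] Q_xt_facts xq_nonzero unfolding variables by blast
  then have "is_subfield M" "tt \<in> M" "fps_to_fls vx \<in> M"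
    using Q_xt_facts by (auto simp: fin_ext_def)
  then have "fps_to_fls f \<in> M"
    using boundary_series_in_subfield[of M xq] M xq_nonzero assms unfolding variables by blast
  then show ?thesis
    by (rule fin_ext_annihilator[OF M(1)])
qed

theorem inner_series_degree_le:
  assumes "f \<in> {P vx vy, inverse vx * L (inverse vx) vy, inverse vy * B vx (inverse vy)}"
  shows "\<exists>p. annihilates Q_xyt p (fps_to_fls f) \<and> degree p \<le> 72"
proof -
  have *: "\<exists>p. annihilates Q_xyt p (fps_to_fls f) \<and> degree p \<le> 72"
    if f: "f \<in> {P X Y, X * L X Y, Y * B X Y}"
      and X: "X = fps_const a" "a \<noteq> 0" "fps_to_fls X \<in> Q_xyt" and Y: "Y = fps_const b" "b \<noteq> 0" "fps_to_fls Y \<in> Q_xyt"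
    for X Y a b
  proof -
    obtain M where M: "fin_ext Q_xyt 72 M" "zz \<in> M" "mm X \<in> M" "mm Y \<in> M"
      using fin_ext_2[of Q_xyt a b] Q_xyt_facts X Y by blast
    then have QM: "Q_xyt \<subseteq> M" and m: "is_subfield M"
      by (auto simp: fin_ext_def)
    then have x: "tt \<in> M" "fps_to_fls X \<in> M" "fps_to_fls Y \<in> M"
      using Q_xyt_facts(2) X(3) Y(3) by blast+
    note i = inner_series_in_subfield[OF m x(1) M(2) x(2)[unfolded X(1)] M(3)[unfolded X(1)] X(2)
        x(3)[unfolded Y(1)] M(4)[unfolded Y(1)] Y(2), folded X(1) Y(1)]
    have "fps_to_fls (P X Y) \<in> M" "fps_to_fls (X * L X Y) \<in> M" "fps_to_fls (Y * B X Y) \<in> M"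
      unfolding fls_hom by (intro subfield_ops(6)[OF m] i x)+
    then have "fps_to_fls f \<in> M"
      using f by blast
    then show ?thesis
      by (rule fin_ext_annihilator[OF M(1)])
  qed
  have xi: "inverse xq \<noteq> 0" "inverse yq \<noteq> 0"
    using xq_nonzero variables(5) by simp_all
  consider "f = P vx vy" | "f = inverse vx * L (inverse vx) vy" | "f = inverse vy * B vx (inverse vy)"
    using assms by auto
  then show ?thesis
  proof cases
    case 1
    then show ?thesis
      by (intro *[OF _ variables(1) xq_nonzero Q_xyt_facts(3) variables(2,5) Q_xyt_facts(4)]) simp
  next
    case 2
    then show ?thesis
      by (intro *[OF _ variables(3) xi(1) Q_xyt_facts(5) variables(2,5) Q_xyt_facts(4)]) simp
  next
    case 3
    then show ?thesis
      by (intro *[OF _ variables(1) xq_nonzero Q_xyt_facts(3) variables(4) xi(2) Q_xyt_facts(6)]) simp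
  qed
qed

lemma gf_cone_split: "gf cone_walks = gf quadrant_walks + gf left_walks + gf below_walks"
proof (rule fps_ext)
  fix n
  let ?f = "\<lambda>w. (emb_poly [:[:0, 1:]:]) powi (fst (last w)) * (emb_poly [:0, 1:]) powi (snd (last w))"
  have fin: "finite (of_length n W)" if "W \<subseteq> cone_walks" for W
    by (rule finite_subset[OF _ finite_of_length[of n]]) (use that in \<open>auto simp: of_length_def\<close>)
  have f3: "finite (of_length n quadrant_walks)" "finite (of_length n left_walks)" "finite (of_length n below_walks)"
    by (rule fin, auto simp: quadrant_walks_def left_walks_def below_walks_def)+
  have u: "of_length n cone_walks = (of_length n quadrant_walks \<union> of_length n left_walks) \<union> of_length n below_walks"
    by (auto simp: of_length_def quadrant_walks_def left_walks_def below_walks_def)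
  have d1: "of_length n quadrant_walks \<inter> of_length n left_walks = {}"
    by (auto simp: of_length_def quadrant_walks_def left_walks_def)
  have d2: "(of_length n quadrant_walks \<union> of_length n left_walks) \<inter> of_length n below_walks = {}"
    using last_in_cone by (force simp: of_length_def quadrant_walks_def left_walks_def below_walks_def)
  have "sum ?f (of_length n cone_walks) =
      sum ?f (of_length n quadrant_walks) + sum ?f (of_length n left_walks) + sum ?f (of_length n below_walks)"
    unfolding u using f3 d1 d2 by (simp add: sum.union_disjoint)
  then show "fps_nth (gf cone_walks) n = fps_nth (gf quadrant_walks + gf left_walks + gf below_walks) n"
    by (simp add: gf_def)
qed

text \<open>
  The three parts are algebraic over the points above \<open>x\<close>, \<open>y\<close>, \<open>1/x\<close>, \<open>1/y\<close>; one finite extension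
  contains all of them.
\<close>

theorem gf_cone_algebraic: "algebraic_over Q_xyt (fps_to_fls (gf cone_walks))"
proof -
  have i: "inverse xq \<noteq> 0" "inverse yq \<noteq> 0"
    using xq_nonzero variables(5) by auto
  obtain M1 where M1: "fin_ext Q_xyt 72 M1" "zz \<in> M1" "mm vx \<in> M1" "mm vy \<in> M1"
    using fin_ext_2[of Q_xyt xq yq] Q_xyt_facts xq_nonzero variables by metis
  obtain M2 where M2: "fin_ext Q_xyt (72 * 3) M2" "M1 \<subseteq> M2" "mm (inverse vx) \<in> M2"
    using fin_ext_mm[OF M1(1) Q_xyt_facts(2) M1(2) Q_xyt_facts(5)] vx_inverse by (metis mult_zero_right zero_neq_one)
  obtain M where M: "fin_ext Q_xyt (72 * 3 * 3) M" "M2 \<subseteq> M" "mm (inverse vy) \<in> M"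
    using fin_ext_mm[OF M2(1) Q_xyt_facts(2) _ Q_xyt_facts(6)] M1(2) M2(2) vx_inverse
    by (metis mult_zero_right subsetD zero_neq_one)
  have s: "is_subfield M" "tt \<in> M" "zz \<in> M"
    using M M1 M2 Q_xyt_facts by (auto simp: fin_ext_def)
  have x: "fps_to_fls (fps_const xq) \<in> M" "mm (fps_const xq) \<in> M"
    "fps_to_fls (fps_const yq) \<in> M" "mm (fps_const yq) \<in> M"
    "fps_to_fls (fps_const (inverse xq)) \<in> M" "mm (fps_const (inverse xq)) \<in> M"
    "fps_to_fls (fps_const (inverse yq)) \<in> M" "mm (fps_const (inverse yq)) \<in> M"
    using M M1 M2 Q_xyt_facts(3-6) unfolding variables[symmetric] fin_ext_def by blast+
  have "fps_to_fls (P vx vy) \<in> M" "fps_to_fls (L (inverse vx) vy) \<in> M" "fps_to_fls (B vx (inverse vy)) \<in> M"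
    using inner_series_in_subfield[OF s x(1,2) xq_nonzero x(3,4) variables(5)]
      inner_series_in_subfield[OF s x(5,6) i(1) x(3,4) variables(5)]
      inner_series_in_subfield[OF s x(1,2) xq_nonzero x(7,8) i(2)]
    unfolding variables[symmetric] by blast+
  then have "fps_to_fls (gf cone_walks) \<in> M"
    unfolding gf_cone_split quadrant_walks_gf[symmetric] left_walks_gf[symmetric] below_walks_gf[symmetric] fls_hom
    using x unfolding variables[symmetric] by (intro subfield_ops(4,6)[OF s(1)])
  then show ?thesis
    unfolding algebraic_over_def using fin_ext_annihilator[OF M(1)] by blast
qed

section \<open>The generic point of the parametrization\<close>

text \<open>
  The value at \<open>a\<close> of a polynomial whose coefficients are first mapped by \<open>h\<close>. Iterated, it evaluates nested
  polynomials, that is, polynomials in several variables.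
\<close>

definition pe :: "('a::comm_ring_1 \<Rightarrow> 'b::comm_ring_1) \<Rightarrow> 'b \<Rightarrow> 'a poly \<Rightarrow> 'b" where
  "pe h a p = poly (map_poly h p) a"

lemma ring_map_pe: "ring_map h \<Longrightarrow> ring_map (pe h a)"
  unfolding pe_def by (rule ring_map_poly_eval)

lemma pe_pCons: "ring_map h \<Longrightarrow> pe h a (pCons c p) = h c + a * pe h a p"
  by (simp add: pe_def map_poly_pCons ring_map_simps)

lemma pe_0: "pe h a 0 = 0"
  by (simp add: pe_def)

lemma pe_compose:
  assumes "ring_map g" "ring_map h"
  shows "g (pe h a p) = pe (\<lambda>x. g (h x)) (g a) p"
proof -
  have gh: "ring_map (\<lambda>x. g (h x))"
    using assms by (rule ring_map_compose)
  show ?thesis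
    by (induction p) (simp_all add: pe_0 pe_pCons[OF assms(2)] pe_pCons[OF gh] ring_map_simps[OF assms(1)])
qed

lemma ring_map_of_int: "ring_map of_int"
  by (simp add: ring_map_def)

lemma ring_map_fps_to_fls: "ring_map fps_to_fls"
  by (simp add: ring_map_def fls_times_fps_to_fls)

lemma ring_map_of_int_eq: "ring_map g \<Longrightarrow> g (of_int n) = of_int n"
proof -
  assume g: "ring_map g"
  have "g (of_nat n) = of_nat n" for n
    by (induction n) (simp_all add: ring_map_simps[OF g])
  then show ?thesis
    by (cases n rule: int_cases2) (simp_all add: ring_map_simps[OF g])
qed

subsection \<open>Common denominators\<close>

lemma gen_field_quotients:
  fixes h :: "'r::comm_ring_1 \<Rightarrow> 'f::field"
  assumes h: "ring_map h" and S: "\<And>s. s \<in> S \<Longrightarrow> \<exists>a b. h b \<noteq> 0 \<and> s = h a / h b" and c: "c \<in> gen_field S"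
  shows "\<exists>a b. h b \<noteq> 0 \<and> c = h a / h b"
  using c
proof (induction rule: gen_field.induct)
  case (gen_field_base a)
  then show ?case by (rule S)
next
  case gen_field_one
  then show ?case
    using ring_map_simps(2)[OF h] by (intro exI[of _ 1]) simp
next
  case (gen_field_diff a b)
  then obtain a1 a2 b1 b2 where *: "h a2 \<noteq> 0" "h b2 \<noteq> 0" "a = h a1 / h a2" "b = h b1 / h b2" by blast
  then have "a - b = h (a1 * b2 - b1 * a2) / h (a2 * b2)" "h (a2 * b2) \<noteq> 0"
    unfolding *(3,4) using *(1,2) by (simp_all add: ring_map_simps[OF h] diff_frac_eq)
  then show ?case by blast
next
  case (gen_field_mult a b)
  then obtain a1 a2 b1 b2 where *: "h a2 \<noteq> 0" "h b2 \<noteq> 0" "a = h a1 / h a2" "b = h b1 / h b2" by blast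
  then have "a * b = h (a1 * b1) / h (a2 * b2)" "h (a2 * b2) \<noteq> 0"
    by (simp_all add: ring_map_simps[OF h])
  then show ?case by blast
next
  case (gen_field_inverse a)
  then obtain a1 a2 where *: "h a2 \<noteq> 0" "a = h a1 / h a2" by blast
  show ?case
  proof (cases "h a1 = 0")
    case True
    then have "inverse a = h 0 / h 1" "h 1 \<noteq> 0"
      using * by (simp_all add: ring_map_simps[OF h])
    then show ?thesis by blast
  next
    case False
    then have "inverse a = h a2 / h a1"
      using * by simp
    with False show ?thesis by blast
  qed
qed

lemma common_denominator:
  fixes h :: "'r::comm_ring_1 \<Rightarrow> 'f::field"
  assumes h: "ring_map h" and "\<And>i. \<exists>a b. h b \<noteq> 0 \<and> coeff p i = h a / h b"
  shows "\<exists>d q. h d \<noteq> 0 \<and> map_poly h q = smult (h d) p"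
  using assms(2)
proof (induction p)
  case 0
  then show ?case
    using ring_map_simps(1,2)[OF h] by (intro exI[of _ 1] exI[of _ 0]) simp
next
  case (pCons c p)
  note hs = ring_map_simps[OF h]
  have "\<exists>a b. h b \<noteq> 0 \<and> coeff p i = h a / h b" for i
    using pCons.prems[of "Suc i"] by simp
  then obtain d q where dq: "h d \<noteq> 0" "map_poly h q = smult (h d) p"
    using pCons.IH by blast
  obtain a b where ab: "h b \<noteq> 0" "c = h a / h b"
    using pCons.prems[of 0] by auto
  have "map_poly h (pCons (a * d) (smult b q)) = smult (h (b * d)) (pCons c p)"
  proof (rule poly_eqI)
    fix n
    have q: "h (coeff q i) = h d * coeff p i" for i
      using arg_cong[OF dq(2), of "\<lambda>r. coeff r i"] by (simp add: coeff_map_poly hs)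
    show "coeff (map_poly h (pCons (a * d) (smult b q))) n = coeff (smult (h (b * d)) (pCons c p)) n"
      using ab by (cases n) (simp_all add: coeff_map_poly hs q)
  qed
  then show ?case
    using dq(1) ab(1) by (intro exI[of _ "b * d"] exI[of _ "pCons (a * d) (smult b q)"]) (simp add: hs)
qed

subsection \<open>Transcendental elements\<close>

definition transc :: "'a::field set \<Rightarrow> 'a \<Rightarrow> bool" where
  "transc k b \<longleftrightarrow> (\<forall>p. (\<forall>i. coeff p i \<in> k) \<longrightarrow> poly p b = 0 \<longrightarrow> p = 0)"

lemma transc_double:
  fixes b :: "'a::field_char_0"
  assumes "transc k b" "is_subfield k"
  shows "transc k (2 * b)"
  unfolding transc_def
proof (intro allI impI)
  fix p assume p: "\<forall>i. coeff p i \<in> k" "poly p (2 * b) = 0"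
  define q where "q = pcompose p [:0, 2:]"
  have q: "coeff q i = 2 ^ i * coeff p i" for i
  proof -
    have "coeff (pcompose p [:0, 2:]) i = 2 ^ i * coeff p i" for p :: "'a poly"
      by (induction p arbitrary: i) (auto simp: pcompose_pCons coeff_pCons split: nat.splits)
    then show ?thesis by (simp add: q_def)
  qed
  have "coeff q i \<in> k" for i
    unfolding q using p(1) by (intro subfield_ops(6,9,10)[OF assms(2)]) auto
  moreover have "poly q b = 0"
    using p(2) by (simp add: q_def poly_pcompose mult.commute)
  ultimately have "q = 0"
    using assms(1) by (simp add: transc_def)
  then have "coeff p i = 0" for i
    using q[of i] by simp
  then show "p = 0"
    by (simp add: poly_eq_iff)
qed

lemma transc_inverse:
  assumes "transc k b" "b \<noteq> 0" "is_subfield k"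
  shows "transc k (inverse b)"
  unfolding transc_def
proof (intro allI impI)
  fix p assume p: "\<forall>i. coeff p i \<in> k" "poly p (inverse b) = 0"
  have "poly (reflect_poly p) b = 0"
    using p(2) assms(2) poly_reflect_poly_nz[of b p] by simp
  moreover have "coeff (reflect_poly p) i \<in> k" for i
    using p(1) subfield_ops(1)[OF assms(3)] by (simp add: coeff_reflect_poly)
  ultimately have "reflect_poly p = 0"
    using assms(1)[unfolded transc_def, rule_format, of "reflect_poly p"] by blast
  then show "p = 0"
    by (simp only: reflect_poly_eq_0_iff)
qed

lemma emb1_of_int: "emb1 (of_int n) = of_int n"
  by (rule ring_map_of_int_eq[OF ring_map_emb1])

lemma emb1_in_gen_field: "emb1 r \<in> gen_field S"
proof -
  obtain a b where r: "r = of_int a / of_int b" "b > 0"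
    by (cases r) (auto simp: Fract_of_int_quotient)
  then have "r * of_int b = of_int a" by simp
  then have "emb1 r * of_int b = of_int a"
    by (metis emb1_of_int ring_map_simps(4)[OF ring_map_emb1])
  then have "emb1 r = of_int a / of_int b"
    using r(2) by (simp add: nonzero_eq_divide_eq)
  moreover have "(of_int n :: qxy) \<in> gen_field S" for n
    by (cases n rule: int_cases2) (auto intro: gen_field_of_nat gen_field_uminus)
  ultimately show ?thesis
    by (simp add: gen_field_divide)
qed

lemma transc_xq: "transc (gen_field {}) xq"
  unfolding transc_def
proof (intro allI impI)
  fix p assume p: "\<forall>i. coeff p i \<in> gen_field {}" "poly p xq = 0"
  then obtain d q where dq: "emb1 d \<noteq> 0" "map_poly emb1 q = smult (emb1 d) p"
    using common_denominator[OF ring_map_emb1, of p] gen_field_quotients[OF ring_map_emb1, of "{}"] by blast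
  then have "evc q xq = 0"
    using p(2) by (simp add: evc_def)
  then have "q = 0"
    by (simp add: evc_xq emb_poly_eq_0_iff)
  then show "p = 0"
    using dq by simp
qed

lemma transc_yq: "transc (gen_field {xq}) yq"
  unfolding transc_def
proof (intro allI impI)
  fix p assume p: "\<forall>i. coeff p i \<in> gen_field {xq}" "poly p yq = 0"
  define h where "h a = emb_poly [:a:]" for a
  have h: "ring_map h"
    unfolding h_def by (rule ring_map_compose[OF ring_map_emb_poly ring_map_const_poly])
  have "\<exists>a b. h b \<noteq> 0 \<and> s = h a / h b" if "s \<in> {xq}" for s
    using that by (intro exI[of _ "[:0, 1:]"] exI[of _ 1]) (simp add: ring_map_simps[OF h], simp add: h_def xq_def)
  then obtain d q where dq: "h d \<noteq> 0" "map_poly h q = smult (h d) p"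
    using common_denominator[OF h, of p] gen_field_quotients[OF h, of "{xq}"] p(1) by blast
  have ev: "poly (map_poly h q) yq = emb_poly q" for q
  proof (induction q)
    case (pCons c q)
    have "poly (map_poly h (pCons c q)) yq = emb_poly ([:c:] + [:0, 1:] * q)"
      using pCons.IH
      by (simp only: emb_poly_add emb_poly_mult yq_def[symmetric])
         (simp add: map_poly_pCons ring_map_simps[OF h] h_def[symmetric])
    then show ?case by simp
  qed simp
  have "emb_poly q = 0"
    unfolding ev[symmetric] dq(2) using p(2) by simp
  then show "p = 0"
    using dq by (simp add: emb_poly_eq_0_iff)
qed

text \<open>
  A power series whose constant term is transcendental over \<open>k\<close> is transcendental over the series with
  coefficients in \<open>k\<close>: divide a relation by the largest possible power of \<open>t\<close> and look at its constant term.
\<close>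

definition series_over :: "'a::field set \<Rightarrow> 'a fps set" where
  "series_over k = {f. \<forall>n. fps_nth f n \<in> k}"

lemma series_over_ops:
  assumes k: "is_subfield k"
  shows "0 \<in> series_over k" "1 \<in> series_over k" "fps_X \<in> series_over k"
    "f \<in> series_over k \<Longrightarrow> g \<in> series_over k \<Longrightarrow> f + g \<in> series_over k"
    "f \<in> series_over k \<Longrightarrow> g \<in> series_over k \<Longrightarrow> f * g \<in> series_over k"
    "f \<in> series_over k \<Longrightarrow> f ^ m \<in> series_over k"
proof -
  note ops = subfield_ops[OF k]
  show 1: "1 \<in> series_over k" and "0 \<in> series_over k" "fps_X \<in> series_over k"
    using ops by (auto simp: series_over_def fps_X_def fps_one_nth)
  show "f \<in> series_over k \<Longrightarrow> g \<in> series_over k \<Longrightarrow> f + g \<in> series_over k"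
    using ops by (auto simp: series_over_def)
  show m: "f \<in> series_over k \<Longrightarrow> g \<in> series_over k \<Longrightarrow> f * g \<in> series_over k" for f g
    unfolding series_over_def mem_Collect_eq fps_mult_nth
    by (intro allI is_subfield_sum[OF k] ops(6)) auto
  show "f \<in> series_over k \<Longrightarrow> f ^ m \<in> series_over k"
    by (induction m) (auto intro: 1 m)
qed

lemma series_transcendental:
  fixes p :: "'a::field fps poly"
  assumes b: "transc k (fps_nth b 0)" and p: "\<And>i. coeff p i \<in> series_over k" and root: "poly p b = 0"
  shows "p = 0"
proof (rule ccontr)
  assume "p \<noteq> 0"
  then have "lead_coeff p \<noteq> 0"
    by simp
  then have ex: "\<exists>n. \<exists>i. fps_nth (coeff p i) n \<noteq> 0"
    unfolding fps_eq_iff by auto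
  define n where "n = (LEAST n. \<exists>i. fps_nth (coeff p i) n \<noteq> 0)"
  have n: "\<exists>i. fps_nth (coeff p i) n \<noteq> 0"
    unfolding n_def using ex by (rule LeastI_ex)
  have least: "fps_nth (coeff p i) m = 0" if "m < n" for m i
    using not_less_Least[OF that[unfolded n_def]] by blast
  define q where "q = map_poly (fps_shift n) p"
  have cq: "coeff q i = fps_shift n (coeff p i)" for i
    by (simp add: q_def coeff_map_poly)
  have pq: "p = smult (fps_X ^ n) q"
    by (intro poly_eqI fps_ext) (auto simp: cq fps_X_power_mult_nth least)
  have "fps_X ^ n * poly q b = 0"
    using root by (subst (asm) pq) simp
  then have "poly q b = 0"
    by simp
  moreover have "fps_nth (poly q b) 0 = poly (map_poly (\<lambda>f. fps_nth f 0) q) (fps_nth b 0)"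
    by (induction q) (simp_all add: map_poly_pCons)
  ultimately have "poly (map_poly (\<lambda>f. fps_nth f 0) q) (fps_nth b 0) = 0"
    by simp
  moreover have "coeff (map_poly (\<lambda>f. fps_nth f 0) q) i \<in> k" for i
    using p by (simp add: coeff_map_poly cq series_over_def)
  ultimately have z: "map_poly (\<lambda>f. fps_nth f 0) q = 0"
    using b[unfolded transc_def, rule_format, of "map_poly (\<lambda>f. fps_nth f 0) q"] by blast
  have "fps_nth (coeff p i) n = 0" for i
    using arg_cong[OF z, of "\<lambda>r. coeff r i"] by (simp add: coeff_map_poly cq)
  then show False
    using n by blast
qed

lemma shifted_series_transcendental:
  fixes p :: "'a::field fps poly"
  assumes k: "is_subfield k" and b: "transc k (fps_nth b 0)" and p: "\<And>i. coeff p i \<in> series_over k"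
    and root: "poly p (1 + fps_X ^ m * b) = 0"
  shows "p = 0"
proof -
  note ops = series_over_ops[OF k]
  define q where "q = pcompose p [:1, fps_X ^ m:]"
  have "coeff (pcompose p [:1, fps_X ^ m:]) i \<in> series_over k" for i
    using p
  proof (induction p arbitrary: i)
    case (pCons c p)
    have c: "c \<in> series_over k"
      using pCons.prems[of 0] by simp
    have "coeff p j \<in> series_over k" for j
      using pCons.prems[of "Suc j"] by simp
    then have IH: "coeff (pcompose p [:1, fps_X ^ m:]) j \<in> series_over k" for j
      by (rule pCons.IH)
    show ?case
      using c IH by (auto simp: pcompose_pCons coeff_pCons simp del: coeff_pcompose_0 split: nat.splits intro!: ops)
  qed (simp add: ops)
  moreover have "poly q b = 0"
    using root by (simp add: q_def poly_pcompose mult.commute)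
  ultimately have "q = 0"
    by (intro series_transcendental[OF b]) (auto simp: q_def)
  moreover have "degree [:1, fps_X ^ m :: 'a fps:] > 0"
    by simp
  ultimately show ?thesis
    unfolding q_def by (rule pcompose_eq_0)
qed

text \<open>
  A relation for \<open>Z\<close> is one for \<open>Z - 1\<close>. Divide it by the largest possible power of \<open>Z - 1\<close>; as \<open>Z - 1\<close> has
  no constant term, the constant coefficient of the quotient vanishes, a contradiction.
\<close>

lemma ZF_transcendental:
  assumes "pe of_int ZF q = 0"
  shows "q = 0"
proof (rule ccontr)
  assume q: "q \<noteq> 0"
  define a where "a = fps_X\<^sup>2 * zetaF"
  have a0: "a \<noteq> 0"
    using ZF(3) unfolding a_def by auto
  define r where "r = pcompose q [:1, 1:]"
  have "r \<noteq> 0"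
    unfolding r_def using q pcompose_eq_0[of q "[:1, 1:]"] by auto
  note h = ring_map_simps[OF ring_map_pe[OF ring_map_of_int]]
  have e: "pe of_int a (pcompose q [:1, 1:]) = pe of_int (1 + a) q" for q
  proof (induction q)
    case (pCons c q)
    have "pe of_int a (pcompose (pCons c q) [:1, 1:]) = pe of_int a ([:c:] + [:1, 1:] * pcompose q [:1, 1:])"
      by (simp add: pcompose_pCons)
    also have "\<dots> = of_int c + (1 + a) * pe of_int a (pcompose q [:1, 1:])"
      unfolding h by (simp add: pe_pCons[OF ring_map_of_int] pe_0)
    finally show ?case
      unfolding pCons.IH by (simp add: pe_pCons[OF ring_map_of_int])
  qed (simp add: pe_0)
  have "pe of_int a r = 0"
    unfolding r_def e using assms ZF(1) by (simp add: a_def)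
  obtain s where s: "r = [:-0, 1:] ^ order 0 r * s" "\<not> [:-0, 1:] dvd s"
    using order_decomp[OF \<open>r \<noteq> 0\<close>, of 0] by blast
  have "pe of_int a r = a ^ order 0 r * pe of_int a s"
    by (subst s(1)) (simp add: h, simp add: pe_pCons[OF ring_map_of_int] pe_0)
  then have "pe of_int a s = 0"
    using \<open>pe of_int a r = 0\<close> a0 by simp
  moreover obtain c s' where cs: "s = pCons c s'"
    by (rule pCons_cases)
  ultimately have "fps_nth (of_int c + a * pe of_int a s') 0 = 0"
    by (simp add: pe_pCons[OF ring_map_of_int])
  then have "(of_int c :: qxy) = 0"
    by (simp add: a_def fps_of_int[symmetric])
  then have "c = 0" by simp
  then have "[:-0, 1:] dvd s"
    unfolding cs by (auto simp: dvd_def intro!: exI[of _ s'])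
  then show False
    using s(2) by simp
qed

subsection \<open>Algebraic relations of the generic point\<close>

lemma LQ_series_over: "LQ f \<in> series_over (gen_field S)"
  using emb1_in_gen_field by (simp add: series_over_def LQ_def flip: emb1_def)

lemma rF_series_over: "rF (fps_const c) \<in> series_over (gen_field {c})"
proof -
  have 1: "poly (map_poly emb_rat p) (fps_const c) = fps_const (evc p c)" for p
  proof (induction p)
    case (pCons a p)
    have "emb_rat a = fps_const (emb1 a)"
      by (simp add: emb_rat_def emb1_def)
    then show ?case
      using pCons.IH
      by (simp add: evc_def map_poly_pCons ring_map_simps[OF ring_map_emb_rat] ring_map_simps[OF ring_map_emb1])
  qed (simp add: evc_def)
  have 2: "evc p c \<in> gen_field {c}" for p
  proof (induction p)
    case (pCons a p)
    have "evc (pCons a p) c = emb1 a + c * evc p c"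
      by (simp add: evc_def map_poly_pCons ring_map_simps[OF ring_map_emb1])
    then show ?case
      using pCons.IH emb1_in_gen_field gen_field_base[of c "{c}"] by (simp add: gen_field_add gen_field_mult)
  qed (simp add: evc_def gen_field_zero)
  have "fps_nth (rF (fps_const c)) n \<in> gen_field {c}" for n
    unfolding rF_def subst_xy_y0 ev1_def 1 fps_nth_Abs_fps
    by (intro is_subfield_sum[OF is_subfield_gen_field]) (auto intro: 2 gen_field_zero)
  then show ?thesis
    by (simp add: series_over_def)
qed

text \<open>
  The coordinate \<open>m\<close> of the generic point as a power series \<open>1 + t\<^sup>5 r\<close>. The constant term of \<open>r\<close> is
  \<open>2 c\<close>, which makes \<open>m\<close> transcendental if \<open>c\<close> is.
\<close>

definition rN :: "qxy \<Rightarrow> qxy fps" where "rN c = rF (fps_const c) * LQ (inverse ZQ)"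
definition NF :: "qxy \<Rightarrow> qxy fps" where "NF c = 1 + fps_X ^ 5 * rN c"

lemma ZF_inverse: "ZF * LQ (inverse ZQ) = 1"
proof -
  have "fps_nth ZQ 0 \<noteq> 0"
    by (simp add: ZQ_def const_simps)
  then have "ZQ * inverse ZQ = 1"
    by (rule inverse_mult_eq_1')
  then show ?thesis
    unfolding ZF_def by (metis ring_map_simps(2,4)[OF ring_map_LQ])
qed

lemma mm_NF: "mm (fps_const c) = fps_to_fls (NF c)"
proof -
  have "ZF * NF c = UF (fps_const c)"
    unfolding NF_def rN_def UF_def using ZF_inverse by algebra
  then have "zz * fps_to_fls (NF c) = fps_to_fls (UF (fps_const c))"
    unfolding zz_def by (metis fls_times_fps_to_fls)
  then show ?thesis
    unfolding mm_def using zz_nonzero by (simp add: nonzero_divide_eq_eq mult.commute)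
qed

lemma rF_nth_0: "fps_nth (rF (fps_const c)) 0 = 2 * c"
proof -
  have "32 * fps_nth (rF (fps_const c)) 0 = 32 * (2 * c)"
    using arg_cong[OF rF_eq[of "fps_const c"], of "\<lambda>f. fps_nth f 0"]
    by (simp add: const_simps ZF UF_def mult_ac)
  then show ?thesis by simp
qed

lemma rN_facts: "rN c \<in> series_over (gen_field {c})" "fps_nth (rN c) 0 = 2 * c"
proof -
  show "rN c \<in> series_over (gen_field {c})"
    unfolding rN_def by (intro series_over_ops(5)[OF is_subfield_gen_field] rF_series_over LQ_series_over)
  have "fps_nth ZF 0 * fps_nth (LQ (inverse ZQ)) 0 = 1"
    using arg_cong[OF ZF_inverse, of "\<lambda>f. fps_nth f 0"] by simp
  then show "fps_nth (rN c) 0 = 2 * c"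
    by (simp add: rN_def rF_nth_0 ZF)
qed

lemma NF_series_over: "NF c \<in> series_over (gen_field {c})"
  unfolding NF_def by (intro series_over_ops[OF is_subfield_gen_field] rN_facts)

definition evz :: "'b::comm_ring_1 \<Rightarrow> int poly \<Rightarrow> 'b" where "evz z = pe of_int z"
definition evt :: "'b::comm_ring_1 \<Rightarrow> 'b \<Rightarrow> int poly poly \<Rightarrow> 'b" where "evt t z = pe (evz z) t"
definition evm :: "'b::comm_ring_1 \<Rightarrow> 'b \<Rightarrow> 'b \<Rightarrow> int poly poly poly \<Rightarrow> 'b" where "evm t z m = pe (evt t z) m"
definition evn :: "'b::comm_ring_1 \<Rightarrow> 'b \<Rightarrow> 'b \<Rightarrow> 'b \<Rightarrow> int poly poly poly poly \<Rightarrow> 'b" where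
  "evn t z m n = pe (evm t z m) n"

lemma ring_map_ev: "ring_map (evz z)" "ring_map (evt t z)" "ring_map (evm t z m)" "ring_map (evn t z m n)"
proof -
  show 1: "ring_map (evz z)"
    unfolding evz_def by (rule ring_map_pe[OF ring_map_of_int])
  show 2: "ring_map (evt t z)"
    unfolding evt_def by (rule ring_map_pe[OF 1])
  show 3: "ring_map (evm t z m)"
    unfolding evm_def by (rule ring_map_pe[OF 2])
  show "ring_map (evn t z m n)"
    unfolding evn_def by (rule ring_map_pe[OF 3])
qed

lemma ev_map:
  assumes "ring_map g"
  shows "g (evn t z m n G) = evn (g t) (g z) (g m) (g n) G"
  unfolding evn_def evm_def evt_def evz_def
  by (simp only: pe_compose[OF assms] ring_map_pe ring_map_of_int ring_map_of_int_eq[OF assms])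

text \<open>
  On the curve that relates \<open>t\<close> and \<open>z\<close>, a polynomial in \<open>t\<close> and \<open>z\<close> becomes \<open>A(z) + t E(z)\<close> after
  multiplication by a power of \<open>256 z\<^sup>6\<close>. The pair \<open>A, E\<close> serves for two rings at once.
\<close>

definition on_curve :: "'a::comm_ring_1 \<Rightarrow> 'a \<Rightarrow> bool" where
  "on_curve t z \<longleftrightarrow> (z\<^sup>2 - 1) * (z\<^sup>2 + 3)^3 = 256 * t\<^sup>2 * z^6"

definition Wp :: "int poly" where "Wp = [:256:] * [:0, 1:] ^ 6"
definition Pp :: "int poly" where "Pp = ([:0, 1:]\<^sup>2 - 1) * ([:0, 1:]\<^sup>2 + [:3:]) ^ 3"

lemma evz_Wp_Pp: "evz z Wp = 256 * z ^ 6" "evz z Pp = (z\<^sup>2 - 1) * (z\<^sup>2 + 3) ^ 3"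
proof -
  have [simp]: "evz z [:0, 1:] = z" "evz z [:c:] = of_int c" for c
    by (simp_all add: evz_def pe_pCons[OF ring_map_of_int] pe_0)
  show "evz z Wp = 256 * z ^ 6" "evz z Pp = (z\<^sup>2 - 1) * (z\<^sup>2 + 3) ^ 3"
    by (simp_all only: Wp_def Pp_def ring_map_simps[OF ring_map_ev(1)]) simp_all
qed

lemma curve_reduction:
  "\<exists>N A E. (\<forall>t z :: 'a::comm_ring_1. on_curve t z \<longrightarrow> (256 * z^6) ^ N * evt t z g = evz z A + t * evz z E) \<and>
     (\<forall>t z :: 'b::comm_ring_1. on_curve t z \<longrightarrow> (256 * z^6) ^ N * evt t z g = evz z A + t * evz z E)"
proof (induction g)
  case 0
  then show ?case
    by (intro exI[of _ 0] exI[of _ "0::int poly"]) (simp add: ring_map_simps[OF ring_map_ev(1)] ring_map_simps[OF ring_map_ev(2)])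
next
  case (pCons q g)
  then obtain N A E where
    a: "\<And>t z :: 'a. on_curve t z \<Longrightarrow> (256 * z^6) ^ N * evt t z g = evz z A + t * evz z E" and
    b: "\<And>t z :: 'b. on_curve t z \<Longrightarrow> (256 * z^6) ^ N * evt t z g = evz z A + t * evz z E"
    by blast
  define A' where "A' = Wp ^ Suc N * q + Pp * E"
  define E' where "E' = Wp * A"
  have step: "(256 * z^6) ^ Suc N * evt t z (pCons q g) = evz z A' + t * evz z E'"
    if "on_curve t z" "(256 * z^6) ^ N * evt t z g = evz z A + t * evz z E" for t z :: "'c::comm_ring_1"
  proof -
    have e: "evt t z (pCons q g) = evz z q + t * evt t z g"
      unfolding evt_def by (rule pe_pCons[OF ring_map_ev(1)])
    have "(256 * z^6) ^ Suc N * evt t z (pCons q g) =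
        (256 * z^6) ^ Suc N * evz z q + (256 * z^6) * t * ((256 * z^6) ^ N * evt t z g)"
      unfolding e by (simp add: algebra_simps)
    also have "\<dots> = (256 * z^6) ^ Suc N * evz z q + (256 * t\<^sup>2 * z^6) * evz z E + t * ((256 * z^6) * evz z A)"
      unfolding that(2) by (simp add: algebra_simps power2_eq_square)
    also have "\<dots> = evz z A' + t * evz z E'"
      using that(1) unfolding A'_def E'_def ring_map_simps[OF ring_map_ev(1)] evz_Wp_Pp on_curve_def by simp
    finally show ?thesis .
  qed
  show ?case
    using step[OF _ a] step[OF _ b] by blast
qed

text \<open>
  The simple root 1 of \<open>Pp\<close> makes the orders at 1 of the two sides differ in parity.
\<close>

lemma Pp_square_nonzero:
  assumes "Wp * A\<^sup>2 = Pp * E\<^sup>2"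
  shows "A = 0 \<and> E = 0"
proof (cases "E = 0")
  case True
  then have "Wp * A\<^sup>2 = 0"
    using assms by simp
  moreover have "Wp \<noteq> 0"
    by (simp add: Wp_def)
  ultimately show ?thesis
    using True by simp
next
  case False
  define R where "R = [:1, 1:] * ([:0, 1:]\<^sup>2 + [:3:]) ^ 3 * (1 :: int poly)"
  have P: "Pp = [:-1, 1:] * R"
    unfolding Pp_def R_def by (simp add: algebra_simps power2_eq_square one_pCons)
  have R1: "poly R 1 \<noteq> 0" and W1: "poly Wp 1 \<noteq> 0"
    by (simp_all add: R_def Wp_def)
  then have nz: "R \<noteq> 0" "Wp \<noteq> 0" by auto
  have "order 1 (Pp * E\<^sup>2) = 1 + (order 1 E + order 1 E)"
    unfolding P power2_eq_square using nz False R1 order_power_n_n[of "1::int" 1]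
    by (simp add: order_mult order_0I del: mult_pCons_left mult_pCons_right)
  moreover have "Pp \<noteq> 0"
    unfolding P using nz(1) by (metis mult_eq_0_iff one_neq_zero pCons_eq_0_iff)
  then have A: "A \<noteq> 0"
    using assms False by auto
  then have "order 1 (Wp * A\<^sup>2) = order 1 A + order 1 A"
    unfolding power2_eq_square using nz W1 by (simp add: order_mult order_0I)
  ultimately have "1 + (order 1 E + order 1 E) = order 1 A + order 1 A"
    using assms by simp
  then have False
    by presburger
  then show ?thesis ..
qed

text \<open>
  A relation \<open>A(Z) + t E(Z) = 0\<close> becomes, after squaring and elimination of \<open>t\<^sup>2\<close>, a relation for \<open>Z\<close>
  alone, hence a polynomial identity.
\<close>

lemma curve_relations:
  fixes t z :: "'b::idom"
  assumes g: "evt fps_X ZF g = 0" and c: "on_curve t z" "256 * z ^ 6 \<noteq> 0"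
  shows "evt t z g = 0"
proof -
  obtain N A E where
    1: "\<And>t z :: qxy fps. on_curve t z \<Longrightarrow> (256 * z^6) ^ N * evt t z g = evz z A + t * evz z E" and
    2: "\<And>t z :: 'b. on_curve t z \<Longrightarrow> (256 * z^6) ^ N * evt t z g = evz z A + t * evz z E"
    using curve_reduction[of g] by blast
  have cF: "on_curve fps_X ZF"
    unfolding on_curve_def by (rule ZF(2))
  have "evz ZF A + fps_X * evz ZF E = 0"
    using 1[OF cF] g by simp
  then have AB: "evz ZF A = - (fps_X * evz ZF E)"
    by (simp add: eq_neg_iff_add_eq_0)
  have "evz ZF (Wp * A\<^sup>2 - Pp * E\<^sup>2) = 256 * ZF^6 * (fps_X * evz ZF E)\<^sup>2 - (ZF\<^sup>2 - 1) * (ZF\<^sup>2 + 3) ^ 3 * (evz ZF E)\<^sup>2"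
    unfolding ring_map_simps[OF ring_map_ev(1)] evz_Wp_Pp AB by simp
  also have "\<dots> = 0"
    unfolding ZF(2) by algebra
  finally have "Wp * A\<^sup>2 - Pp * E\<^sup>2 = 0"
    unfolding evz_def by (rule ZF_transcendental)
  then have "A = 0" "E = 0"
    using Pp_square_nonzero[of A E] by auto
  then show ?thesis
    using 2[OF c(1)] c(2) by (simp add: ring_map_simps[OF ring_map_ev(1)])
qed

lemma evt_series_over: "evt fps_X ZF g \<in> series_over (gen_field {})"
proof -
  note ops = series_over_ops[OF is_subfield_gen_field]
  have i: "(of_int n :: qxy fps) \<in> series_over (gen_field {})" for n
    using emb1_in_gen_field[of "of_int n" "{}"] gen_field_zero unfolding emb1_of_int
    by (auto simp: series_over_def fps_of_int[symmetric])
  have Z: "ZF \<in> series_over (gen_field {})"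
    unfolding ZF_def by (rule LQ_series_over)
  have z: "evz ZF q \<in> series_over (gen_field {})" for q
    unfolding evz_def
    by (induction q) (auto simp: pe_0 pe_pCons[OF ring_map_of_int] intro!: ops(1,4,5) i Z)
  show ?thesis
    unfolding evt_def
    by (induction g) (auto simp: pe_0 pe_pCons[OF ring_map_ev(1)] intro!: ops(1,3,4,5) z)
qed

text \<open>
  The pair is algebraically independent over \<open>\<rat>\<close>.
\<close>

definition independent_pair :: "qxy \<Rightarrow> qxy \<Rightarrow> bool" where
  "independent_pair a b \<longleftrightarrow> a \<noteq> 0 \<and> b \<noteq> 0 \<and> transc (gen_field {}) a \<and> transc (gen_field {a}) b"

text \<open>
  A relation between the coordinates of the generic point is a polynomial in \<open>n\<close> whose coefficients are
  polynomials in \<open>m\<close>, all of whose coefficients vanish on the curve of \<open>t\<close> and \<open>z\<close>: the successive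
  coordinates \<open>m\<close> and \<open>n\<close> are transcendental over the series in the preceding ones. So it holds at every
  point of that curve, whatever the other two coordinates are.
\<close>

lemma generic_relations:
  fixes t z m n :: "'b::idom"
  assumes ab: "independent_pair a b" and c: "on_curve t z" "256 * z ^ 6 \<noteq> 0"
    and G: "evn fps_X ZF (NF a) (NF b) G = 0"
  shows "evn t z m n G = 0"
proof -
  have sub: "gen_field {} \<subseteq> gen_field {a}"
    by (rule gen_field_subset[OF is_subfield_gen_field]) auto
  have evm_over: "evm fps_X ZF (NF a) H \<in> series_over (gen_field {a})" for H
  proof -
    note ops = series_over_ops[OF is_subfield_gen_field]
    have "evt fps_X ZF g \<in> series_over (gen_field {a})" for g
      using evt_series_over[of g] sub by (auto simp: series_over_def)
    then show ?thesis
      unfolding evm_def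
      by (induction H) (auto simp: pe_0 pe_pCons[OF ring_map_ev(2)] intro!: ops(1,4,5) NF_series_over)
  qed
  have tb: "transc (gen_field {a}) (fps_nth (rN b) 0)" and ta: "transc (gen_field {}) (fps_nth (rN a) 0)"
    unfolding rN_facts using ab by (auto simp: independent_pair_def intro!: transc_double is_subfield_gen_field)
  have "poly (map_poly (evm fps_X ZF (NF a)) G) (1 + fps_X ^ 5 * rN b) = 0"
    using G unfolding evn_def pe_def NF_def[of b] .
  then have "map_poly (evm fps_X ZF (NF a)) G = 0"
    by (intro shifted_series_transcendental[OF is_subfield_gen_field tb])
       (simp_all add: coeff_map_poly ring_map_simps[OF ring_map_ev(3)] evm_over)
  then have 1: "evm fps_X ZF (NF a) (coeff G j) = 0" for j
    by (metis coeff_0 coeff_map_poly ring_map_simps(1)[OF ring_map_ev(3)])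
  have "poly (map_poly (evt fps_X ZF) (coeff G j)) (1 + fps_X ^ 5 * rN a) = 0" for j
    using 1[of j] unfolding evm_def pe_def NF_def[of a] .
  then have "map_poly (evt fps_X ZF) (coeff G j) = 0" for j
    by (intro shifted_series_transcendental[OF is_subfield_gen_field ta])
       (simp_all add: coeff_map_poly ring_map_simps[OF ring_map_ev(2)] evt_series_over)
  then have "evt fps_X ZF (coeff (coeff G j) i) = 0" for i j
    by (metis coeff_0 coeff_map_poly ring_map_simps(1)[OF ring_map_ev(2)])
  then have "evt t z (coeff (coeff G j) i) = 0" for i j
    by (rule curve_relations[OF _ c])
  then have "map_poly (evt t z) (coeff G j) = 0" for j
    by (intro poly_eqI) (simp add: coeff_map_poly ring_map_simps[OF ring_map_ev(2)])
  then have "evm t z m (coeff G j) = 0" for j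
    by (simp add: evm_def pe_def)
  then have "map_poly (evm t z m) G = 0"
    by (intro poly_eqI) (simp add: coeff_map_poly ring_map_simps[OF ring_map_ev(3)])
  then show ?thesis
    by (simp add: evn_def pe_def)
qed

lemma independent_pairs:
  "independent_pair xq yq" "independent_pair (inverse xq) yq" "independent_pair xq (inverse yq)"
proof -
  note k = is_subfield_gen_field
  have eq: "gen_field {inverse xq} = gen_field {xq}"
  proof
    show "gen_field {inverse xq} \<subseteq> gen_field {xq}"
      by (rule gen_field_subset[OF k]) (auto intro: gen_field_inverse gen_field_base)
    have "inverse (inverse xq) \<in> gen_field {inverse xq}"
      by (intro gen_field_inverse gen_field_base) simp
    then show "gen_field {xq} \<subseteq> gen_field {inverse xq}"
      by (intro gen_field_subset[OF k]) simp
  qed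
  show "independent_pair xq yq" "independent_pair (inverse xq) yq" "independent_pair xq (inverse yq)"
    unfolding independent_pair_def eq
    using xq_nonzero variables(5) transc_xq transc_yq transc_inverse[OF transc_xq xq_nonzero k]
      transc_inverse[OF transc_yq variables(5) k] by auto
qed

section \<open>Specialization to a finite field\<close>

text \<open>
  The field with 1009 elements. Modulo this prime, 72 smooth rational points lie over the base point \<open>t = 622\<close>
  with both abscissas equal to 768, and each of the series takes distinct values at its conjugate points.
\<close>

typedef fp = "{0..<1009::int}"
  by (rule exI[of _ 0]) simp

setup_lifting type_definition_fp

instantiation fp :: comm_ring_1
begin
lift_definition zero_fp :: fp is 0 by simp
lift_definition one_fp :: fp is 1 by simp
lift_definition plus_fp :: "fp \<Rightarrow> fp \<Rightarrow> fp" is "\<lambda>a b. (a + b) mod 1009" by simp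
lift_definition minus_fp :: "fp \<Rightarrow> fp \<Rightarrow> fp" is "\<lambda>a b. (a - b) mod 1009" by simp
lift_definition times_fp :: "fp \<Rightarrow> fp \<Rightarrow> fp" is "\<lambda>a b. (a * b) mod 1009" by simp
lift_definition uminus_fp :: "fp \<Rightarrow> fp" is "\<lambda>a. (- a) mod 1009" by simp
instance
proof
  fix a b c :: fp
  show "a * b * c = a * (b * c)" "a * b = b * a" "1 * a = a" "(a + b) * c = a * c + b * c"
    "a + b + c = a + (b + c)" "a + b = b + a" "0 + a = a" "- a + a = 0" "a - b = a + - b"
    by (transfer; simp add: mod_simps algebra_simps)+
  show "(0::fp) \<noteq> 1"
    by transfer simp
qed
end

lemma Rep_fp_of_int: "Rep_fp (of_int n) = n mod 1009"
proof -
  have nat: "Rep_fp (of_nat k) = int k mod 1009" for k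
    by (induction k) (simp_all add: zero_fp.rep_eq one_fp.rep_eq plus_fp.rep_eq mod_simps add.commute)
  show ?thesis
    by (cases n rule: int_cases2) (simp_all add: nat uminus_fp.rep_eq mod_simps)
qed

lemma of_int_fp_eq_iff: "(of_int a :: fp) = of_int b \<longleftrightarrow> a mod 1009 = b mod 1009"
  by (metis Rep_fp_inject Rep_fp_of_int)

lemma fp_of_int_cases: obtains n where "(a :: fp) = of_int n"
proof
  show "a = of_int (Rep_fp a)"
    using Rep_fp[of a] by (simp add: Rep_fp_of_int flip: Rep_fp_inject)
qed

lemma divisor_1009: "k dvd 1009 \<Longrightarrow> k = 1 \<or> k = (1009::nat)"
proof (rule ccontr)
  assume k: "k dvd 1009" "\<not> (k = 1 \<or> k = 1009)"
  from k(1) obtain l where l: "1009 = k * l" by (elim dvdE)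
  have *: "\<forall>i\<in>set [2..<32::nat]. 1009 mod i \<noteq> 0"
    by (simp add: upt_rec)
  have "k \<noteq> 0" "l \<noteq> 0"
    using l by (metis mult_zero_left mult_zero_right zero_neq_numeral)+
  moreover have "l \<noteq> 1"
    using k l by auto
  ultimately have kl: "2 \<le> k" "2 \<le> l" using k(2) by auto
  have "k \<le> 31 \<or> l \<le> 31"
  proof (rule ccontr)
    assume "\<not> ?thesis"
    then have "32 * 32 \<le> k * l" by (intro mult_le_mono) auto
    then show False using l by linarith
  qed
  then have "k \<in> set [2..<32] \<or> l \<in> set [2..<32]"
    using kl unfolding set_upt atLeastLessThan_iff by linarith
  moreover have "1009 mod k = 0" "1009 mod l = 0" by (simp_all add: l)
  ultimately show False using *[rule_format, of k] *[rule_format, of l] by metis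
qed
lemma prime_1009: "prime (1009::int)"
proof -
  have "prime (1009::nat)"
    unfolding prime_nat_iff using divisor_1009 by (intro conjI allI impI) (simp, blast)
  then have "prime (int 1009)" by (rule prime_nat_int_transfer[THEN iffD2])
  then show ?thesis unfolding of_nat_numeral .
qed
lemma fp_inverse_exists:
  fixes a :: fp
  assumes "a \<noteq> 0"
  shows "\<exists>b. b * a = 1"
proof -
  obtain n where n: "a = of_int n"
    by (rule fp_of_int_cases)
  then have "\<not> 1009 dvd n"
    using assms of_int_fp_eq_iff[of n 0] by (auto simp: dvd_eq_mod_eq_0)
  then have "coprime 1009 n"
    using prime_1009 by (rule prime_imp_coprime[rotated])
  then obtain u v where "u * 1009 + v * n = 1"
    using bezout_int[of 1009 n] by (auto simp: coprime_iff_gcd_eq_1)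
  then have "(v * n) mod 1009 = 1 mod 1009"
    by (metis mod_mult_self3)
  then have "(of_int (v * n) :: fp) = of_int 1"
    unfolding of_int_fp_eq_iff .
  then show ?thesis
    using n by (intro exI[of _ "of_int v"]) simp
qed

instantiation fp :: field
begin
definition inverse_fp :: "fp \<Rightarrow> fp" where "inverse_fp a = (if a = 0 then 0 else SOME b. b * a = 1)"
definition divide_fp :: "fp \<Rightarrow> fp \<Rightarrow> fp" where "divide_fp a b = a * inverse b"
instance
proof
  fix a b :: fp
  show "inverse a * a = 1" if "a \<noteq> 0"
    using someI_ex[OF fp_inverse_exists[OF that]] that by (simp add: inverse_fp_def)
qed (simp_all add: inverse_fp_def divide_fp_def)
end

subsection \<open>Special points\<close>

text \<open>
  A point over the power series ring of the finite field. Its coordinates \<open>x\<close>, \<open>y\<close> are the abscissas, which for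
  the generic point are \<open>a/t\<close> and \<open>b/t\<close>. The conditions on \<open>z\<close> and \<open>ck\<close> concern constant terms, so that the
  abscissas are functions of \<open>z\<close>, \<open>m\<close>, \<open>n\<close> without poles there.
\<close>

locale special_point =
  fixes a b :: qxy and t x y z m n :: "fp fps"
  assumes independent: "independent_pair a b"
    and curve: "on_curve t z" and z0: "fps_nth z 0 \<noteq> 0"
    and abscissa_m: "16 * z^3 * (1 - m\<^sup>2) = x * ck z m" and cm: "fps_nth (ck z m) 0 \<noteq> 0"
    and abscissa_n: "16 * z^3 * (1 - n\<^sup>2) = y * ck z n" and cn: "fps_nth (ck z n) 0 \<noteq> 0"
begin

definition gen :: "int poly poly poly poly \<Rightarrow> qxy fls" where
  "gen = evn tt zz (mm (fps_const a)) (mm (fps_const b))"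
definition sp :: "int poly poly poly poly \<Rightarrow> fp fls" where
  "sp = evn (fps_to_fls t) (fps_to_fls z) (fps_to_fls m) (fps_to_fls n)"

lemma gen_0: "gen G = 0 \<Longrightarrow> sp G = 0"
proof -
  assume G: "gen G = 0"
  have "gen G = fps_to_fls (evn fps_X ZF (NF a) (NF b) G)"
    unfolding gen_def mm_NF tt_def zz_def by (rule ev_map[OF ring_map_fps_to_fls, symmetric])
  then have "evn fps_X ZF (NF a) (NF b) G = 0"
    using G by simp
  moreover have "fps_nth (256 * z ^ 6) 0 \<noteq> 0"
  proof -
    have "(of_int 256 :: fp) \<noteq> of_int 0"
      unfolding of_int_fp_eq_iff by simp
    then have "(256 :: fp) \<noteq> 0" by simp
    then show ?thesis
      using z0 by (simp add: const_simps)
  qed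
  then have "256 * z ^ 6 \<noteq> 0"
    by (metis fps_zero_nth)
  ultimately have "evn t z m n G = 0"
    by (intro generic_relations[OF independent curve])
  then show "sp G = 0"
    unfolding sp_def ev_map[OF ring_map_fps_to_fls, symmetric] by simp
qed

text \<open>
  The partial map from the function field of the generic point to the Laurent series over the finite
  field, as a relation: both elements are given by the same quotient of polynomials, and the
  denominator does not vanish at the special point.
\<close>

definition spec :: "qxy fls \<Rightarrow> fp fls \<Rightarrow> bool" where
  "spec u v \<longleftrightarrow> (\<exists>G H. sp H \<noteq> 0 \<and> u * gen H = gen G \<and> v * sp H = sp G)"

lemma gen_ring: "ring_map gen" and sp_ring: "ring_map sp"
  unfolding gen_def sp_def by (rule ring_map_ev)+

lemmas gs = ring_map_simps[OF gen_ring] ring_map_simps[OF sp_ring]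

lemma spec_poly: "spec (gen G) (sp G)"
  unfolding spec_def by (intro exI[of _ G] exI[of _ 1]) (simp add: gs)

text \<open>
  The specialization is well defined because all relations of the generic point persist. Differences reduce
  this to the value 0.
\<close>

lemma spec_0: "spec 0 v \<Longrightarrow> v = 0"
  unfolding spec_def using gen_0 by (metis mult_eq_0_iff)

lemma spec_add: "spec u v \<Longrightarrow> spec u' v' \<Longrightarrow> spec (u + u') (v + v')"
  and spec_diff: "spec u v \<Longrightarrow> spec u' v' \<Longrightarrow> spec (u - u') (v - v')"
  and spec_mult: "spec u v \<Longrightarrow> spec u' v' \<Longrightarrow> spec (u * u') (v * v')"
  and spec_divide: "spec u v \<Longrightarrow> spec u' v' \<Longrightarrow> v' \<noteq> 0 \<Longrightarrow> spec (u / u') (v / v')"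
proof -
  assume "spec u v" "spec u' v'"
  then obtain G H G' H' where *: "sp H \<noteq> 0" "u * gen H = gen G" "v * sp H = sp G"
    "sp H' \<noteq> 0" "u' * gen H' = gen G'" "v' * sp H' = sp G'"
    unfolding spec_def by blast
  have H: "sp (H * H') \<noteq> 0"
    using * by (simp add: gs)
  show "spec (u + u') (v + v')"
    unfolding spec_def
    by (rule exI[of _ "G * H' + G' * H"], rule exI[of _ "H * H'"], intro conjI H)
       (simp_all add: gs *(2,3,5,6)[symmetric] algebra_simps)
  show "spec (u - u') (v - v')"
    unfolding spec_def
    by (rule exI[of _ "G * H' - G' * H"], rule exI[of _ "H * H'"], intro conjI H)
       (simp_all add: gs *(2,3,5,6)[symmetric] algebra_simps)
  show "spec (u * u') (v * v')"
    unfolding spec_def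
    by (rule exI[of _ "G * G'"], rule exI[of _ "H * H'"], intro conjI H)
       (simp_all add: gs *(2,3,5,6)[symmetric] algebra_simps)
  show "spec (u / u') (v / v')" if "v' \<noteq> 0"
  proof -
    have "sp G' \<noteq> 0"
      using that *(4,6) by auto
    then have nz: "sp (H * G') \<noteq> 0"
      using *(1) by (simp add: gs)
    have "gen G' \<noteq> 0"
      using gen_0 \<open>sp G' \<noteq> 0\<close> by blast
    then have "u' \<noteq> 0"
      using *(5) by auto
    then show ?thesis
      unfolding spec_def using that
      by (intro exI[of _ "G * H'"] exI[of _ "H * G'"] conjI nz)
         (simp_all add: gs *(2,3,5,6)[symmetric] field_simps)
  qed
qed

lemma spec_of_int: "spec (of_int k) (of_int k)"
  using spec_poly[of "of_int k"] by (simp add: ring_map_of_int_eq[OF gen_ring] ring_map_of_int_eq[OF sp_ring])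

lemma spec_coordinates: "spec tt (fps_to_fls t)" "spec zz (fps_to_fls z)"
  "spec (mm (fps_const a)) (fps_to_fls m)" "spec (mm (fps_const b)) (fps_to_fls n)"
proof -
  note e = pe_pCons[OF ring_map_of_int] pe_pCons[OF ring_map_ev(1)] pe_pCons[OF ring_map_ev(2)] pe_pCons[OF ring_map_ev(3)] pe_0
  have z1: "evz z [:0, 1:] = z" "evz z 1 = 1" "evz z 0 = 0" for z :: "'b::comm_ring_1"
    by (simp_all add: ring_map_simps[OF ring_map_ev(1)]) (simp add: evz_def e)
  have t1: "evt t z [:0, 1:] = t" "evt t z [:q:] = evz z q" "evt t z 1 = 1" "evt t z 0 = 0" for t z :: "'b::comm_ring_1" and q
    by (simp_all add: ring_map_simps[OF ring_map_ev(2)]) (simp_all add: evt_def e z1)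
  have m1: "evm t z m [:0, 1:] = m" "evm t z m [:q:] = evt t z q" "evm t z m 1 = 1" "evm t z m 0 = 0" for t z m :: "'b::comm_ring_1" and q
    by (simp_all add: ring_map_simps[OF ring_map_ev(3)]) (simp_all add: evm_def e t1)
  have n1: "evn t z m n [:0, 1:] = n" "evn t z m n [:q:] = evm t z m q" for t z m n :: "'b::comm_ring_1" and q
    by (simp_all add: evn_def e m1)
  show "spec tt (fps_to_fls t)"
    using spec_poly[of "[:[:[:0, 1:]:]:]"] by (simp add: gen_def sp_def n1 m1 t1)
  show "spec zz (fps_to_fls z)"
    using spec_poly[of "[:[:[:[:0, 1:]:]:]:]"] by (simp add: gen_def sp_def n1 m1 t1 z1)
  show "spec (mm (fps_const a)) (fps_to_fls m)"
    using spec_poly[of "[:[:0, 1:]:]"] by (simp add: gen_def sp_def n1 m1)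
  show "spec (mm (fps_const b)) (fps_to_fls n)"
    using spec_poly[of "[:0, 1:]"] by (simp add: gen_def sp_def n1)
qed

lemma spec_power: "spec u v \<Longrightarrow> spec (u ^ k) (v ^ k)"
  using spec_of_int[of 1] by (induction k) (auto intro: spec_mult)

lemma spec_numeral: "spec 1 1" "spec (numeral k) (numeral k)"
  using spec_of_int[of 1] spec_of_int[of "numeral k"] by simp_all

text \<open>
  The abscissas are not among the coordinates, but they are the same rational functions of \<open>z\<close>, \<open>m\<close>, \<open>n\<close> at
  both points.
\<close>

lemma spec_abscissa:
  "spec (fps_to_fls (fps_const a) / tt) (fps_to_fls x)" "spec (fps_to_fls (fps_const b) / tt) (fps_to_fls y)"
proof -
  have *: "spec (fps_to_fls X / tt) (fps_to_fls x)"
    if s: "spec (mm X) (fps_to_fls m)" and e: "16 * z^3 * (1 - m\<^sup>2) = x * ck z m" and c: "fps_nth (ck z m) 0 \<noteq> 0"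
    for X m x
  proof -
    have ck: "ck (fps_to_fls z) (fps_to_fls m) = fps_to_fls (ck z m)"
      by (simp only: ck_def h1_def h2_def h3_def fls_hom)
    have nz: "ck (fps_to_fls z) (fps_to_fls m) \<noteq> 0"
      unfolding ck by (rule fls_unit[OF c])
    have "16 * (fps_to_fls z)^3 * (1 - (fps_to_fls m)\<^sup>2) = fps_to_fls x * ck (fps_to_fls z) (fps_to_fls m)"
      unfolding ck using arg_cong[OF e, of fps_to_fls] by (simp only: fls_hom)
    then have "fps_to_fls x = 16 * (fps_to_fls z)^3 * (1 - (fps_to_fls m)\<^sup>2) / ck (fps_to_fls z) (fps_to_fls m)"
      using nz by (simp add: nonzero_eq_divide_eq)
    moreover have "spec (16 * zz^3 * (1 - (mm X)\<^sup>2) / ck zz (mm X))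
        (16 * (fps_to_fls z)^3 * (1 - (fps_to_fls m)\<^sup>2) / ck (fps_to_fls z) (fps_to_fls m))"
      using nz unfolding ck_def h1_def h2_def h3_def
      by (intro spec_divide spec_add spec_diff spec_mult spec_power spec_numeral spec_coordinates s)
    ultimately show ?thesis
      unfolding abscissa_quotient by simp
  qed
  show "spec (fps_to_fls (fps_const a) / tt) (fps_to_fls x)" "spec (fps_to_fls (fps_const b) / tt) (fps_to_fls y)"
    by (rule *[OF spec_coordinates(3) abscissa_m cm], rule *[OF spec_coordinates(4) abscissa_n cn])
qed

lemma spec_pe:
  assumes f: "ring_map f" and g: "ring_map g" and "\<And>c. spec (f c) (g c)" "spec u v"
  shows "spec (pe f u p) (pe g v p)"
  using spec_of_int[of 0]
  by (induction p) (auto simp: pe_0 pe_pCons[OF f] pe_pCons[OF g] intro!: spec_add spec_mult assms)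

text \<open>The residue at \<open>t = 0\<close> of the specialization.\<close>

definition val :: "qxy fls \<Rightarrow> fp \<Rightarrow> bool" where
  "val u r \<longleftrightarrow> (\<exists>f. spec u (fps_to_fls f) \<and> fps_nth f 0 = r)"

lemma val_add: "val u r \<Longrightarrow> val u' r' \<Longrightarrow> val (u + u') (r + r')"
  and val_diff: "val u r \<Longrightarrow> val u' r' \<Longrightarrow> val (u - u') (r - r')"
  and val_mult: "val u r \<Longrightarrow> val u' r' \<Longrightarrow> val (u * u') (r * r')"
  and val_divide: "val u r \<Longrightarrow> val u' r' \<Longrightarrow> r' \<noteq> 0 \<Longrightarrow> val (u / u') (r / r')"
proof -
  assume "val u r" "val u' r'"
  then obtain f f' where *: "spec u (fps_to_fls f)" "fps_nth f 0 = r" "spec u' (fps_to_fls f')" "fps_nth f' 0 = r'"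
    unfolding val_def by blast
  show "val (u + u') (r + r')"
    unfolding val_def using spec_add[OF *(1,3)] *(2,4) by (intro exI[of _ "f + f'"]) simp
  show "val (u - u') (r - r')"
    unfolding val_def using spec_diff[OF *(1,3)] *(2,4) by (intro exI[of _ "f - f'"]) simp
  show "val (u * u') (r * r')"
    unfolding val_def using spec_mult[OF *(1,3)] *(2,4) by (intro exI[of _ "f * f'"]) (simp add: fls_times_fps_to_fls)
  show "val (u / u') (r / r')" if "r' \<noteq> 0"
  proof -
    have "fps_nth f' 0 \<noteq> 0"
      using that *(4) by simp
    then have "f' * inverse f' = 1" and nz: "fps_to_fls f' \<noteq> 0"
      by (simp_all add: inverse_mult_eq_1' fls_unit del: fps_to_fls_eq_0_iff)
    then have "fps_to_fls f' * fps_to_fls (inverse f') = 1"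
      by (metis fls_times_fps_to_fls fps_one_to_fls)
    then have "fps_to_fls f / fps_to_fls f' = fps_to_fls (f * inverse f')"
      using nz by (simp add: fls_times_fps_to_fls nonzero_divide_eq_eq mult_ac)
    then show ?thesis
      unfolding val_def using spec_divide[OF *(1,3) nz] *(2,4)
      by (intro exI[of _ "f * inverse f'"]) (simp add: divide_inverse)
  qed
qed

lemma val_numeral: "val 1 1" "val (numeral k) (numeral k)"
proof -
  show "val 1 1"
    unfolding val_def using spec_numeral(1) by (intro exI[of _ 1]) simp
  show "val (numeral k) (numeral k)"
    unfolding val_def using spec_numeral(2) by (intro exI[of _ "numeral k"]) (simp add: fps_nth_numeral_0)
qed

lemma val_power: "val u r \<Longrightarrow> val (u ^ k) (r ^ k)"
  by (induction k) (auto intro: val_mult val_numeral)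

lemma val_coordinates: "val tt (fps_nth t 0)" "val zz (fps_nth z 0)" "val (mm (fps_const a)) (fps_nth m 0)"
  "val (mm (fps_const b)) (fps_nth n 0)" "val (fps_to_fls (fps_const a) / tt) (fps_nth x 0)"
  "val (fps_to_fls (fps_const b) / tt) (fps_nth y 0)"
  unfolding val_def using spec_coordinates spec_abscissa by blast+

end

subsection \<open>Integral polynomials modulo a prime\<close>

definition nonzero_mod :: "int \<Rightarrow> bool" where
  "nonzero_mod k \<longleftrightarrow> (of_int k :: fp) \<noteq> 0"

definition some_coeff :: "('a::zero \<Rightarrow> bool) \<Rightarrow> 'a poly \<Rightarrow> bool" where
  "some_coeff R p \<longleftrightarrow> (\<exists>i. R (coeff p i))"

text \<open>
  Division by a power of 1009 makes an element nonzero modulo 1009. The predicate \<open>R\<close> stands for the latter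
  property; it passes from a ring to its polynomial ring.
\<close>

definition content_removable :: "('a::comm_ring_1 \<Rightarrow> bool) \<Rightarrow> bool" where
  "content_removable R \<longleftrightarrow> (\<forall>q. q \<noteq> 0 \<longrightarrow> (\<exists>e q'. q = 1009 ^ e * q' \<and> R q'))"

lemma content_removable_int: "content_removable nonzero_mod"
  unfolding content_removable_def
proof (intro allI impI)
  fix q :: int assume q: "q \<noteq> 0"
  have "\<not> is_unit (1009::int)"
    by simp
  then obtain q' where q': "q = 1009 ^ multiplicity 1009 q * q'" "\<not> 1009 dvd q'"
    using q multiplicity_decompose'[of q 1009] by blast
  have "nonzero_mod q'"
    using q'(2) of_int_fp_eq_iff[of q' 0] by (simp add: nonzero_mod_def dvd_eq_mod_eq_0)
  with q'(1) show "\<exists>e q'. q = 1009 ^ e * q' \<and> nonzero_mod q'"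
    by blast
qed

lemma content_removable_poly:
  fixes R :: "'a::idom \<Rightarrow> bool"
  assumes R: "content_removable R"
  shows "content_removable (some_coeff R)"
proof -
  have num: "(1009 :: 'a poly) ^ e * p = smult (1009 ^ e) p" for e and p :: "'a poly"
    by (simp add: numeral_poly poly_const_pow)
  have "\<exists>e q'. q = smult (1009 ^ e) q' \<and> some_coeff R q'" if "q \<noteq> 0" for q
    using that
  proof (induction q)
    case (pCons c q)
    consider "q = 0" | "q \<noteq> 0" "c = 0" | "q \<noteq> 0" "c \<noteq> 0" by blast
    then show ?case
    proof cases
      case 1
      then have "c \<noteq> 0" using pCons.hyps by simp
      then obtain e c' where c: "c = 1009 ^ e * c'" "R c'"
        using R unfolding content_removable_def by blast
      then have "pCons c q = smult (1009 ^ e) [:c':]" "some_coeff R [:c':]"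
        using 1 by (auto simp: some_coeff_def intro: exI[of _ 0])
      then show ?thesis by blast
    next
      case 2
      then obtain e q' where q: "q = smult (1009 ^ e) q'" "some_coeff R q'"
        using pCons.IH by blast
      then obtain i where "R (coeff q' i)"
        by (auto simp: some_coeff_def)
      then have "pCons c q = smult (1009 ^ e) (pCons 0 q')" "some_coeff R (pCons 0 q')"
        using 2 q(1) by (auto simp: some_coeff_def intro: exI[of _ "Suc i"])
      then show ?thesis by blast
    next
      case 3
      then obtain e q' where q: "q = smult (1009 ^ e) q'" "some_coeff R q'"
        using pCons.IH by blast
      then obtain i where i: "R (coeff q' i)"
        by (auto simp: some_coeff_def)
      obtain f c' where c: "c = 1009 ^ f * c'" "R c'"
        using R 3 unfolding content_removable_def by blast
      show ?thesis
      proof (cases "e \<le> f")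
        case True
        then have "pCons c q = smult (1009 ^ e) (pCons (1009 ^ (f - e) * c') q')"
          using q(1) c(1) by (simp add: mult.assoc[symmetric] power_add[symmetric])
        moreover have "some_coeff R (pCons (1009 ^ (f - e) * c') q')"
          unfolding some_coeff_def by (rule exI[of _ "Suc i"]) (simp add: i)
        ultimately show ?thesis by blast
      next
        case False
        then have "pCons c q = smult (1009 ^ f) (pCons c' (smult (1009 ^ (e - f)) q'))"
          using q(1) c(1) by (simp add: power_add[symmetric])
        moreover have "some_coeff R (pCons c' (smult (1009 ^ (e - f)) q'))"
          unfolding some_coeff_def by (rule exI[of _ 0]) (simp add: c)
        ultimately show ?thesis by blast
      qed
    qed
  qed simp
  then show ?thesis
    unfolding content_removable_def num by blast
qed

lemma infinite_lifts: "infinite {v :: 'a::idom fps. fps_nth v 0 = c}"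
proof
  assume "finite {v :: 'a fps. fps_nth v 0 = c}"
  moreover have "range (\<lambda>i. fps_const c + fps_X ^ Suc i) \<subseteq> {v :: 'a fps. fps_nth v 0 = c}"
    by auto
  moreover have "inj (\<lambda>i. fps_const c + fps_X ^ Suc i :: 'a fps)"
  proof (rule injI)
    fix i j :: nat
    assume "fps_const c + fps_X ^ Suc i = (fps_const c + fps_X ^ Suc j :: 'a fps)"
    then have "fps_nth (fps_X ^ Suc i :: 'a fps) (Suc i) = fps_nth (fps_X ^ Suc j) (Suc i)"
      by simp
    then show "i = j"
      by (simp only: fps_X_power_nth split: if_splits) simp_all
  qed
  ultimately show False
    using finite_subset infinite_UNIV_nat finite_imageD by metis
qed

lemma nonvanishing_lift:
  fixes h :: "'a::comm_ring_1 \<Rightarrow> 'b::idom fps"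
  assumes h: "ring_map h" and q: "h (coeff q i) \<noteq> 0"
  shows "\<exists>v. fps_nth v 0 = c \<and> pe h v q \<noteq> 0"
proof (rule ccontr)
  assume *: "\<not> ?thesis"
  have "map_poly h q \<noteq> 0"
    using q by (metis coeff_map_poly coeff_0 ring_map_simps(1)[OF h])
  then have "finite {v. poly (map_poly h q) v = 0}"
    by (rule poly_roots_finite)
  moreover have "{v. fps_nth v 0 = c} \<subseteq> {v. poly (map_poly h q) v = 0}"
    using * by (auto simp: pe_def)
  ultimately show False
    using infinite_lifts finite_subset by blast
qed

definition evp :: "'a::comm_ring_1 \<Rightarrow> 'a \<Rightarrow> 'a \<Rightarrow> int poly poly poly \<Rightarrow> 'a" where
  "evp t x y = pe (pe (pe of_int t) x) y"

lemma ring_map_evp: "ring_map (evp t x y)"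
  unfolding evp_def by (intro ring_map_pe ring_map_of_int)

text \<open>
  A polynomial that is nonzero modulo 1009 may still vanish at a given point, but not at all series with given
  constant terms, since these are infinitely many in each variable.
\<close>

lemma nonvanishing_base_point:
  assumes "some_coeff (some_coeff (some_coeff nonzero_mod)) c"
  shows "\<exists>t x y. fps_nth t 0 = t0 \<and> fps_nth x 0 = x0 \<and> fps_nth y 0 = y0 \<and> evp t x (y :: fp fps) c \<noteq> 0"
proof -
  obtain i j k where ijk: "nonzero_mod (coeff (coeff (coeff c i) j) k)"
    using assms by (auto simp: some_coeff_def)
  have "(of_int (coeff (coeff (coeff c i) j) k) :: fp fps) \<noteq> 0"
    using ijk unfolding nonzero_mod_def fps_of_int[symmetric] by simp
  then obtain t where t: "fps_nth t 0 = t0" "pe of_int t (coeff (coeff c i) j) \<noteq> 0"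
    using nonvanishing_lift[OF ring_map_of_int, of "coeff (coeff c i) j" k] by blast
  note rt = ring_map_pe[OF ring_map_of_int, of t]
  obtain x where x: "fps_nth x 0 = x0" "pe (pe of_int t) x (coeff c i) \<noteq> 0"
    using nonvanishing_lift[OF rt t(2)] by blast
  obtain y where y: "fps_nth y 0 = y0" "pe (pe (pe of_int t) x) y c \<noteq> 0"
    using nonvanishing_lift[OF ring_map_pe[OF rt] x(2)] by blast
  show ?thesis
    using t(1) x(1) y unfolding evp_def by blast
qed

subsection \<open>Counting conjugates modulo a prime\<close>

text \<open>
  The derivative of \<open>ck z m\<close> with respect to \<open>m\<close>.
\<close>

definition dck :: "'a::comm_ring_1 \<Rightarrow> 'a \<Rightarrow> 'a" where
  "dck z m = (z\<^sup>2 + 1) * h2 z m * h3 z m + h1 z m * (z + 1) * h3 z m + h1 z m * h2 z m * (z - 1)"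

definition smooth_abscissa :: "fp \<Rightarrow> fp \<Rightarrow> fp \<Rightarrow> bool" where
  "smooth_abscissa x z m \<longleftrightarrow> 16 * z^3 * (1 - m\<^sup>2) = x * ck z m \<and> ck z m \<noteq> 0 \<and> - 32 * z^3 * m - x * dck z m \<noteq> 0"

definition smooth_curve :: "fp \<Rightarrow> fp \<Rightarrow> bool" where
  "smooth_curve t z \<longleftrightarrow> on_curve t z \<and> z \<noteq> 0 \<and> 8 * z^7 + 6 * (8 - 256 * t\<^sup>2) * z^5 + 72 * z^3 \<noteq> 0"

lemma lift_curve:
  assumes "smooth_curve (fps_nth t 0) z0"
  shows "\<exists>z. fps_nth z 0 = z0 \<and> on_curve t z"
proof -
  define f where "f = [:-27, 0, 0, 0, 18, 0, 8 - 256 * t\<^sup>2, 0, 1:]"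
  have f: "poly f z = (z\<^sup>2 - 1) * (z\<^sup>2 + 3)^3 - 256 * t\<^sup>2 * z^6" for z
    unfolding f_def by (simp only: poly_pCons poly_0) algebra
  have f': "poly (pderiv f) z = 8 * z^7 + 6 * (8 - 256 * t\<^sup>2) * z^5 + 72 * z^3" for z
    unfolding f_def by (simp only: pderiv_pCons pderiv_0 poly_pCons poly_0 poly_add) algebra
  define d where "d = inverse (8 * z0^7 + 6 * (8 - 256 * (fps_nth t 0)\<^sup>2) * z0^5 + 72 * z0^3)"
  have "\<exists>!z. fps_nth z 0 = z0 \<and> poly f z = 0"
  proof (rule hensel)
    show "fps_nth (poly f (fps_const z0)) 0 = 0"
      using assms unfolding f smooth_curve_def on_curve_def by (simp add: const_simps)
    show "fps_nth (poly (pderiv f) (fps_const z0)) 0 * d = 1"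
      using assms unfolding f' smooth_curve_def d_def by (simp add: const_simps)
  qed
  then show ?thesis
    unfolding f on_curve_def by auto
qed

lemma lift_abscissa:
  assumes "smooth_abscissa (fps_nth x 0) (fps_nth z 0) m0"
  shows "\<exists>m. fps_nth m 0 = m0 \<and> 16 * z^3 * (1 - m\<^sup>2) = x * ck z m"
proof -
  define a b c a' b' c' where "a = z\<^sup>2 + 1" "b = z + 1" "c = z - 1" "a' = - 2 * z" "b' = z - 3" "c' = - z - 3"
  note d = this
  define f where "f = [: 16 * z^3 - x * (a' * b' * c'), - (x * (a * b' * c' + a' * b * c' + a' * b' * c)),
      - (16 * z^3) - x * (a * b * c' + a * b' * c + a' * b * c), - (x * (a * b * c)) :]"
  have f: "poly f m = 16 * z^3 * (1 - m\<^sup>2) - x * ck z m" for m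
    unfolding f_def d ck_def h1_def h2_def h3_def by (simp only: poly_pCons poly_0) algebra
  have f': "poly (pderiv f) m = - 32 * z^3 * m - x * dck z m" for m
    unfolding f_def d dck_def h1_def h2_def h3_def
    by (simp only: pderiv_pCons pderiv_0 poly_pCons poly_0 poly_add) algebra
  define e where "e = inverse (- 32 * (fps_nth z 0)^3 * m0 - fps_nth x 0 * dck (fps_nth z 0) m0)"
  have "\<exists>!m. fps_nth m 0 = m0 \<and> poly f m = 0"
  proof (rule hensel)
    show "fps_nth (poly f (fps_const m0)) 0 = 0"
      using assms unfolding f smooth_abscissa_def ck_def h1_def h2_def h3_def by (simp add: const_simps)
    show "fps_nth (poly (pderiv f) (fps_const m0)) 0 * e = 1"
      using assms unfolding f' smooth_abscissa_def dck_def h1_def h2_def h3_def e_def by (simp add: const_simps)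
  qed
  then show ?thesis
    unfolding f by auto
qed

text \<open>
  Smooth points lift along every deformation of the base point, by Hensel's lemma.
\<close>

lemma lift_point:
  assumes "independent_pair a b"
    and "smooth_curve (fps_nth t 0) z0" "smooth_abscissa (fps_nth x 0) z0 m0" "smooth_abscissa (fps_nth y 0) z0 n0"
  shows "\<exists>z m n. special_point a b t x y z m n \<and> fps_nth z 0 = z0 \<and> fps_nth m 0 = m0 \<and> fps_nth n 0 = n0"
proof -
  obtain z where z: "fps_nth z 0 = z0" "on_curve t z"
    using lift_curve[OF assms(2)] by blast
  obtain m where m: "fps_nth m 0 = m0" "16 * z^3 * (1 - m\<^sup>2) = x * ck z m"
    using lift_abscissa[of x z m0] assms(3) z(1) by blast
  obtain n where n: "fps_nth n 0 = n0" "16 * z^3 * (1 - n\<^sup>2) = y * ck z n"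
    using lift_abscissa[of y z n0] assms(4) z(1) by blast
  have "fps_nth (ck z m) 0 = ck z0 m0" "fps_nth (ck z n) 0 = ck z0 n0"
    by (simp_all add: ck_def h1_def h2_def h3_def const_simps z(1) m(1) n(1))
  then have "special_point a b t x y z m n"
    using assms z m n unfolding smooth_curve_def smooth_abscissa_def by unfold_locales auto
  then show ?thesis
    using z(1) m(1) n(1) by blast
qed

lemma (in special_point) spec_evp:
  "spec (evp tt (fps_to_fls (fps_const a) / tt) (fps_to_fls (fps_const b) / tt) c) (fps_to_fls (evp t x y c))"
proof -
  note r1 = ring_map_of_int
  note r2 = ring_map_pe[OF r1] note r3 = ring_map_pe[OF r2]
  have e: "fps_to_fls (evp t x y c) = evp (fps_to_fls t) (fps_to_fls x) (fps_to_fls y) c"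
    unfolding evp_def
    by (simp only: pe_compose[OF ring_map_fps_to_fls] r1 r2 r3 ring_map_of_int_eq[OF ring_map_fps_to_fls])
  show ?thesis
    unfolding e unfolding evp_def
    by (intro spec_pe r1 r2 r3 spec_of_int spec_coordinates spec_abscissa)
qed

text \<open>
  The coefficients of an annihilator are quotients of integral polynomials in \<open>t\<close> and the abscissas. Cleared of
  denominators and of its content modulo 1009, it specializes to a nonzero polynomial over the series ring of
  the finite field at a suitable deformation of the base point. All the lifted special points give roots of the
  latter, and these are distinct because their constant terms are.
\<close>

theorem card_conjugates_le_degree:
  assumes ind: "independent_pair a b"
    and ann: "annihilates (gen_field {fps_to_fls (fps_const a), fps_to_fls (fps_const b), tt}) \<mu> \<alpha>"
    and pts: "\<And>i. i \<in> S \<Longrightarrow> smooth_curve t0 (Z i) \<and> smooth_abscissa x0 (Z i) (M i) \<and> smooth_abscissa y0 (Z i) (N i)"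
    and val: "\<And>i t x y z m n. i \<in> S \<Longrightarrow> special_point a b t x y z m n \<Longrightarrow>
      fps_nth t 0 = t0 \<Longrightarrow> fps_nth x 0 = x0 \<Longrightarrow> fps_nth y 0 = y0 \<Longrightarrow>
      fps_nth z 0 = Z i \<Longrightarrow> fps_nth m 0 = M i \<Longrightarrow> fps_nth n 0 = N i \<Longrightarrow>
      special_point.val a b t z m n \<alpha> (f i)"
    and inj: "inj_on f S"
  shows "card S \<le> degree \<mu>"
proof -
  define x' y' where "x' = fps_to_fls (fps_const a) / tt" "y' = fps_to_fls (fps_const b) / tt"
  define h where "h = evp tt x' y'"
  have h: "ring_map h"
    unfolding h_def by (rule ring_map_evp)
  note hs = ring_map_simps[OF h]
  have tt0: "tt \<noteq> 0"
    by (simp add: tt_def)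
  have ht: "h [:[:[:0, 1:]:]:] = tt" and hx: "h [:[:0, 1:]:] = x'" and hy: "h [:0, 1:] = y'"
  proof -
    note r1 = ring_map_of_int[where 'a = "qxy fls"]
    note r2 = ring_map_pe[OF r1, of tt] note r3 = ring_map_pe[OF r2, of x']
    note e = pe_pCons[OF r1] pe_pCons[OF r2] pe_pCons[OF r3] pe_0
      ring_map_simps(1,2)[OF r2] ring_map_simps(1,2)[OF r3]
    show "h [:[:[:0, 1:]:]:] = tt" "h [:[:0, 1:]:] = x'" "h [:0, 1:] = y'"
      unfolding h_def evp_def by (simp_all add: e)
  qed
  have quot: "\<exists>a b. h b \<noteq> 0 \<and> c = h a / h b"
    if c: "c \<in> gen_field {fps_to_fls (fps_const a), fps_to_fls (fps_const b), tt}" for c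
  proof (rule gen_field_quotients[OF h _ c])
    fix s assume "s \<in> {fps_to_fls (fps_const a), fps_to_fls (fps_const b), tt}"
    then have "s = h ([:[:[:0, 1:]:]:] * [:[:0, 1:]:]) \<or> s = h ([:[:[:0, 1:]:]:] * [:0, 1:]) \<or> s = h [:[:[:0, 1:]:]:]"
      unfolding hs(4) ht hx hy x'_y'_def using tt0 by auto
    then obtain r where "s = h r" by blast
    then show "\<exists>a b. h b \<noteq> 0 \<and> s = h a / h b"
      by (intro exI[of _ r] exI[of _ 1]) (simp add: hs)
  qed
  have "\<exists>a b. h b \<noteq> 0 \<and> coeff \<mu> i = h a / h b" for i
    using ann by (intro quot) (auto simp: annihilates_def)
  then obtain d q where dq: "h d \<noteq> 0" "map_poly h q = smult (h d) \<mu>"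
    using common_denominator[OF h, of \<mu>] by blast
  \<comment> \<open>Coefficients of \<open>q\<close> beyond the degree of \<open>\<mu>\<close> may be nonzero polynomials with the value 0.\<close>
  define p where "p = (\<Sum>i\<le>degree \<mu>. monom (coeff q i) i)"
  have coeff_p: "coeff p i = (if i \<le> degree \<mu> then coeff q i else 0)" for i
    by (simp add: p_def coeff_sum)
  have "h (coeff q i) = h d * coeff \<mu> i" for i
    using arg_cong[OF dq(2), of "\<lambda>r. coeff r i"] by (simp add: coeff_map_poly hs)
  then have mp: "map_poly h p = smult (h d) \<mu>"
    by (intro poly_eqI) (auto simp: coeff_map_poly hs coeff_p coeff_eq_0)
  have "\<mu> \<noteq> 0"
    using ann by (simp add: annihilates_def)
  then have "p \<noteq> 0"
    using mp dq(1) by auto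
  moreover have "content_removable (some_coeff (some_coeff (some_coeff (some_coeff nonzero_mod))))"
    by (intro content_removable_poly content_removable_int)
  ultimately obtain e r where r: "p = 1009 ^ e * r" "some_coeff (some_coeff (some_coeff (some_coeff nonzero_mod))) r"
    unfolding content_removable_def by blast
  have "degree r = degree p"
  proof -
    have "(1009 :: int poly poly poly poly) ^ e = [:1009 ^ e:]"
      by (simp add: numeral_poly poly_const_pow)
    then show ?thesis
      using r(1) by simp
  qed
  also have "\<dots> \<le> degree \<mu>"
    by (intro degree_le) (simp add: coeff_p)
  finally have deg_r: "degree r \<le> degree \<mu>" .
  note pe_ring = ring_map_pe[OF h, of \<alpha>]
  have "pe h \<alpha> p = 0"
    using ann unfolding pe_def mp by (simp add: annihilates_def)
  then have root: "pe h \<alpha> r = 0"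
    unfolding r(1) by (simp add: ring_map_simps[OF pe_ring])
  obtain i where "some_coeff (some_coeff (some_coeff nonzero_mod)) (coeff r i)"
    using r(2) by (auto simp: some_coeff_def)
  then obtain t x y where txy: "fps_nth t 0 = t0" "fps_nth x 0 = x0" "fps_nth y 0 = y0"
    "evp t x (y :: fp fps) (coeff r i) \<noteq> 0"
    using nonvanishing_base_point by blast
  define g where "g = map_poly (evp t x y) r"
  have "coeff g i \<noteq> 0"
    using txy(4) by (simp add: g_def coeff_map_poly ring_map_simps(1)[OF ring_map_evp])
  then have g0: "g \<noteq> 0" by auto
  have "\<exists>v. fps_nth v 0 = f s \<and> poly g v = 0" if sS: "s \<in> S" for s
  proof -
    obtain z m n where sp: "special_point a b t x y z m n"
      and z: "fps_nth z 0 = Z s" "fps_nth m 0 = M s" "fps_nth n 0 = N s"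
      using lift_point[OF ind, of t "Z s" x "M s" y "N s"] pts[OF sS] txy(1-3) by blast
    interpret special_point a b t x y z m n by (rule sp)
    have "val \<alpha> (f s)"
      by (rule val[OF sS sp txy(1-3) z])
    then obtain v where v: "spec \<alpha> (fps_to_fls v)" "fps_nth v 0 = f s"
      unfolding val_def by blast
    note E = ring_map_evp[of t x y]
    have "spec (pe h \<alpha> r) (pe (\<lambda>c. fps_to_fls (evp t x y c)) (fps_to_fls v) r)"
      unfolding h_def x'_y'_def
      by (rule spec_pe[OF ring_map_evp ring_map_compose[OF ring_map_fps_to_fls E] spec_evp v(1)])
    then have "fps_to_fls (pe (evp t x y) v r) = 0"
      unfolding root pe_compose[OF ring_map_fps_to_fls E] by (rule spec_0)
    then have "poly g v = 0"
      by (simp add: g_def pe_def)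
    with v(2) show ?thesis by blast
  qed
  then obtain v where v: "\<And>s. s \<in> S \<Longrightarrow> fps_nth (v s) 0 = f s \<and> poly g (v s) = 0"
    by metis
  have "inj_on v S"
    using inj v by (metis inj_on_def)
  moreover have fin: "finite {w. poly g w = 0}"
    using g0 by (rule poly_roots_finite)
  moreover have "v ` S \<subseteq> {w. poly g w = 0}"
    using v by auto
  ultimately have "card S \<le> card {w. poly g w = 0}"
    by (metis card_inj_on_le)
  also have "\<dots> \<le> degree g"
    using g0 by (rule card_poly_roots_bound)
  also have "\<dots> \<le> degree r"
    unfolding g_def by (intro degree_le) (simp add: coeff_map_poly ring_map_simps(1)[OF ring_map_evp] coeff_eq_0)
  finally show ?thesis
    using deg_r by simp
qed

section \<open>The values of the series\<close>

subsection \<open>At the generic point\<close>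

text \<open>
  Solving the functional equations for the two-variable series. Here \<open>s\<close> and \<open>r\<close> are the inverses of the
  abscissas that belong to the two arguments, \<open>tx\<close> and \<open>ty\<close> are these abscissas times \<open>t\<^sup>2\<close>, \<open>k\<close> is the
  inverse of twice the kernel, \<open>c\<close> is the difference of the corner values, and the \<open>f\<^sub>i\<close> are the boundary
  values.
\<close>

definition inner_L :: "'a::comm_ring_1 \<Rightarrow> 'a \<Rightarrow> 'a \<Rightarrow> 'a \<Rightarrow> 'a \<Rightarrow> 'a \<Rightarrow> 'a \<Rightarrow> 'a \<Rightarrow> 'a" where
  "inner_L k s r ty c f1 f2 f4 = k * (1 - 2 * r * f1 + (1 - 2 * s - ty - r) * r * f2 + r * (f4 + c))"
definition inner_B :: "'a::comm_ring_1 \<Rightarrow> 'a \<Rightarrow> 'a \<Rightarrow> 'a \<Rightarrow> 'a \<Rightarrow> 'a \<Rightarrow> 'a \<Rightarrow> 'a \<Rightarrow> 'a" where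
  "inner_B k s r tx c f1 f3 f4 = k * ((1 - tx - s - 2 * r) * s * f3 - 2 * s * f4 + s * (f1 - c))"
definition inner_P :: "'a::comm_ring_1 \<Rightarrow> 'a \<Rightarrow> 'a \<Rightarrow> 'a \<Rightarrow> 'a \<Rightarrow> 'a \<Rightarrow> 'a" where
  "inner_P s r l b f2 f3 = s * (l - r * f2) + r * (b - s * f3)"

lemma boundary_series_value:
  assumes "c \<noteq> 0" and s: "s = inverse (fps_to_fls (fps_const c) / tt)"
  defines "u \<equiv> zz * mm (fps_const c)"
  shows "fps_to_fls (L (fps_const c) 0) = F1 zz u" "fps_to_fls (B 0 (fps_const c)) = F4 zz u"
    "fps_to_fls (L 0 (fps_const c)) = s * F2 zz u" "fps_to_fls (B (fps_const c) 0) = s * F3 zz u"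
proof -
  show "fps_to_fls (L (fps_const c) 0) = F1 zz u" "fps_to_fls (B 0 (fps_const c)) = F4 zz u"
    unfolding u_def zz_mm L_B_series by simp_all
  obtain Y where Y: "kernel_pair (fps_const c) Y" "fps_nth Y 0 = 0"
    using kernel_pair_const[OF assms(1)] by blast
  have x: "fps_to_fls (fps_const c) \<noteq> 0"
    using assms(1) by simp
  have q: "f = s * g" if "fps_to_fls (fps_const c) * f = tt * g" for f g
    unfolding s using that x tt_nonzero by (simp add: field_simps)
  show "fps_to_fls (L 0 (fps_const c)) = s * F2 zz u" "fps_to_fls (B (fps_const c) 0) = s * F3 zz u"
    unfolding u_def zz_mm by (rule q, rule L_B_series_boundary[OF Y])+
qed

lemma kap_corner: "fps_to_fls (L 0 0) - fps_to_fls (B 0 0) = kap zz"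
  unfolding kap_zz zz_mm L_B_series ..

lemma inner_series_value:
  assumes a: "a \<noteq> 0" and b: "b \<noteq> 0"
  defines "x \<equiv> fps_to_fls (fps_const a) / tt" and "y \<equiv> fps_to_fls (fps_const b) / tt"
    and "u \<equiv> zz * mm (fps_const a)" and "v \<equiv> zz * mm (fps_const b)"
  defines "s \<equiv> inverse x" and "r \<equiv> inverse y"
  defines "K \<equiv> 1 - tt\<^sup>2 * x - s - tt\<^sup>2 * y - r"
  defines "l \<equiv> inner_L (inverse (2 * K)) s r (tt\<^sup>2 * y) (kap zz) (F1 zz u) (F2 zz v) (F4 zz v)"
    and "m \<equiv> inner_B (inverse (2 * K)) s r (tt\<^sup>2 * x) (kap zz) (F1 zz u) (F3 zz u) (F4 zz v)"
  shows "fps_to_fls (L (fps_const a) (fps_const b)) = l" "fps_to_fls (B (fps_const a) (fps_const b)) = m"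
    "fps_to_fls (P (fps_const a) (fps_const b)) = inner_P s r l m (F2 zz v) (F3 zz u) / tt"
proof -
  define X Y where "X = fps_const a" "Y = fps_const b"
  note XY = this[symmetric]
  have xy0: "x \<noteq> 0" "y \<noteq> 0"
    using a b tt_nonzero by (simp_all add: x_def y_def)
  have X: "fps_to_fls X = tt * x" and Y: "fps_to_fls Y = tt * y"
    using tt_nonzero by (simp_all add: x_def y_def XY)
  have xs: "x * s = 1" and yr: "y * r = 1"
    using xy0 by (simp_all add: s_def r_def)
  have sa: "s = inverse (fps_to_fls (fps_const a) / tt)" and rb: "r = inverse (fps_to_fls (fps_const b) / tt)"
    by (simp_all only: s_def r_def x_def y_def)
  note va = boundary_series_value[OF a sa, unfolded XY, folded u_def[unfolded XY]]
  note vb = boundary_series_value[OF b rb, unfolded XY, folded v_def[unfolded XY]]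
  define l0 m0 where "l0 = fps_to_fls (L X Y)" "m0 = fps_to_fls (B X Y)"
  define g1 g2 g3 g4 where "g1 = F1 zz u" "g2 = F2 zz v" "g3 = F3 zz u" "g4 = F4 zz v"
  define c1 c2 where "c1 = fps_to_fls (L 0 0)" "c2 = fps_to_fls (B 0 0)"
  have kap: "kap zz = c1 - c2"
    unfolding c1_c2_def kap_corner ..
  define k where "k = fps_to_fls (X * Y - vt * (X * (X * Y) + Y + X * (Y * Y) + X))"
  have k_eq: "k = tt * x * (tt * y) - tt * (tt * x * (tt * x * (tt * y)) + tt * y + tt * x * (tt * y * (tt * y)) + tt * x)"
    by (simp only: k_def fls_hom X Y flip: tt_def)
  have kK: "k = tt\<^sup>2 * (x * y * K)"
    unfolding k_eq K_def using xs yr by algebra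
  have "k \<noteq> 0"
    unfolding k_def by (rule fls_unit) (use a b in \<open>simp add: X_Y_def\<close>)
  then have K0: "K \<noteq> 0"
    using kK by auto
  define j where "j = inverse (2 * K)"
  have jK: "2 * K * j = 1"
    using K0 by (simp add: j_def)
  have EL: "k * (2 * l0 - r * g2) = tt * x * (tt * y) - 2 * (tt * (tt * x * g1)) + tt * (tt * x * (tt * x * (tt * y * (r * g2))))
     - tt * (tt * y * (r * g2)) + tt * (tt * x * g4) + tt * (tt * x * c1) - tt * (tt * x * c2)"
    using arg_cong[OF L_at[of X Y], of fps_to_fls]
    unfolding fls_hom unfolding tt_def[symmetric] va vb X Y l0_m0_def[symmetric] c1_c2_def[symmetric] g1_g2_g3_g4_def[symmetric] k_eq .
  have EB: "k * (2 * m0 - s * g3) = tt * (tt * x * (tt * y * (tt * y * (s * g3)))) - tt * (tt * x * (s * g3))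
     - 2 * (tt * (tt * y * g4)) + tt * (tt * y * g1) - tt * (tt * y * c1) + tt * (tt * y * c2)"
    using arg_cong[OF B_at[of X Y], of fps_to_fls]
    unfolding fls_hom unfolding tt_def[symmetric] va vb X Y l0_m0_def[symmetric] c1_c2_def[symmetric] g1_g2_g3_g4_def[symmetric] k_eq .
  have EP: "tt * x * (tt * y * fps_to_fls (P X Y)) = tt * y * (l0 - r * g2) + tt * x * (m0 - s * g3)"
    using arg_cong[OF P_at[of X Y], of fps_to_fls]
    unfolding fls_hom unfolding va vb X Y l0_m0_def[symmetric] g1_g2_g3_g4_def[symmetric] .
  have cancel: "p = q" if "tt\<^sup>2 * (x * y) * p = tt\<^sup>2 * (x * y) * q" for p q
    using that tt_nonzero xy0 by simp
  have "K * (2 * l0) = 1 - 2 * r * g1 + (1 - 2 * s - tt\<^sup>2 * y - r) * r * g2 + r * (g4 + (c1 - c2))"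
    by (rule cancel) (use EL[unfolded kK] K_def xs yr in algebra)
  then have "l0 = j * (1 - 2 * r * g1 + (1 - 2 * s - tt\<^sup>2 * y - r) * r * g2 + r * (g4 + (c1 - c2)))"
    using jK by algebra
  then show L: "fps_to_fls (L (fps_const a) (fps_const b)) = l"
    by (simp only: XY l_def inner_L_def kap g1_g2_g3_g4_def j_def l0_m0_def)
  have "K * (2 * m0) = (1 - tt\<^sup>2 * x - s - 2 * r) * s * g3 - 2 * s * g4 + s * (g1 - (c1 - c2))"
    by (rule cancel) (use EB[unfolded kK] K_def xs yr in algebra)
  then have "m0 = j * ((1 - tt\<^sup>2 * x - s - 2 * r) * s * g3 - 2 * s * g4 + s * (g1 - (c1 - c2)))"
    using jK by algebra
  then show B: "fps_to_fls (B (fps_const a) (fps_const b)) = m"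
    by (simp only: XY m_def inner_B_def kap g1_g2_g3_g4_def j_def l0_m0_def)
  have "tt * fps_to_fls (P X Y) = s * (l0 - r * g2) + r * (m0 - s * g3)"
    by (rule cancel) (use EP xs yr in algebra)
  then show "fps_to_fls (P (fps_const a) (fps_const b)) = inner_P s r l m (F2 zz v) (F3 zz u) / tt"
    unfolding inner_P_def L[symmetric] B[symmetric] XY l0_m0_def g1_g2_g3_g4_def
    using tt_nonzero by (simp add: nonzero_eq_divide_eq mult.commute)
qed

context special_point
begin

lemma val_uminus: "val u r \<Longrightarrow> val (- u) (- r)"
  using val_diff[OF val_diff[OF val_numeral(1) val_numeral(1)], of u r] by simp

lemma val_inverse: "val u r \<Longrightarrow> r \<noteq> 0 \<Longrightarrow> val (inverse u) (inverse r)"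
  using val_divide[OF val_numeral(1), of u r] by (simp add: inverse_eq_divide)

lemmas val_intros = val_add val_diff val_mult val_power val_numeral

lemma val_F:
  assumes u: "val u w" and z: "fps_nth z 0 = z0"
  shows "(w * z0 + z0 ^ 2 + w - 3 * z0) * (w + z0) * (z0 - 1) * (z0 ^ 2 + 3) ^ 3 \<noteq> 0 \<Longrightarrow> val (F1 zz u) (F1 z0 w)"
    "poly_D z0 w * (z0 - 1) * (z0 ^ 2 + 3) ^ 3 \<noteq> 0 \<Longrightarrow> val (F2 zz u) (F2 z0 w)"
    "(z0 ^ 2 - 1) * (z0 ^ 2 + 3) ^ 3 * poly_D z0 w \<noteq> 0 \<Longrightarrow> val (F3 zz u) (F3 z0 w)"
    "(w + z0) * (1 - z0 ^ 2) * (z0 ^ 2 + 3) ^ 3 * (w * z0 - z0 ^ 2 - w - 3 * z0) \<noteq> 0 \<Longrightarrow> val (F4 zz u) (F4 z0 w)"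
    "(z0 + 1) * (z0 ^ 2 + 3) ^ 3 \<noteq> 0 \<Longrightarrow> val (kap zz) (kap z0)"
  unfolding F1_def F2_def F3_def F4_def kap_def poly_D_def poly_N1_def poly_N2_def
  by (intro val_uminus val_divide val_intros u val_coordinates(2)[unfolded z], assumption)+

end

subsection \<open>At the points modulo 1009\<close>

type_synonym row = "int \<times> int \<times> int \<times> int \<times> int"

text \<open>
  The points over the base point \<open>t = 622\<close> and the abscissa 768. For each of the eight values of \<open>z\<close> the table
  lists \<open>z\<close>, the value of \<open>kap\<close>, and for each of the three points over \<open>z\<close> the value of \<open>m\<close> and those of
  \<open>F1\<close>, \<open>F2\<close>, \<open>F3\<close>, \<open>F4\<close>.
\<close>

definition point_table :: "(int \<times> int \<times> row list) list" where
  "point_table =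
    [(85, 391, [(269,402,583,568,179), (356,493,581,949,510), (784,646,854,658,938)]),
     (88, 329, [(378,829,341,858,469), (435,694,585,137,145), (680,965,83,171,66)]),
     (123, 377, [(74,345,8,465,1002), (103,53,1007,138,468), (776,120,1003,563,171)]),
     (365, 539, [(403,1002,669,184,683), (639,485,779,682,403), (802,202,570,300,393)]),
     (644, 186, [(207,9,425,155,586), (370,19,43,955,869), (606,299,541,56,377)]),
     (886, 348, [(233,796,162,731,504), (906,84,587,727,437), (935,618,260,717,729)]),
     (921, 396, [(329,691,554,642,340), (574,770,588,140,69), (631,85,876,384,204)]),
     (924, 334, [(225,554,67,880,21), (653,126,785,144,877), (740,804,157,142,786)])]"

text \<open>
  The conditions on a row of the table as polynomials that have to vanish modulo 1009 (the equations of the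
  point, and those of the values without division) or not to vanish (smoothness and denominators). They are
  stated for an arbitrary ring because they are evaluated in the integers and used in the finite field.
\<close>

definition row_zeros :: "'a::comm_ring_1 \<Rightarrow> 'a \<Rightarrow> 'a \<Rightarrow> 'a \<Rightarrow> 'a \<Rightarrow> 'a \<Rightarrow> 'a \<Rightarrow> 'a list" where
  "row_zeros z m f1 f2 f3 f4 c = (let w = z * m; q = (z ^ 2 + 3) ^ 3 in
    [(z\<^sup>2 - 1) * q - 256 * 622\<^sup>2 * z ^ 6,
     16 * z^3 * (1 - m\<^sup>2) - 768 * ck z m,
     f1 * ((w * z + z ^ 2 + w - 3 * z) * (w + z) * (z - 1) * q)
       - 256 * z ^ 4 * (w * z ^ 2 - 2 * z ^ 2 + w),
     f2 * (poly_D z w * (z - 1) * q)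
       - 256 * z ^ 6 * (w - z) * (w * z - z ^ 2 - w - 3 * z) * (w ^ 2 * z ^ 2 - z ^ 4 - 4 * w * z ^ 2 + w ^ 2 + 3 * z ^ 2),
     f3 * ((z ^ 2 - 1) * q * poly_D z w)
       + 512 * z ^ 6 * (w * z ^ 2 - 2 * z ^ 2 + w) * (w - z) * poly_N1 z w,
     f4 * ((w + z) * (1 - z ^ 2) * q * (w * z - z ^ 2 - w - 3 * z))
       - 16 * z ^ 2 * (w * z ^ 2 - 2 * z ^ 2 + w) * poly_N2 z w,
     c * ((z + 1) * q) - 32 * z^3 * (z^3 - 3 * z\<^sup>2 + 3 * z + 3)])"

definition row_units :: "'a::comm_ring_1 \<Rightarrow> 'a \<Rightarrow> 'a list" where
  "row_units z m = (let w = z * m; q = (z ^ 2 + 3) ^ 3 in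
    [z, 8 * z^7 + 6 * (8 - 256 * 622\<^sup>2) * z^5 + 72 * z^3, ck z m, - 32 * z^3 * m - 768 * dck z m,
     (w * z + z ^ 2 + w - 3 * z) * (w + z) * (z - 1) * q,
     poly_D z w * (z - 1) * q,
     (z ^ 2 - 1) * q * poly_D z w,
     (w + z) * (1 - z ^ 2) * q * (w * z - z ^ 2 - w - 3 * z),
     (z + 1) * q])"

lemma table_check:
  "list_all (\<lambda>(z, c, l). list_all (\<lambda>(m, f1, f2, f3, f4).
     list_all (\<lambda>v. v mod 1009 = 0) (row_zeros z m f1 f2 f3 f4 c) \<and>
     list_all (\<lambda>v. v mod 1009 \<noteq> 0) (row_units z m)) l) point_table"
  by code_simp

lemma row_of_int:
  "map of_int (row_zeros z m f1 f2 f3 f4 c) =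
     row_zeros (of_int z) (of_int m) (of_int f1) (of_int f2) (of_int f3) (of_int f4) (of_int c :: 'a::comm_ring_1)"
  "map of_int (row_units z m) = row_units (of_int z) (of_int m :: 'a)"
  by (simp_all add: row_zeros_def row_units_def Let_def ck_def dck_def h1_def h2_def h3_def poly_D_def poly_N1_def poly_N2_def)

definition boundary_points :: "(int \<times> int \<times> row \<times> row) list" where
  "boundary_points = concat (map (\<lambda>(z, c, l). map (\<lambda>r. (z, c, r, r)) l) point_table)"

definition inner_points :: "(int \<times> int \<times> row \<times> row) list" where
  "inner_points = concat (map (\<lambda>(z, c, l). map (\<lambda>(r, q). (z, c, r, q)) (List.product l l)) point_table)"

text \<open>
  The integers are the residues of the arguments of \<open>inner_L\<close>, \<open>inner_B\<close> and \<open>inner_P\<close>: modulo 1009 the inverse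
  of 768 is 314, \<open>622\<^sup>2 \<cdot> 768\<close> is 628, and 938 is the inverse of \<open>2 (1 - 2 \<cdot> 628 - 2 \<cdot> 314)\<close>.
\<close>

definition L_value :: "int \<times> int \<times> row \<times> row \<Rightarrow> int" where
  "L_value = (\<lambda>(z, c, (m, f1, f2, f3, f4), (n, g1, g2, g3, g4)). inner_L 938 314 314 628 c f1 g2 g4)"
definition B_value :: "int \<times> int \<times> row \<times> row \<Rightarrow> int" where
  "B_value = (\<lambda>(z, c, (m, f1, f2, f3, f4), (n, g1, g2, g3, g4)). inner_B 938 314 314 628 c f1 f3 g4)"
definition P_value :: "int \<times> int \<times> row \<times> row \<Rightarrow> int" where
  "P_value = (\<lambda>(z, c, (m, f1, f2, f3, f4), (n, g1, g2, g3, g4)).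
     inner_P 314 314 (inner_L 938 314 314 628 c f1 g2 g4) (inner_B 938 314 314 628 c f1 f3 g4) g2 f3)"

lemma points_length: "length boundary_points = 24" "length inner_points = 72"
  by (simp_all add: boundary_points_def inner_points_def point_table_def)

text \<open>
  The factors are the residues of the two arguments of the series, \<open>622 \<cdot> 768\<close>, and of \<open>1/t\<close>, which is 73.
\<close>

lemma inner_values_distinct:
  "distinct (map (\<lambda>p. (622 * 768 * L_value p) mod 1009) inner_points)"
  "distinct (map (\<lambda>p. (622 * 768 * B_value p) mod 1009) inner_points)"
  "distinct (map (\<lambda>p. (73 * P_value p) mod 1009) inner_points)"
  by (simp_all add: inner_points_def point_table_def L_value_def B_value_def P_value_def
      inner_L_def inner_B_def inner_P_def)

lemma boundary_values_distinct:
  "distinct (map (\<lambda>(z, c, (m, f1, f2, f3, f4), q). f1 mod 1009) boundary_points)"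
  "distinct (map (\<lambda>(z, c, (m, f1, f2, f3, f4), q). (314 * f2) mod 1009) boundary_points)"
  "distinct (map (\<lambda>(z, c, (m, f1, f2, f3, f4), q). (314 * f3) mod 1009) boundary_points)"
  "distinct (map (\<lambda>(z, c, (m, f1, f2, f3, f4), q). f4 mod 1009) boundary_points)"
  by (simp_all add: boundary_points_def point_table_def)

lemma inj_on_residues:
  assumes d: "distinct (map (\<lambda>r. g r mod 1009) rows)"
  shows "inj_on (\<lambda>r. of_int (g r) :: fp) (set rows)" "card (set rows) = length rows"
proof -
  show "inj_on (\<lambda>r. of_int (g r) :: fp) (set rows)"
    using d by (simp add: distinct_map inj_on_def of_int_fp_eq_iff)
  show "card (set rows) = length rows"
    using d by (simp add: distinct_card distinct_map)
qed

lemma row_facts: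
  assumes "(z, c, l) \<in> set point_table" "(m, f1, f2, f3, f4) \<in> set l"
  defines "z0 \<equiv> of_int z :: fp" and "m0 \<equiv> of_int m :: fp"
  shows "smooth_curve 622 z0" "smooth_abscissa 768 z0 m0"
    "F1 z0 (z0 * m0) = of_int f1" "F2 z0 (z0 * m0) = of_int f2" "F3 z0 (z0 * m0) = of_int f3"
    "F4 z0 (z0 * m0) = of_int f4" "kap z0 = of_int c"
    and "special_point a b t x y Z M N \<Longrightarrow> fps_nth Z 0 = z0 \<Longrightarrow> special_point.val a b t Z M N u (z0 * m0) \<Longrightarrow>
      special_point.val a b t Z M N (F1 zz u) (of_int f1) \<and> special_point.val a b t Z M N (F2 zz u) (of_int f2) \<and>
      special_point.val a b t Z M N (F3 zz u) (of_int f3) \<and> special_point.val a b t Z M N (F4 zz u) (of_int f4) \<and>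
      special_point.val a b t Z M N (kap zz) (of_int c)"
proof -
  have zeros: "list_all (\<lambda>v. v mod 1009 = 0) (row_zeros z m f1 f2 f3 f4 c)"
    and units: "list_all (\<lambda>v. v mod 1009 \<noteq> 0) (row_units z m)"
    using table_check assms(1,2) unfolding list_all_iff by fastforce+
  have "list_all (\<lambda>v. v = 0) (map of_int (row_zeros z m f1 f2 f3 f4 c) :: fp list)"
    using zeros of_int_fp_eq_iff[of _ 0] by (auto simp: list_all_iff)
  then have zeros: "list_all (\<lambda>v. v = 0) (row_zeros z0 m0 (of_int f1) (of_int f2) (of_int f3) (of_int f4) (of_int c))"
    unfolding row_of_int z0_def m0_def .
  have "list_all (\<lambda>v. v \<noteq> 0) (map of_int (row_units z m) :: fp list)"
    using units of_int_fp_eq_iff[of _ 0] by (auto simp: list_all_iff)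
  then have units: "list_all (\<lambda>v. v \<noteq> 0) (row_units z0 m0)"
    unfolding row_of_int z0_def m0_def .
  note zs = zeros[unfolded row_zeros_def Let_def list.pred_inject right_minus_eq]
  note us = units[unfolded row_units_def Let_def list.pred_inject]
  show "smooth_curve 622 z0"
    unfolding smooth_curve_def on_curve_def using zs us by blast
  show "smooth_abscissa 768 z0 m0"
    unfolding smooth_abscissa_def using zs us by blast
  have q: "p / r = f" if "f * r = p" "r \<noteq> 0" for p r f :: fp
    using that by (simp add: nonzero_divide_eq_eq)
  show F1: "F1 z0 (z0 * m0) = of_int f1"
    unfolding F1_def by (rule q) (use zs us in blast)+
  show F2: "F2 z0 (z0 * m0) = of_int f2"
    unfolding F2_def by (rule q) (use zs us in blast)+
  show F3: "F3 z0 (z0 * m0) = of_int f3"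
    unfolding F3_def minus_divide_left by (rule q[OF iffD2[OF eq_neg_iff_add_eq_0]]) (use zs us in blast)+
  show F4: "F4 z0 (z0 * m0) = of_int f4"
    unfolding F4_def by (rule q) (use zs us in blast)+
  show kap: "kap z0 = of_int c"
    unfolding kap_def by (rule q) (use zs us in blast)+
  show "special_point.val a b t Z M N (F1 zz u) (of_int f1) \<and> special_point.val a b t Z M N (F2 zz u) (of_int f2) \<and>
      special_point.val a b t Z M N (F3 zz u) (of_int f3) \<and> special_point.val a b t Z M N (F4 zz u) (of_int f4) \<and>
      special_point.val a b t Z M N (kap zz) (of_int c)"
    if sp: "special_point a b t x y Z M N" and Z: "fps_nth Z 0 = z0" and u: "special_point.val a b t Z M N u (z0 * m0)"
  proof -
    note F = special_point.val_F[OF sp u Z]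
    show ?thesis
      unfolding F1[symmetric] F2[symmetric] F3[symmetric] F4[symmetric] kap[symmetric]
      by (intro conjI F) (use us in blast)+
  qed
qed

section \<open>The degrees\<close>

lemma fp_constants:
  "(768 :: fp) * 314 = 1" "(622 :: fp) * 73 = 1" "(622 :: fp)\<^sup>2 * 768 = 628"
  "2 * (1 - 628 - 314 - 628 - 314) * (938 :: fp) = 1"
proof -
  have "(of_int (768 * 314) :: fp) = of_int 1" "(of_int (622 * 73) :: fp) = of_int 1"
    "(of_int (622\<^sup>2 * 768) :: fp) = of_int 628" "(of_int (2 * (1 - 628 - 314 - 628 - 314) * 938) :: fp) = of_int 1"
    unfolding of_int_fp_eq_iff by simp_all
  then show "(768 :: fp) * 314 = 1" "(622 :: fp) * 73 = 1" "(622 :: fp)\<^sup>2 * 768 = 628"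
    "2 * (1 - 628 - 314 - 628 - 314) * (938 :: fp) = 1"
    by (simp_all only: of_int_mult of_int_diff of_int_power of_int_numeral of_int_1)
qed

lemma fp_inverses: "inverse (768 :: fp) = 314" "inverse (622 :: fp) = 73"
    "inverse (2 * (1 - 628 - 314 - 628 - 314) :: fp) = 938"
    "(768 :: fp) \<noteq> 0" "(622 :: fp) \<noteq> 0" "(2 * (1 - 628 - 314 - 628 - 314) :: fp) \<noteq> 0"
proof -
  show "inverse (768 :: fp) = 314" "inverse (622 :: fp) = 73" "inverse (2 * (1 - 628 - 314 - 628 - 314) :: fp) = 938"
    by (rule inverse_unique, rule fp_constants)+
  show "(768 :: fp) \<noteq> 0" "(622 :: fp) \<noteq> 0" "(2 * (1 - 628 - 314 - 628 - 314) :: fp) \<noteq> 0"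
    using fp_constants(1,2,4) by (metis mult_zero_left zero_neq_one)+
qed

lemma (in special_point) val_constants:
  assumes "fps_nth t 0 = 622" "fps_nth x 0 = 768" "fps_nth y 0 = 768"
  defines "xa \<equiv> fps_to_fls (fps_const a) / tt" and "yb \<equiv> fps_to_fls (fps_const b) / tt"
  defines "K \<equiv> 1 - tt\<^sup>2 * xa - inverse xa - tt\<^sup>2 * yb - inverse yb"
  shows "val (inverse xa) 314" "val (inverse yb) 314" "val (tt\<^sup>2 * xa) 628" "val (tt\<^sup>2 * yb) 628"
    "val (inverse (2 * K)) 938" "val (inverse tt) 73"
    "val (fps_to_fls (fps_const a)) (622 * 768)" "val (fps_to_fls (fps_const b)) (622 * 768)"
proof -
  have v: "val tt 622" "val xa 768" "val yb 768"
    using val_coordinates(1,5,6) unfolding assms(1-3) xa_def yb_def by blast+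
  show i: "val (inverse xa) 314" "val (inverse yb) 314" "val (inverse tt) 73"
    unfolding fp_inverses(1,2)[symmetric] by (intro val_inverse v fp_inverses)+
  show p: "val (tt\<^sup>2 * xa) 628" "val (tt\<^sup>2 * yb) 628"
    unfolding fp_constants(3)[symmetric] by (intro val_mult val_power v)+
  show "val (inverse (2 * K)) 938"
    unfolding fp_inverses(3)[symmetric] K_def by (intro val_inverse val_intros i p fp_inverses)
  have "fps_to_fls (fps_const a) = tt * xa" "fps_to_fls (fps_const b) = tt * yb"
    using tt_nonzero by (simp_all add: xa_def yb_def)
  then show "val (fps_to_fls (fps_const a)) (622 * 768)" "val (fps_to_fls (fps_const b)) (622 * 768)"
    using val_mult[OF v(1,2)] val_mult[OF v(1,3)] by simp_all
qed

definition tabulated :: "int \<times> int \<times> row \<times> row \<Rightarrow> bool" where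
  "tabulated = (\<lambda>(z, c, r, q). \<exists>l. (z, c, l) \<in> set point_table \<and> r \<in> set l \<and> q \<in> set l)"

lemma points_tabulated: "p \<in> set boundary_points \<Longrightarrow> tabulated p" "p \<in> set inner_points \<Longrightarrow> tabulated p"
  unfolding boundary_points_def inner_points_def tabulated_def by fastforce+

text \<open>
  The point lies over the base point of the table and the boundary functions have there the values of the
  entry.
\<close>

definition (in special_point) over_row :: "int \<times> int \<times> row \<times> row \<Rightarrow> bool" where
  "over_row = (\<lambda>(z, c, (m, f1, f2, f3, f4), (n, g1, g2, g3, g4)).
     let u = zz * mm (fps_const a); v = zz * mm (fps_const b) in
     fps_nth t 0 = 622 \<and> fps_nth x 0 = 768 \<and> fps_nth y 0 = 768 \<and>
     val (F1 zz u) (of_int f1) \<and> val (F2 zz u) (of_int f2) \<and> val (F3 zz u) (of_int f3) \<and> val (F4 zz u) (of_int f4) \<and>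
     val (F2 zz v) (of_int g2) \<and> val (F4 zz v) (of_int g4) \<and> val (kap zz) (of_int c))"

lemma length_le_degree:
  assumes ind: "independent_pair a b"
    and ann: "annihilates (gen_field {fps_to_fls (fps_const a), fps_to_fls (fps_const b), tt}) \<mu> \<alpha>"
    and rows: "\<And>p. p \<in> set rows \<Longrightarrow> tabulated p"
    and val: "\<And>t x y z m n p. special_point a b t x y z m n \<Longrightarrow> special_point.over_row a b t x y z m n p \<Longrightarrow>
      special_point.val a b t z m n \<alpha> (of_int (g p))"
    and distinct: "distinct (map (\<lambda>p. g p mod 1009) rows)"
  shows "length rows \<le> degree \<mu>"
proof -
  define Z M N :: "int \<times> int \<times> row \<times> row \<Rightarrow> fp" where
    "Z = (\<lambda>(z, c, (m, _), (n, _)). of_int z)" and "M = (\<lambda>(z, c, (m, _), (n, _)). of_int m)"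
    and "N = (\<lambda>(z, c, (m, _), (n, _)). of_int n)"
  note d = this
  have "card (set rows) \<le> degree \<mu>"
  proof (rule card_conjugates_le_degree[where S = "set rows" and Z = Z and M = M and N = N and ?t0.0 = 622
        and ?x0.0 = 768 and ?y0.0 = 768, OF ind ann _ _ inj_on_residues(1)[OF distinct]])
    fix p assume p: "p \<in> set rows"
    obtain z c m f1 f2 f3 f4 n g1 g2 g3 g4 where e: "p = (z, c, (m, f1, f2, f3, f4), (n, g1, g2, g3, g4))"
      by (cases p) auto
    obtain l where l: "(z, c, l) \<in> set point_table" "(m, f1, f2, f3, f4) \<in> set l" "(n, g1, g2, g3, g4) \<in> set l"
      using rows[OF p] unfolding e tabulated_def by blast
    note R = row_facts[OF l(1,2)] and R' = row_facts[OF l(1,3)]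
    have zmn: "Z p = of_int z" "M p = of_int m" "N p = of_int n"
      by (simp_all add: d e)
    show "smooth_curve 622 (Z p) \<and> smooth_abscissa 768 (Z p) (M p) \<and> smooth_abscissa 768 (Z p) (N p)"
      unfolding zmn by (intro conjI R(1,2) R'(2))
    fix t x y ze mu nu
    assume sp: "special_point a b t x y ze mu nu"
      and 0: "fps_nth t 0 = 622" "fps_nth x 0 = 768" "fps_nth y 0 = 768"
      and 1: "fps_nth ze 0 = Z p" "fps_nth mu 0 = M p" "fps_nth nu 0 = N p"
    interpret special_point a b t x y ze mu nu by (rule sp)
    have w: "val (zz * mm (fps_const a)) (of_int z * of_int m)" "val (zz * mm (fps_const b)) (of_int z * of_int n)"
      using val_mult[OF val_coordinates(2,3)] val_mult[OF val_coordinates(2,4)] unfolding 1 zmn .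
    have "over_row p"
      using R(8)[OF sp 1(1)[unfolded zmn] w(1)] R'(8)[OF sp 1(1)[unfolded zmn] w(2)] 0
      unfolding over_row_def e prod.case Let_def by blast
    with sp show "val \<alpha> (of_int (g p))"
      by (rule assms(4))
  qed
  then show ?thesis
    unfolding inj_on_residues(2)[OF distinct] .
qed

context special_point
begin

lemma boundary_vals:
  assumes "over_row (k, c, (i, f1, f2, f3, f4), q)"
  shows "val (fps_to_fls (L (fps_const a) 0)) (of_int f1)" "val (fps_to_fls (L 0 (fps_const a))) (of_int (314 * f2))"
    "val (fps_to_fls (B (fps_const a) 0)) (of_int (314 * f3))" "val (fps_to_fls (B 0 (fps_const a))) (of_int f4)"
proof -
  have a: "a \<noteq> 0"
    using independent by (simp add: independent_pair_def)
  obtain j g1 g2 g3 g4 where q: "q = (j, g1, g2, g3, g4)"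
    by (cases q) auto
  note h = assms[unfolded q over_row_def prod.case Let_def]
  have 0: "fps_nth t 0 = 622" "fps_nth x 0 = 768" "fps_nth y 0 = 768"
    and F: "val (F1 zz (zz * mm (fps_const a))) (of_int f1)" "val (F2 zz (zz * mm (fps_const a))) (of_int f2)"
      "val (F3 zz (zz * mm (fps_const a))) (of_int f3)" "val (F4 zz (zz * mm (fps_const a))) (of_int f4)"
    using h by blast+
  show "val (fps_to_fls (L (fps_const a) 0)) (of_int f1)" "val (fps_to_fls (L 0 (fps_const a))) (of_int (314 * f2))"
    "val (fps_to_fls (B (fps_const a) 0)) (of_int (314 * f3))" "val (fps_to_fls (B 0 (fps_const a))) (of_int f4)"
    unfolding boundary_series_value[OF a refl] of_int_mult of_int_numeral
    by (intro F val_mult val_constants(1) 0)+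
qed

text \<open>
  Each of the three series satisfies a linear equation over the boundary values, so its residue follows from
  the table.
\<close>

lemma inner_vals:
  assumes "over_row p"
  shows "val (fps_to_fls (fps_const a * L (fps_const a) (fps_const b))) (of_int (622 * 768 * L_value p))"
    "val (fps_to_fls (fps_const b * B (fps_const a) (fps_const b))) (of_int (622 * 768 * B_value p))"
    "val (fps_to_fls (P (fps_const a) (fps_const b))) (of_int (73 * P_value p))"
proof -
  have ab: "a \<noteq> 0" "b \<noteq> 0"
    using independent by (auto simp: independent_pair_def)
  note series = inner_series_value[OF ab]
  obtain k c i f1 f2 f3 f4 j g1 g2 g3 g4 where p: "p = (k, c, (i, f1, f2, f3, f4), (j, g1, g2, g3, g4))"
    by (cases p) auto
  define u v where "u = zz * mm (fps_const a)" "v = zz * mm (fps_const b)"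
  note u = this
  note h = assms[unfolded p over_row_def prod.case Let_def, folded u]
  have 0: "fps_nth t 0 = 622" "fps_nth x 0 = 768" "fps_nth y 0 = 768"
    and F: "val (F1 zz u) (of_int f1)" "val (F2 zz u) (of_int f2)" "val (F3 zz u) (of_int f3)" "val (F4 zz u) (of_int f4)"
      "val (F2 zz v) (of_int g2)" "val (F4 zz v) (of_int g4)" "val (kap zz) (of_int c)"
    using h by blast+
  note c = val_constants[OF 0]
  have e: "of_int (L_value p) = (inner_L 938 314 314 628 (of_int c) (of_int f1) (of_int g2) (of_int g4) :: fp)"
    "of_int (B_value p) = (inner_B 938 314 314 628 (of_int c) (of_int f1) (of_int f3) (of_int g4) :: fp)"
    "of_int (73 * P_value p) = (inner_P 314 314 (of_int (L_value p)) (of_int (B_value p)) (of_int g2) (of_int f3) * 73 :: fp)"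
    by (simp_all add: p L_value_def B_value_def P_value_def inner_L_def inner_B_def inner_P_def)
  have l: "val (fps_to_fls (L (fps_const a) (fps_const b))) (of_int (L_value p))"
    unfolding series(1) unfolding e inner_L_def u[symmetric] by (intro val_intros c F)
  have r: "val (fps_to_fls (B (fps_const a) (fps_const b))) (of_int (B_value p))"
    unfolding series(2) unfolding e inner_B_def u[symmetric] by (intro val_intros c F)
  have num: "(of_int (622 * 768 * k) :: fp) = 622 * 768 * of_int k" for k
    by simp
  show "val (fps_to_fls (fps_const a * L (fps_const a) (fps_const b))) (of_int (622 * 768 * L_value p))"
    "val (fps_to_fls (fps_const b * B (fps_const a) (fps_const b))) (of_int (622 * 768 * B_value p))"
    unfolding num fls_times_fps_to_fls by (rule val_mult[OF c(7) l], rule val_mult[OF c(8) r])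
  show "val (fps_to_fls (P (fps_const a) (fps_const b))) (of_int (73 * P_value p))"
    unfolding series(3) unfolding series(1,2)[symmetric] unfolding e(3) inner_P_def u[symmetric] divide_inverse
    by (intro val_intros c[unfolded divide_inverse] F l r)
qed

end

lemma boundary_degree_ge:
  assumes f: "f \<in> {L vx 0, L 0 vx, B vx 0, B 0 vx}" and ann: "annihilates Q_xt \<mu> (fps_to_fls f)"
  shows "24 \<le> degree \<mu>"
proof -
  have Q: "annihilates (gen_field {fps_to_fls (fps_const xq), fps_to_fls (fps_const yq), tt}) \<mu> (fps_to_fls f)"
    using ann Q_xt_facts(4) unfolding annihilates_def Q_xyt_def variables tt_def by blast
  have le: "24 \<le> degree \<mu>"
    if val: "\<And>t x y Z M N z c m f1 f2 f3 f4 q. special_point xq yq t x y Z M N \<Longrightarrow>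
      special_point.over_row xq yq t x y Z M N (z, c, (m, f1, f2, f3, f4), q) \<Longrightarrow>
      special_point.val xq yq t Z M N (fps_to_fls f) (of_int (g f1 f2 f3 f4))"
      and distinct: "distinct (map (\<lambda>(z, c, (m, f1, f2, f3, f4), q). g f1 f2 f3 f4 mod 1009) boundary_points)"
    for g
  proof -
    define h :: "int \<times> int \<times> row \<times> row \<Rightarrow> int" where "h = (\<lambda>(z, c, (m, f1, f2, f3, f4), q). g f1 f2 f3 f4)"
    have "length boundary_points \<le> degree \<mu>"
    proof (rule length_le_degree[where g = h, OF independent_pairs(1) Q points_tabulated(1)])
      fix t x y Z M N p
      assume sp: "special_point xq yq t x y Z M N" "special_point.over_row xq yq t x y Z M N p"
      obtain z c m f1 f2 f3 f4 q where p: "p = (z, c, (m, f1, f2, f3, f4), q)"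
        by (cases p) auto
      show "special_point.val xq yq t Z M N (fps_to_fls f) (of_int (h p))"
        using val[OF sp[unfolded p]] by (simp add: p h_def)
    next
      show "distinct (map (\<lambda>p. h p mod 1009) boundary_points)"
        using distinct unfolding h_def by (simp add: case_prod_unfold)
    qed
    then show ?thesis
      by (simp add: points_length)
  qed
  note vals = special_point.boundary_vals[where a = xq and b = yq, folded variables(1)]
  consider "f = L vx 0" | "f = L 0 vx" | "f = B vx 0" | "f = B 0 vx"
    using f by blast
  then show ?thesis
  proof cases
    case 1
    show ?thesis
      by (rule le[OF _ boundary_values_distinct(1)]) (unfold 1, rule vals(1))
  next
    case 2
    show ?thesis
      by (rule le[OF _ boundary_values_distinct(2)]) (unfold 2, rule vals(2))
  next
    case 3
    show ?thesis
      by (rule le[OF _ boundary_values_distinct(3)]) (unfold 3, rule vals(3))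
  next
    case 4
    show ?thesis
      by (rule le[OF _ boundary_values_distinct(4)]) (unfold 4, rule vals(4))
  qed
qed

lemma inner_degree_ge:
  assumes ind: "independent_pair a b" and Q: "Q_xyt \<subseteq> gen_field {fps_to_fls (fps_const a), fps_to_fls (fps_const b), tt}"
    and f: "f \<in> {P (fps_const a) (fps_const b), fps_const a * L (fps_const a) (fps_const b), fps_const b * B (fps_const a) (fps_const b)}"
    and ann: "annihilates Q_xyt \<mu> (fps_to_fls f)"
  shows "72 \<le> degree \<mu>"
proof -
  have ann': "annihilates (gen_field {fps_to_fls (fps_const a), fps_to_fls (fps_const b), tt}) \<mu> (fps_to_fls f)"
    using ann Q unfolding annihilates_def by blast
  note le = length_le_degree[where rows = inner_points, OF ind ann' points_tabulated(2), unfolded points_length]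
  consider "f = P (fps_const a) (fps_const b)" | "f = fps_const a * L (fps_const a) (fps_const b)"
    | "f = fps_const b * B (fps_const a) (fps_const b)"
    using f by blast
  then show ?thesis
  proof cases
    case 1
    show ?thesis
      by (rule le[OF _ _ inner_values_distinct(3)]) (assumption, unfold 1, rule special_point.inner_vals(3))
  next
    case 2
    show ?thesis
      by (rule le[OF _ _ inner_values_distinct(1)]) (assumption, unfold 2, rule special_point.inner_vals(1))
  next
    case 3
    show ?thesis
      by (rule le[OF _ _ inner_values_distinct(2)]) (assumption, unfold 3, rule special_point.inner_vals(2))
  qed
qed

lemma algebraic_of_degreeI:
  assumes k: "is_subfield k" and le: "\<exists>p. annihilates k p a \<and> degree p \<le> d"
    and ge: "\<And>p. annihilates k p a \<Longrightarrow> d \<le> degree p"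
  shows "algebraic_of_degree k a d"
proof -
  obtain p where p: "annihilates k p a" "degree p \<le> d"
    using le by blast
  have lc: "lead_coeff p \<noteq> 0"
    using p(1) by (simp add: annihilates_def)
  define q where "q = smult (inverse (lead_coeff p)) p"
  have "annihilates k q a"
    using p(1) lc unfolding annihilates_def q_def coeff_smult by (auto intro: subfield_ops(6,7)[OF k])
  moreover have "lead_coeff q = 1"
    using lc unfolding q_def lead_coeff_smult by simp
  moreover have "degree q = d"
    unfolding q_def degree_smult_eq using nonzero_imp_inverse_nonzero[OF lc] p(2) ge[OF p(1)] by (metis le_antisym)
  ultimately show ?thesis
    unfolding algebraic_of_degree_def minimal_poly_def using ge by blast
qed

lemma boundary_degree:
  "f \<in> {L vx 0, L 0 vx, B vx 0, B 0 vx} \<Longrightarrow> algebraic_of_degree Q_xt (fps_to_fls f) 24"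
  by (rule algebraic_of_degreeI[OF Q_xt_facts(1) boundary_series_degree_le boundary_degree_ge])

lemma inner_degree:
  assumes f: "f \<in> {P vx vy, inverse vx * L (inverse vx) vy, inverse vy * B vx (inverse vy)}"
  shows "algebraic_of_degree Q_xyt (fps_to_fls f) 72"
proof (rule algebraic_of_degreeI[OF Q_xyt_facts(1) inner_series_degree_le[OF f]])
  fix \<mu> assume ann: "annihilates Q_xyt \<mu> (fps_to_fls f)"
  have Q: "Q_xyt \<subseteq> gen_field S" if "fps_to_fls vx \<in> gen_field S" "fps_to_fls vy \<in> gen_field S" "tt \<in> S" for S
    unfolding Q_xyt_def using that gen_field_base[OF that(3)]
    by (intro gen_field_subset[OF is_subfield_gen_field]) (auto simp: tt_def)
  have inv: "fps_to_fls vx = inverse (fps_to_fls (inverse vx))" "fps_to_fls vy = inverse (fps_to_fls (inverse vy))"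
    using vx_inverse by (metis fps_one_to_fls fls_times_fps_to_fls inverse_unique mult.commute)+
  note ge = inner_degree_ge[OF _ _ _ ann]
  have Q1: "Q_xyt \<subseteq> gen_field {fps_to_fls vx, fps_to_fls vy, tt}"
    by (rule Q) (auto intro: gen_field_base)
  have Q2: "Q_xyt \<subseteq> gen_field {fps_to_fls (inverse vx), fps_to_fls vy, tt}"
    by (rule Q) (auto intro: gen_field_base gen_field_inverse simp: inv(1))
  have Q3: "Q_xyt \<subseteq> gen_field {fps_to_fls vx, fps_to_fls (inverse vy), tt}"
    by (rule Q) (auto intro: gen_field_base gen_field_inverse simp: inv(2))
  consider "f = P vx vy" | "f = inverse vx * L (inverse vx) vy" | "f = inverse vy * B vx (inverse vy)"
    using f by blast
  then show "72 \<le> degree \<mu>"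
  proof cases
    case 1
    then show ?thesis
      using ge[OF independent_pairs(1)] Q1 unfolding variables[symmetric] by blast
  next
    case 2
    then show ?thesis
      using ge[OF independent_pairs(2)] Q2 unfolding variables[symmetric] by blast
  next
    case 3
    then show ?thesis
      using ge[OF independent_pairs(3)] Q3 unfolding variables[symmetric] by blast
  qed
qed

section \<open>Walks avoiding a quadrant\<close>

theorem theorem6:
  shows
    "algebraic_over Q_xyt (fps_to_fls (gf cone_walks))

   \<and> algebraic_of_degree Q_xyt (fps_to_fls (P vx vy)) 72
   \<and> algebraic_of_degree Q_xyt (fps_to_fls (inverse vx * L (inverse vx) vy)) 72
   \<and> algebraic_of_degree Q_xyt (fps_to_fls (inverse vy * B vx (inverse vy))) 72

   \<and> P vx vy = inverse vx * (L vx vy - L 0 vy) + inverse vy * (B vx vy - B vx 0)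

   \<and> (1 - vt * (vx + inverse vx + vy + inverse vy)) * (2 * L vx vy - L 0 vy) =
        1 - 2 * vt * inverse vy * L vx 0 + vt * (vx - inverse vx) * L 0 vy
        + vt * inverse vy * B 0 vy + vt * inverse vy * L 0 0 - vt * inverse vy * B 0 0

   \<and> (1 - vt * (vx + inverse vx + vy + inverse vy)) * (2 * B vx vy - B vx 0) =
        vt * (vy - inverse vy) * B vx 0 - 2 * vt * inverse vx * B 0 vy
        + vt * inverse vx * L vx 0 - vt * inverse vx * L 0 0 + vt * inverse vx * B 0 0

   \<and> algebraic_of_degree Q_xt (fps_to_fls (L vx 0)) 24
   \<and> algebraic_of_degree Q_xt (fps_to_fls (L 0 vx)) 24
   \<and> algebraic_of_degree Q_xt (fps_to_fls (B vx 0)) 24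
   \<and> algebraic_of_degree Q_xt (fps_to_fls (B 0 vx)) 24

   \<and> (\<exists>!T. is_T T)
   \<and> (\<forall>T. is_T T \<longrightarrow>
        (\<exists>!Z. is_Z T Z) \<and> (\<exists>!U. is_U T U) \<and>
        (\<forall>Z' U'. is_Z T Z' \<and> is_U T U' \<longrightarrow>
          (let Z = lift_Q Z'; U = lift_Qx U'; x = fps_to_fls vx;
               L1 = fps_to_fls (L (vx * vt) 0); L2 = fps_to_fls (L 0 (vx * vt));
               B1 = fps_to_fls (B (vx * vt) 0); B2 = fps_to_fls (B 0 (vx * vt))
           in {x, L1, L2, B1, B2} \<subseteq> gen_field {Z, U}
            \<and> L1 = 256 * Z ^ 4 * (U * Z ^ 2 - 2 * Z ^ 2 + U)
                / ((U * Z + Z ^ 2 + U - 3 * Z) * (U + Z) * (Z - 1) * (Z ^ 2 + 3) ^ 3)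
            \<and> x * L2 = 256 * Z ^ 6 * (U - Z) * (U * Z - Z ^ 2 - U - 3 * Z)
                  * (U ^ 2 * Z ^ 2 - Z ^ 4 - 4 * U * Z ^ 2 + U ^ 2 + 3 * Z ^ 2)
                / (poly_D Z U * (Z - 1) * (Z ^ 2 + 3) ^ 3)
            \<and> x * B1 = - (512 * Z ^ 6 * (U * Z ^ 2 - 2 * Z ^ 2 + U) * (U - Z) * poly_N1 Z U
                / ((Z ^ 2 - 1) * (Z ^ 2 + 3) ^ 3 * poly_D Z U))
            \<and> B2 = 16 * Z ^ 2 * (U * Z ^ 2 - 2 * Z ^ 2 + U) * poly_N2 Z U
                / ((U + Z) * (1 - Z ^ 2) * (Z ^ 2 + 3) ^ 3 * (U * Z - Z ^ 2 - U - 3 * Z)))))"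
  by (intro conjI gf_cone_algebraic inner_degree boundary_degree P_equation L_vx_vy_equation B_vx_vy_equation parametrization_theorem)
    simp_all

end
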